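(* Let $K$ be a commutative ring, let $R$ be a $K$-algebra, let $\Lambda$ be a left noetherian subalgebra of $R$, let $s$ be a positive integer and let $q_{ji}\in\Lambda$ for $1\le i<j\le s$. The following statements are equivalent: (i) There is an admissible order $\preceq$ on some $\mathbb{N}^n$ and an $(\mathbb{N}^n,\preceq)$-filtration $F=\{F_\alpha(R)\mid \alpha\in\mathbb{N}^n\}$ on $R$ such that $F_0(R)=\Lambda$, every $F_\alpha(R)$ is finitely generated as a left $\Lambda$-module, and $G^F(R)=\Lambda[y_1;\sigma_1]\cdots[y_s;\sigma_s]$ is an $\mathbb{N}^n$-graded iterated Ore extension for some homogeneous elements $y_1,\dots,y_s$ such that $\sigma_j(y_i)=q_{ji}y_i$ for every $1\le i<j\le s$. (ii) There is an $\mathbb{N}$-filtration $\{R_n\mid n\in\mathbb{N}\}$ on $R$ such that $R_0=\Lambda$, every $R_n$ is finitely generated as a left $\Lambda$-module, and the associated graded algebra $\operatorname{gr}(R)=\Lambda[y_1;\sigma_1]\cdots[y_s;\sigma_s]$ is an $\mathbb{N}$-graded iterated Ore extension for some homogeneous elements $y_1,\dots,y_s$ such that $\sigma_j(y_i)=q_{ji}y_i$ for every $1\le i<j\le s$. (iii) There are elements $x_1,\dots,x_s\in R$, an admissible order $\preceq'$ on $\mathbb{N}^s$, and finite subsets $\Gamma_{ji},\Gamma_k\subseteq\mathbb{N}^s$ ($1\le i<j\le s$, $1\le k\le s$) such that every $\gamma\in\Gamma_{ji}$ satisfies $\gamma\prec'\epsilon_i+\epsilon_j$ and every $\gamma\in\Gamma_k$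 satisfies $\gamma\prec'\epsilon_k$, such that the standard monomials $\{x^\alpha=x_1^{\alpha_1}\cdots x_s^{\alpha_s}\mid \alpha\in\mathbb{N}^s\}$ form a basis of $R$ as a left $\Lambda$-module, and such that $x_jx_i=q_{ji}x_ix_j+\sum_{\alpha\in\Gamma_{ji}}c_\alpha x^\alpha$ for all $1\le i<j\le s$ (with $c_\alpha\in\Lambda$), and for every $a\in\Lambda$ and every $k$ there is $a^{(k)}\in\Lambda$ with $x_ka=a^{(k)}x_k+\sum_{\alpha\in\Gamma_k}c_\alpha x^\alpha$ (with $c_\alpha\in\Lambda$).
   Context: $\mathbb{N}^n$ is the free abelian monoid on $\epsilon_1,\dots,\epsilon_n$ (vectors with nonnegative integer entries). An admissible order on $\mathbb{N}^n$ is a total order compatible with addition such that $0\preceq\alpha$ for all $\alpha$. An $(\mathbb{N}^n,\preceq)$-filtration on a $K$-algebra $R$ is a family $\{F_\alpha(R)\}_{\alpha\in\mathbb{N}^n}$ of $K$-submodules with $F_\alpha(R)\subseteq F_\beta(R)$ for $\alpha\preceq\beta$, $F_\alpha(R)F_\beta(R)\subseteq F_{\alpha+\beta}(R)$, $\bigcup_\alpha F_\alpha(R)=R$ and $1\in F_0(R)$. The associated $\mathbb{N}^n$-graded algebra is $G^F(R)=\bigoplus_\alpha F_\alpha(R)/F_{\prec\alpha}(R)$, where $F_{\prec\alpha}(R)=\bigcup_{\beta\prec\alpha}F_\beta(R)$; for $n=1$ (usual order) this is the usual associated graded algebra $\operatorname{gr}(R)$ of a positive filtration. $\Lambda$ is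 identified with the degree-zero part of the associated graded algebra. $\Lambda[y_1;\sigma_1]\cdots[y_s;\sigma_s]$ denotes an iterated Ore extension without derivations: $\sigma_j$ is a ring endomorphism of $\Lambda[y_1;\sigma_1]\cdots[y_{j-1};\sigma_{j-1}]$ and $y_jr=\sigma_j(r)y_j$ for all $r$ in that ring. *)

theory Defs
  imports "HOL-Algebra.Algebra"
begin

definition Nvec :: "nat \<Rightarrow> (nat \<Rightarrow> nat) set" where
  "Nvec n = {\<alpha>. \<forall>i. \<alpha> i \<noteq> 0 \<longrightarrow> i \<in> {1..n}}"

definition vzero :: "nat \<Rightarrow> nat" where
  "vzero = (\<lambda>_. 0)"

definition vadd :: "(nat \<Rightarrow> nat) \<Rightarrow> (nat \<Rightarrow> nat) \<Rightarrow> (nat \<Rightarrow> nat)" where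
  "vadd \<alpha> \<beta> = (\<lambda>i. \<alpha> i + \<beta> i)"

definition unitvec :: "nat \<Rightarrow> (nat \<Rightarrow> nat)" where
  "unitvec k = (\<lambda>i. if i = k then 1 else 0)"

definition admissible_order :: "nat \<Rightarrow> ((nat \<Rightarrow> nat) \<Rightarrow> (nat \<Rightarrow> nat) \<Rightarrow> bool) \<Rightarrow> bool" where
  "admissible_order n ordr \<longleftrightarrow>
     (\<forall>\<alpha>\<in>Nvec n. ordr \<alpha> \<alpha>) \<and>
     (\<forall>\<alpha>\<in>Nvec n. \<forall>\<beta>\<in>Nvec n. ordr \<alpha> \<beta> \<and> ordr \<beta> \<alpha> \<longrightarrow> \<alpha> = \<beta>) \<and>
     (\<forall>\<alpha>\<in>Nvec n. \<forall>\<beta>\<in>Nvec n. \<forall>\<gamma>\<in>Nvec n. ordr \<alpha> \<beta> \<and> ordr \<beta> \<gamma> \<longrightarrow> ordr \<alpha> \<gamma>) \<and>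
     (\<forall>\<alpha>\<in>Nvec n. \<forall>\<beta>\<in>Nvec n. ordr \<alpha> \<beta> \<or> ordr \<beta> \<alpha>) \<and>
     (\<forall>\<alpha>\<in>Nvec n. \<forall>\<beta>\<in>Nvec n. \<forall>\<gamma>\<in>Nvec n. ordr \<alpha> \<beta> \<longrightarrow> ordr (vadd \<alpha> \<gamma>) (vadd \<beta> \<gamma>)) \<and>
     (\<forall>\<alpha>\<in>Nvec n. ordr vzero \<alpha>)"

definition K_algebra :: "('k,'c) ring_scheme \<Rightarrow> ('k \<Rightarrow> 'r) \<Rightarrow> ('r,'b) ring_scheme \<Rightarrow> bool" where
  "K_algebra K \<phi> R \<longleftrightarrow> cring K \<and> ring R \<and> \<phi> \<in> ring_hom K R \<and>
     (\<forall>k\<in>carrier K. \<forall>r\<in>carrier R. \<phi> k \<otimes>\<^bsub>R\<^esub> r = r \<otimes>\<^bsub>R\<^esub> \<phi> k)"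

definition K_submodule :: "('k,'c) ring_scheme \<Rightarrow> ('k \<Rightarrow> 'r) \<Rightarrow> ('r,'b) ring_scheme \<Rightarrow> 'r set \<Rightarrow> bool" where
  "K_submodule K \<phi> R M \<longleftrightarrow> additive_subgroup M R \<and>
     (\<forall>k\<in>carrier K. \<forall>m\<in>M. \<phi> k \<otimes>\<^bsub>R\<^esub> m \<in> M)"

definition K_subalgebra :: "('k,'c) ring_scheme \<Rightarrow> ('k \<Rightarrow> 'r) \<Rightarrow> ('r,'b) ring_scheme \<Rightarrow> 'r set \<Rightarrow> bool" where
  "K_subalgebra K \<phi> R L \<longleftrightarrow> subring L R \<and> \<phi> ` carrier K \<subseteq> L"

definition left_span :: "('r,'b) ring_scheme \<Rightarrow> 'r set \<Rightarrow> 'r set \<Rightarrow> 'r set" where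
  "left_span R L S = {finsum R (\<lambda>x. a x \<otimes>\<^bsub>R\<^esub> x) S | a. a \<in> S \<rightarrow> L}"

definition fin_gen_left :: "('r,'b) ring_scheme \<Rightarrow> 'r set \<Rightarrow> 'r set \<Rightarrow> bool" where
  "fin_gen_left R L M \<longleftrightarrow> (\<exists>S. finite S \<and> S \<subseteq> M \<and> M = left_span R L S)"

definition left_ideal_of :: "('r,'b) ring_scheme \<Rightarrow> 'r set \<Rightarrow> 'r set \<Rightarrow> bool" where
  "left_ideal_of R L J \<longleftrightarrow> J \<subseteq> L \<and> additive_subgroup J R \<and>
     (\<forall>a\<in>L. \<forall>x\<in>J. a \<otimes>\<^bsub>R\<^esub> x \<in> J)"

definition left_noetherian :: "('r,'b) ring_scheme \<Rightarrow> 'r set \<Rightarrow> bool" where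
  "left_noetherian R L \<longleftrightarrow> (\<forall>J. left_ideal_of R L J \<longrightarrow> fin_gen_left R L J)"

definition left_basis :: "('r,'b) ring_scheme \<Rightarrow> 'r set \<Rightarrow> 'i set \<Rightarrow> ('i \<Rightarrow> 'r) \<Rightarrow> 'r set \<Rightarrow> bool" where
  "left_basis R A I b M \<longleftrightarrow>
     (\<forall>m\<in>M. \<exists>!c. (\<forall>i. c i \<in> (if i \<in> I then A else {\<zero>\<^bsub>R\<^esub>})) \<and>
                 finite {i. c i \<noteq> \<zero>\<^bsub>R\<^esub>} \<and>
                 m = finsum R (\<lambda>i. c i \<otimes>\<^bsub>R\<^esub> b i) {i. c i \<noteq> \<zero>\<^bsub>R\<^esub>})"

definition is_filtration :: "('k,'c) ring_scheme \<Rightarrow> ('k \<Rightarrow> 'r) \<Rightarrow> ('r,'b) ring_scheme \<Rightarrow> nat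
    \<Rightarrow> ((nat \<Rightarrow> nat) \<Rightarrow> (nat \<Rightarrow> nat) \<Rightarrow> bool) \<Rightarrow> ((nat \<Rightarrow> nat) \<Rightarrow> 'r set) \<Rightarrow> bool" where
  "is_filtration K \<phi> R n ordr F \<longleftrightarrow>
     (\<forall>\<alpha>\<in>Nvec n. K_submodule K \<phi> R (F \<alpha>)) \<and>
     (\<forall>\<alpha>\<in>Nvec n. \<forall>\<beta>\<in>Nvec n. ordr \<alpha> \<beta> \<longrightarrow> F \<alpha> \<subseteq> F \<beta>) \<and>
     (\<forall>\<alpha>\<in>Nvec n. \<forall>\<beta>\<in>Nvec n. \<forall>a\<in>F \<alpha>. \<forall>b\<in>F \<beta>. a \<otimes>\<^bsub>R\<^esub> b \<in> F (vadd \<alpha> \<beta>)) \<and>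
     (\<Union>\<alpha>\<in>Nvec n. F \<alpha>) = carrier R \<and>
     \<one>\<^bsub>R\<^esub> \<in> F vzero"

text \<open>F_{<alpha} (together with 0, so that F_{<0} = 0).\<close>
definition Fprec :: "('r,'b) ring_scheme \<Rightarrow> nat \<Rightarrow> ((nat \<Rightarrow> nat) \<Rightarrow> (nat \<Rightarrow> nat) \<Rightarrow> bool)
    \<Rightarrow> ((nat \<Rightarrow> nat) \<Rightarrow> 'r set) \<Rightarrow> (nat \<Rightarrow> nat) \<Rightarrow> 'r set" where
  "Fprec R n ordr F \<alpha> = insert \<zero>\<^bsub>R\<^esub> (\<Union>\<beta>\<in>{\<beta>\<in>Nvec n. ordr \<beta> \<alpha> \<and> \<beta> \<noteq> \<alpha>}. F \<beta>)"

definition rees :: "('r,'b) ring_scheme \<Rightarrow> nat \<Rightarrow> ((nat \<Rightarrow> nat) \<Rightarrow> 'r set) \<Rightarrow> ((nat \<Rightarrow> nat) \<Rightarrow> 'r) ring" where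
  "rees R n F = \<lparr> carrier = {f. (\<forall>\<alpha>. f \<alpha> \<in> (if \<alpha> \<in> Nvec n then F \<alpha> else {\<zero>\<^bsub>R\<^esub>})) \<and>
                                finite {\<alpha>. f \<alpha> \<noteq> \<zero>\<^bsub>R\<^esub>}},
                 monoid.mult = (\<lambda>f g \<gamma>. if \<gamma> \<in> Nvec n
                           then finsum R (\<lambda>\<alpha>. f \<alpha> \<otimes>\<^bsub>R\<^esub> g (\<lambda>i. \<gamma> i - \<alpha> i)) {\<alpha>. \<forall>i. \<alpha> i \<le> \<gamma> i}
                           else \<zero>\<^bsub>R\<^esub>),
                 monoid.one = (\<lambda>\<alpha>. if \<alpha> = vzero then \<one>\<^bsub>R\<^esub> else \<zero>\<^bsub>R\<^esub>),
                 ring.zero = (\<lambda>\<alpha>. \<zero>\<^bsub>R\<^esub>),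
                 ring.add = (\<lambda>f g \<alpha>. f \<alpha> \<oplus>\<^bsub>R\<^esub> g \<alpha>) \<rparr>"

definition rees_lower :: "('r,'b) ring_scheme \<Rightarrow> nat \<Rightarrow> ((nat \<Rightarrow> nat) \<Rightarrow> (nat \<Rightarrow> nat) \<Rightarrow> bool)
    \<Rightarrow> ((nat \<Rightarrow> nat) \<Rightarrow> 'r set) \<Rightarrow> ((nat \<Rightarrow> nat) \<Rightarrow> 'r) set" where
  "rees_lower R n ordr F = {f \<in> carrier (rees R n F). \<forall>\<alpha>\<in>Nvec n. f \<alpha> \<in> Fprec R n ordr F \<alpha>}"

text \<open>G^F(R) = (direct sum of F_alpha) / (direct sum of F_{<alpha}) = direct sum of F_alpha / F_{<alpha}.\<close>
definition assoc_graded :: "('r,'b) ring_scheme \<Rightarrow> nat \<Rightarrow> ((nat \<Rightarrow> nat) \<Rightarrow> (nat \<Rightarrow> nat) \<Rightarrow> bool)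
    \<Rightarrow> ((nat \<Rightarrow> nat) \<Rightarrow> 'r set) \<Rightarrow> ((nat \<Rightarrow> nat) \<Rightarrow> 'r) set ring" where
  "assoc_graded R n ordr F = rees R n F Quot rees_lower R n ordr F"

definition gclass :: "('r,'b) ring_scheme \<Rightarrow> nat \<Rightarrow> ((nat \<Rightarrow> nat) \<Rightarrow> (nat \<Rightarrow> nat) \<Rightarrow> bool)
    \<Rightarrow> ((nat \<Rightarrow> nat) \<Rightarrow> 'r set) \<Rightarrow> (nat \<Rightarrow> nat) \<Rightarrow> 'r \<Rightarrow> ((nat \<Rightarrow> nat) \<Rightarrow> 'r) set" where
  "gclass R n ordr F \<alpha> r = a_r_coset (rees R n F) (rees_lower R n ordr F)
                           (\<lambda>\<beta>. if \<beta> = \<alpha> then r else \<zero>\<^bsub>R\<^esub>)"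

definition gembed :: "('r,'b) ring_scheme \<Rightarrow> nat \<Rightarrow> ((nat \<Rightarrow> nat) \<Rightarrow> (nat \<Rightarrow> nat) \<Rightarrow> bool)
    \<Rightarrow> ((nat \<Rightarrow> nat) \<Rightarrow> 'r set) \<Rightarrow> 'r \<Rightarrow> ((nat \<Rightarrow> nat) \<Rightarrow> 'r) set" where
  "gembed R n ordr F a = gclass R n ordr F vzero a"

definition homogeneous :: "('r,'b) ring_scheme \<Rightarrow> nat \<Rightarrow> ((nat \<Rightarrow> nat) \<Rightarrow> (nat \<Rightarrow> nat) \<Rightarrow> bool)
    \<Rightarrow> ((nat \<Rightarrow> nat) \<Rightarrow> 'r set) \<Rightarrow> ((nat \<Rightarrow> nat) \<Rightarrow> 'r) set \<Rightarrow> bool" where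
  "homogeneous R n ordr F g \<longleftrightarrow> (\<exists>\<delta>\<in>Nvec n. \<exists>r\<in>F \<delta>. g = gclass R n ordr F \<delta> r)"

definition ore_step :: "('g,'c) ring_scheme \<Rightarrow> 'g set \<Rightarrow> 'g \<Rightarrow> ('g \<Rightarrow> 'g) \<Rightarrow> 'g set \<Rightarrow> bool" where
  "ore_step G A y \<sigma> B \<longleftrightarrow>
     y \<in> carrier G \<and> A \<subseteq> B \<and> y \<in> B \<and>
     \<sigma> \<in> ring_hom (G\<lparr>carrier := A\<rparr>) (G\<lparr>carrier := A\<rparr>) \<and>
     (\<forall>a\<in>A. y \<otimes>\<^bsub>G\<^esub> a = \<sigma> a \<otimes>\<^bsub>G\<^esub> y) \<and>
     left_basis G A (UNIV :: nat set) (\<lambda>k. y [^]\<^bsub>G\<^esub> k) B"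

definition ore_stage :: "('g,'c) ring_scheme \<Rightarrow> 'g set \<Rightarrow> (nat \<Rightarrow> 'g) \<Rightarrow> nat \<Rightarrow> 'g set" where
  "ore_stage G A y j = generate_ring G (A \<union> y ` {1..j})"

definition graded_iter_ore :: "('r,'b) ring_scheme \<Rightarrow> 'r set \<Rightarrow> nat \<Rightarrow> ((nat \<Rightarrow> nat) \<Rightarrow> (nat \<Rightarrow> nat) \<Rightarrow> bool)
    \<Rightarrow> ((nat \<Rightarrow> nat) \<Rightarrow> 'r set) \<Rightarrow> nat \<Rightarrow> (nat \<Rightarrow> nat \<Rightarrow> 'r) \<Rightarrow> bool" where
  "graded_iter_ore R L n ordr F s q \<longleftrightarrow>
     (let G = assoc_graded R n ordr F; \<iota> = gembed R n ordr F in
      \<exists>y. (\<forall>i\<in>{1..s}. y i \<in> carrier G \<and> homogeneous R n ordr F (y i)) \<and>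
          carrier G = ore_stage G (\<iota> ` L) y s \<and>
          (\<forall>j\<in>{1..s}. \<exists>\<sigma>. ore_step G (ore_stage G (\<iota> ` L) y (j - 1)) (y j) \<sigma> (ore_stage G (\<iota> ` L) y j) \<and>
                          (\<forall>i\<in>{1..<j}. \<sigma> (y i) = \<iota> (q j i) \<otimes>\<^bsub>G\<^esub> y i)))"

definition std_monom :: "('r,'b) ring_scheme \<Rightarrow> (nat \<Rightarrow> 'r) \<Rightarrow> nat \<Rightarrow> (nat \<Rightarrow> nat) \<Rightarrow> 'r" where
  "std_monom R x s \<alpha> = foldr (\<lambda>k p. (x k [^]\<^bsub>R\<^esub> \<alpha> k) \<otimes>\<^bsub>R\<^esub> p) [1..<Suc s] \<one>\<^bsub>R\<^esub>"

end

theory Submission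
  imports Defs
begin

text \<open>
  From (i) to (iii): lift the homogeneous variables \<open>y\<^sub>i\<close> of degree \<open>\<delta>\<^sub>i\<close> to elements \<open>x\<^sub>i\<close> of the filtration.
  An admissible order is a well-order, so comparing leading terms shows that the standard
  monomials in the \<open>x\<^sub>i\<close> form a basis because those in the \<open>y\<^sub>i\<close> do, and that an element of
  \<open>F\<^sub>\<prec>\<^sub>\<alpha>\<close> only involves monomials \<open>x\<^sup>\<gamma>\<close> of degree \<open>\<Sum> \<gamma>\<^sub>i \<delta>\<^sub>i \<prec> \<alpha>\<close>. The relations of the Ore extension thus
  hold in \<open>R\<close> up to lower terms, for the order on \<open>\<nat>\<^sup>s\<close> that compares degrees first. The
  supports can be chosen independently of the coefficient because \<open>F\<^sub>\<alpha>\<close> is finitely generated.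

  From (iii) to (ii): only finitely many comparisons \<open>\<gamma> \<prec>' \<epsilon>\<^sub>i + \<epsilon>\<^sub>j\<close> and \<open>\<gamma> \<prec>' \<epsilon>\<^sub>k\<close> occur, and by
  Gordan's theorem of the alternative they are realised by positive integer weights \<open>w\<close>. The
  spans \<open>R\<^sub>m\<close> of the monomials of weight at most \<open>m\<close> form the required filtration.
\<close>

section \<open>Admissible orders and weights\<close>

text \<open>Nothing in \<open>ore_step\<close> says that \<sigma> preserves degrees, so on the way
  to (iii) the value of \<sigma> at the class of a scalar is known only as a combination of
  monomials in the earlier variables. Comparing components in the degree of \<open>y k\<close> keeps
  just the monomials of degree 0. Only the constant one is left, because no variable has degree 0:
  such a variable would lift into \<Lambda>, against the independence of 1 and \<open>x k\<close>.
  This fails in the zero ring, which is treated apart. On the way to (ii) the obstacle is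
  multiplicativity of the weight filtration. Sorting a product leaves remainders of smaller weight,
  both from swapping variables and from moving a variable past a scalar, and these remainders
  produce new products to be sorted. The induction therefore runs on the weight and, for fixed
  weight, on the index of the variable that is multiplied in. Gordan's theorem applies because the
  differences v - u with u below v are closed under addition and never 0.\<close>

lemma Nvec_iff: "\<alpha> \<in> Nvec n \<longleftrightarrow> (\<forall>i. i \<notin> {1..n} \<longrightarrow> \<alpha> i = 0)"
  unfolding Nvec_def by auto

lemma vzero_in_Nvec [simp]: "vzero \<in> Nvec n"
  by (simp add: Nvec_iff vzero_def)

lemma vadd_in_Nvec [simp]: "\<alpha> \<in> Nvec n \<Longrightarrow> \<beta> \<in> Nvec n \<Longrightarrow> vadd \<alpha> \<beta> \<in> Nvec n"
  by (auto simp: Nvec_iff vadd_def)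

lemma unitvec_in_Nvec [simp]: "k \<in> {1..n} \<Longrightarrow> unitvec k \<in> Nvec n"
  by (auto simp: Nvec_iff unitvec_def)

lemma vadd_comm: "vadd \<alpha> \<beta> = vadd \<beta> \<alpha>"
  by (auto simp: vadd_def)

lemma vadd_vzero [simp]: "vadd vzero \<alpha> = \<alpha>" "vadd \<alpha> vzero = \<alpha>"
  by (auto simp: vadd_def vzero_def)

lemma vadd_right_cancel [simp]: "vadd \<alpha> \<gamma> = vadd \<beta> \<gamma> \<longleftrightarrow> \<alpha> = \<beta>"
  by (auto simp: vadd_def fun_eq_iff)

lemma Nvec_le: "\<gamma> \<in> Nvec n \<Longrightarrow> \<forall>i. \<alpha> i \<le> \<gamma> i \<Longrightarrow> \<alpha> \<in> Nvec n"
  unfolding Nvec_iff by (metis le_zero_eq)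

lemma Nvec_minus: "\<gamma> \<in> Nvec n \<Longrightarrow> (\<lambda>i. \<gamma> i - \<alpha> i) \<in> Nvec n"
  by (auto simp: Nvec_iff)

lemma Nvec_mono: "j \<le> s \<Longrightarrow> Nvec j \<subseteq> Nvec s"
  by (auto simp: Nvec_iff)

lemma finite_Nvec_bounded: "finite {\<alpha> \<in> Nvec n. \<forall>i. \<alpha> i \<le> (b::nat)}"
proof -
  have "{\<alpha> \<in> Nvec n. \<forall>i. \<alpha> i \<le> b} \<subseteq>
      {\<alpha>. \<forall>i. (i \<in> {1..n} \<longrightarrow> \<alpha> i \<in> {..b}) \<and> (i \<notin> {1..n} \<longrightarrow> \<alpha> i = 0)}"
    by (auto simp: Nvec_iff)
  then show ?thesis
    by (rule finite_subset) (rule finite_set_of_finite_funs, auto)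
qed

text \<open>Each entry is bounded by the sum of all entries of \<gamma>. These boxes index the
  convolution sums of the Rees ring; a \<open>finsum\<close> over an infinite set would be 0 by
  convention.\<close>

lemma finite_vectors_below:
  assumes "\<gamma> \<in> Nvec n"
  shows "finite {\<alpha>. \<forall>i. \<alpha> i \<le> \<gamma> i}"
proof -
  have le: "\<gamma> i \<le> (\<Sum>k\<in>{1..n}. \<gamma> k)" for i
    using assms member_le_sum[of i "{1..n}" \<gamma>] by (cases "i \<in> {1..n}") (auto simp: Nvec_iff)
  have "{\<alpha>. \<forall>i. \<alpha> i \<le> \<gamma> i} \<subseteq> {\<alpha> \<in> Nvec n. \<forall>i. \<alpha> i \<le> (\<Sum>k\<in>{1..n}. \<gamma> k)}"
    using assms Nvec_le le order_trans by blast
  then show ?thesis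
    using finite_Nvec_bounded by (rule finite_subset)
qed

section \<open>Elementary consequences of admissibility\<close>

locale adm_order =
  fixes n :: nat and ordr :: "(nat \<Rightarrow> nat) \<Rightarrow> (nat \<Rightarrow> nat) \<Rightarrow> bool"
  assumes adm: "admissible_order n ordr"
begin

definition prec where "prec \<alpha> \<beta> \<longleftrightarrow> ordr \<alpha> \<beta> \<and> \<alpha> \<noteq> \<beta>"

lemma ordr_refl: "\<alpha> \<in> Nvec n \<Longrightarrow> ordr \<alpha> \<alpha>"
  and ordr_antisym: "\<lbrakk>\<alpha> \<in> Nvec n; \<beta> \<in> Nvec n; ordr \<alpha> \<beta>; ordr \<beta> \<alpha>\<rbrakk> \<Longrightarrow> \<alpha> = \<beta>"
  and ordr_trans: "\<lbrakk>\<alpha> \<in> Nvec n; \<beta> \<in> Nvec n; \<gamma> \<in> Nvec n; ordr \<alpha> \<beta>; ordr \<beta> \<gamma>\<rbrakk> \<Longrightarrow> ordr \<alpha> \<gamma>"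
  and ordr_total: "\<lbrakk>\<alpha> \<in> Nvec n; \<beta> \<in> Nvec n\<rbrakk> \<Longrightarrow> ordr \<alpha> \<beta> \<or> ordr \<beta> \<alpha>"
  and ordr_add: "\<lbrakk>\<alpha> \<in> Nvec n; \<beta> \<in> Nvec n; \<gamma> \<in> Nvec n; ordr \<alpha> \<beta>\<rbrakk> \<Longrightarrow> ordr (vadd \<alpha> \<gamma>) (vadd \<beta> \<gamma>)"
  and ordr_vzero: "\<alpha> \<in> Nvec n \<Longrightarrow> ordr vzero \<alpha>"
  using adm unfolding admissible_order_def by blast+

lemma prec_trans:
  "\<lbrakk>\<alpha> \<in> Nvec n; \<beta> \<in> Nvec n; \<gamma> \<in> Nvec n; prec \<alpha> \<beta>; prec \<beta> \<gamma>\<rbrakk> \<Longrightarrow> prec \<alpha> \<gamma>"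
  unfolding prec_def using ordr_trans ordr_antisym by metis

lemma prec_ordr_trans:
  "\<lbrakk>\<alpha> \<in> Nvec n; \<beta> \<in> Nvec n; \<gamma> \<in> Nvec n; prec \<alpha> \<beta>; ordr \<beta> \<gamma>\<rbrakk> \<Longrightarrow> prec \<alpha> \<gamma>"
  unfolding prec_def using ordr_trans ordr_antisym by metis

lemma prec_add: "\<lbrakk>\<alpha> \<in> Nvec n; \<beta> \<in> Nvec n; \<gamma> \<in> Nvec n; prec \<alpha> \<beta>\<rbrakk> \<Longrightarrow> prec (vadd \<alpha> \<gamma>) (vadd \<beta> \<gamma>)"
  unfolding prec_def using ordr_add by auto

lemma not_prec: "\<lbrakk>\<alpha> \<in> Nvec n; \<beta> \<in> Nvec n; \<not> prec \<alpha> \<beta>\<rbrakk> \<Longrightarrow> ordr \<beta> \<alpha>"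
  unfolding prec_def using ordr_total ordr_refl by metis

lemma prec_not_ordr: "\<lbrakk>\<alpha> \<in> Nvec n; \<beta> \<in> Nvec n; prec \<alpha> \<beta>\<rbrakk> \<Longrightarrow> \<not> ordr \<beta> \<alpha>"
  unfolding prec_def using ordr_antisym by blast

lemma prec_add_both:
  assumes "\<alpha> \<in> Nvec n" "\<beta> \<in> Nvec n" "\<alpha>' \<in> Nvec n" "\<beta>' \<in> Nvec n" "prec \<alpha> \<beta>" "prec \<alpha>' \<beta>'"
  shows "prec (vadd \<alpha> \<alpha>') (vadd \<beta> \<beta>')"
proof -
  have "prec (vadd \<alpha> \<alpha>') (vadd \<beta> \<alpha>')"
    using assms prec_add by blast
  moreover have "prec (vadd \<beta> \<alpha>') (vadd \<beta> \<beta>')"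
    using assms prec_add vadd_comm by metis
  ultimately show ?thesis
    using assms by (meson prec_trans vadd_in_Nvec)
qed

text \<open>Add \<alpha> to both sides of 0 \<le> \<beta> - \<alpha>. This is the link between an
  admissible order and Dickson's lemma.\<close>

lemma ordr_pointwise:
  assumes "\<alpha> \<in> Nvec n" "\<beta> \<in> Nvec n" "\<forall>i. \<alpha> i \<le> \<beta> i"
  shows "ordr \<alpha> \<beta>"
proof -
  have "ordr (vadd vzero \<alpha>) (vadd (\<lambda>i. \<beta> i - \<alpha> i) \<alpha>)"
    using assms by (intro ordr_add ordr_vzero Nvec_minus) auto
  moreover have "vadd (\<lambda>i. \<beta> i - \<alpha> i) \<alpha> = \<beta>"
    using assms by (auto simp: vadd_def)
  ultimately show ?thesis by simp
qed

text \<open>Supplies the top degree of a finite set of terms in leading-term arguments.\<close>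

lemma finite_has_maximal:
  assumes "finite S" "S \<noteq> {}" "S \<subseteq> Nvec n"
  shows "\<exists>\<mu>\<in>S. \<forall>\<alpha>\<in>S. ordr \<alpha> \<mu>"
  using assms
proof (induction rule: finite_ne_induct)
  case (singleton x)
  then show ?case by (auto intro: ordr_refl)
next
  case (insert x S)
  then obtain \<mu> where \<mu>: "\<mu> \<in> S" "\<forall>\<alpha>\<in>S. ordr \<alpha> \<mu>" by auto
  show ?case
  proof (cases "ordr x \<mu>")
    case True
    then show ?thesis using \<mu> by auto
  next
    case False
    then have x: "ordr \<mu> x" using ordr_total insert.prems \<mu>(1) by blast
    then have "\<forall>\<alpha>\<in>S. ordr \<alpha> x"
      using \<mu> insert.prems ordr_trans by (meson insert_subset subset_iff)
    then show ?thesis using insert.prems ordr_refl by auto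
  qed
qed

end

section \<open>Dickson's lemma\<close>

text \<open>Some subsequence is monotone. If it is nonincreasing, it is constant from the index on
  where its least value is attained, and its tail is then nondecreasing.\<close>

lemma nat_seq_mono_subseq:
  fixes f :: "nat \<Rightarrow> nat"
  shows "\<exists>r :: nat \<Rightarrow> nat. strict_mono r \<and> mono (f \<circ> r)"
proof -
  obtain r :: "nat \<Rightarrow> nat" where r: "strict_mono r" "monoseq (\<lambda>n. f (r n))"
    using seq_monosub[of f] by (auto simp: strict_mono_def)
  show ?thesis
  proof (cases "mono (f \<circ> r)")
    case True
    then show ?thesis using r by blast
  next
    case False
    then have dec: "\<forall>m. \<forall>n\<ge>m. f (r n) \<le> f (r m)"
      using r(2) unfolding monoseq_def mono_def by auto
    obtain N where N: "\<forall>k. f (r N) \<le> f (r k)"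
      using ex_has_least_nat[of "\<lambda>_. True" 0 "\<lambda>k. f (r k)"] by auto
    have "strict_mono (\<lambda>k. r (N + k))"
      using r(1) by (auto simp: strict_mono_def)
    moreover have "f (r (N + k)) = f (r N)" for k
      using dec N by (metis le_add1 le_antisym)
    then have "mono (f \<circ> (\<lambda>k. r (N + k)))"
      by (auto simp: mono_def)
    ultimately show ?thesis by blast
  qed
qed

text \<open>Dickson's lemma in sequence form: thin out one coordinate at a time. Coordinates that
  are already monotone stay so on a further subsequence.\<close>

lemma vector_seq_mono_subseq:
  fixes f :: "nat \<Rightarrow> nat \<Rightarrow> nat"
  shows "\<exists>r :: nat \<Rightarrow> nat. strict_mono r \<and> (\<forall>k\<in>{1..n}. mono (\<lambda>i. f (r i) k))"
proof (induction n)
  case 0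
  have "strict_mono (id :: nat \<Rightarrow> nat)" by (simp add: strict_mono_def)
  then show ?case by auto
next
  case (Suc n)
  then obtain r :: "nat \<Rightarrow> nat" where r: "strict_mono r" "\<forall>k\<in>{1..n}. mono (\<lambda>i. f (r i) k)" by blast
  obtain t :: "nat \<Rightarrow> nat" where t: "strict_mono t" "mono ((\<lambda>i. f (r i) (Suc n)) \<circ> t)"
    using nat_seq_mono_subseq by blast
  have "strict_mono (r \<circ> t)" using r t strict_mono_o by blast
  moreover have "mono (\<lambda>i. f ((r \<circ> t) i) k)" if "k \<in> {1..Suc n}" for k
  proof (cases "k = Suc n")
    case True
    then show ?thesis using t(2) by (simp add: comp_def)
  next
    case False
    then have "mono (\<lambda>i. f (r i) k)" using r that by auto
    then show ?thesis
      using strict_mono_mono[OF t(1)] by (auto simp: mono_def)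
  qed
  ultimately show ?case by blast
qed

text \<open>Dickson's lemma makes an admissible order a well-order.\<close>
lemma (in adm_order) wf_prec: "wf {(\<alpha>, \<beta>). \<alpha> \<in> Nvec n \<and> \<beta> \<in> Nvec n \<and> prec \<alpha> \<beta>}"
proof (rule ccontr)
  assume "\<not> ?thesis"
  then obtain f where f: "\<And>i. f i \<in> Nvec n" "\<And>i. prec (f (Suc i)) (f i)"
    unfolding wf_iff_no_infinite_down_chain by auto
  have dec: "prec (f j) (f i)" if "i < j" for i j
    using that
  proof (induction j)
    case (Suc j)
    show ?case
    proof (cases "i = j")
      case True
      then show ?thesis using f by simp
    next
      case False
      then have "prec (f j) (f i)" using Suc by simp
      then show ?thesis using f prec_trans by blast
    qed
  qed simp
  \<comment> \<open>Two terms of the thinned sequence are comparable pointwise, in the direction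
    opposite to the descending chain.\<close>
  obtain r :: "nat \<Rightarrow> nat" where r: "strict_mono r" "\<forall>k\<in>{1..n}. mono (\<lambda>i. f (r i) k)"
    using vector_seq_mono_subseq by blast
  have "\<forall>k. f (r 0) k \<le> f (r 1) k"
    using r(2) f(1) unfolding mono_def Nvec_iff by (metis le0 order_refl)
  then have "ordr (f (r 0)) (f (r 1))"
    using f ordr_pointwise by blast
  moreover have "prec (f (r 1)) (f (r 0))"
    using dec r(1) by (simp add: strict_mono_def)
  ultimately show False using f prec_not_ordr by blast
qed

section \<open>Pulling back an admissible order along the degree\<close>

definition lex_le :: "(nat \<Rightarrow> nat) \<Rightarrow> (nat \<Rightarrow> nat) \<Rightarrow> bool" where
  "lex_le \<alpha> \<beta> \<longleftrightarrow> \<alpha> = \<beta> \<or> (\<exists>k. \<alpha> k < \<beta> k \<and> (\<forall>i<k. \<alpha> i = \<beta> i))"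

lemma lex_le_total: "lex_le \<alpha> \<beta> \<or> lex_le \<beta> \<alpha>"
proof (cases "\<alpha> = \<beta>")
  case False
  then have ex: "\<exists>k. \<alpha> k \<noteq> \<beta> k" by auto
  define k where "k = (LEAST k. \<alpha> k \<noteq> \<beta> k)"
  have "\<alpha> k \<noteq> \<beta> k" unfolding k_def using ex by (rule LeastI_ex)
  moreover have "\<forall>i<k. \<alpha> i = \<beta> i" unfolding k_def using not_less_Least by blast
  ultimately show ?thesis
    unfolding lex_le_def by (metis nat_neq_iff)
qed (simp add: lex_le_def)

lemma lex_le_trans:
  assumes "lex_le \<alpha> \<beta>" "lex_le \<beta> \<gamma>"
  shows "lex_le \<alpha> \<gamma>"
proof (cases "\<alpha> = \<beta> \<or> \<beta> = \<gamma>")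
  case False
  then obtain k l where k: "\<alpha> k < \<beta> k" "\<forall>i<k. \<alpha> i = \<beta> i" and l: "\<beta> l < \<gamma> l" "\<forall>i<l. \<beta> i = \<gamma> i"
    using assms unfolding lex_le_def by blast
  have "\<alpha> (min k l) < \<gamma> (min k l)"
    using k l by (cases k l rule: linorder_cases) (auto simp: min_def)
  moreover have "\<forall>i<min k l. \<alpha> i = \<gamma> i"
    using k l by simp
  ultimately show ?thesis unfolding lex_le_def by blast
qed (use assms in auto)

lemma lex_le_antisym:
  assumes "lex_le \<alpha> \<beta>" "lex_le \<beta> \<alpha>"
  shows "\<alpha> = \<beta>"
proof (rule ccontr)
  assume "\<alpha> \<noteq> \<beta>"
  then obtain k l where k: "\<alpha> k < \<beta> k" "\<forall>i<k. \<alpha> i = \<beta> i" and l: "\<beta> l < \<alpha> l" "\<forall>i<l. \<beta> i = \<alpha> i"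
    using assms unfolding lex_le_def by blast
  then show False by (metis less_imp_neq less_asym linorder_neqE_nat)
qed

lemma lex_le_add: "lex_le \<alpha> \<beta> \<Longrightarrow> lex_le (vadd \<alpha> \<gamma>) (vadd \<beta> \<gamma>)"
  unfolding lex_le_def vadd_def by auto

lemma lex_le_vzero: "lex_le vzero \<alpha>"
proof -
  have "\<not> lex_le \<alpha> vzero" if "\<alpha> \<noteq> vzero"
    using that unfolding lex_le_def by (simp add: vzero_def)
  then show ?thesis using lex_le_total unfolding lex_le_def by blast
qed

text \<open>Additivity of \<open>wt\<close> carries over compatibility with addition, and the
  lexicographic order decides between equal degrees. An exponent of strictly smaller degree is
  strictly smaller whatever the tie-breaker says.\<close>

lemma (in adm_order) admissible_order_pullback:
  assumes closed: "\<And>\<alpha>. \<alpha> \<in> Nvec s \<Longrightarrow> wt \<alpha> \<in> Nvec n"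
    and add: "\<And>\<alpha> \<beta>. wt (vadd \<alpha> \<beta>) = vadd (wt \<alpha>) (wt \<beta>)"
    and zero: "wt vzero = vzero"
  shows "admissible_order s (\<lambda>\<alpha> \<beta>. prec (wt \<alpha>) (wt \<beta>) \<or> wt \<alpha> = wt \<beta> \<and> lex_le \<alpha> \<beta>)"
  unfolding admissible_order_def
proof (intro conjI ballI impI, goal_cases)
  case (1 \<alpha>)
  then show ?case by (simp add: lex_le_def)
next
  case (2 \<alpha> \<beta>)
  then show ?case using closed lex_le_antisym prec_not_ordr unfolding prec_def by metis
next
  case (3 \<alpha> \<beta> \<gamma>)
  then have N: "wt \<alpha> \<in> Nvec n" "wt \<beta> \<in> Nvec n" "wt \<gamma> \<in> Nvec n" using closed by auto
  show ?case using 3 prec_trans[OF N] lex_le_trans[of \<alpha> \<beta> \<gamma>] by auto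
next
  case (4 \<alpha> \<beta>)
  then show ?case using closed lex_le_total not_prec unfolding prec_def by metis
next
  case (5 \<alpha> \<beta> \<gamma>)
  then have N: "wt \<alpha> \<in> Nvec n" "wt \<beta> \<in> Nvec n" "wt \<gamma> \<in> Nvec n" using closed by auto
  show ?case using 5 prec_add[OF N] lex_le_add[of \<alpha> \<beta> \<gamma>] add by auto
next
  case (6 \<alpha>)
  have "ordr vzero (wt \<alpha>)" using 6 closed ordr_vzero by blast
  then show ?case by (auto simp: zero prec_def lex_le_vzero)
qed

text \<open>Fourier--Motzkin elimination of the last coordinate.\<close>
lemma gordan:
  fixes P :: "(nat \<Rightarrow> int) \<Rightarrow> bool"
  assumes add: "\<And>d e. P d \<Longrightarrow> P e \<Longrightarrow> P (\<lambda>i. d i + e i)"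
    and nz: "\<not> P (\<lambda>_. 0)"
  shows "finite D \<Longrightarrow> (\<And>d. d \<in> D \<Longrightarrow> P d) \<Longrightarrow> (\<And>d i. d \<in> D \<Longrightarrow> i \<notin> {1..s} \<Longrightarrow> d i = 0) \<Longrightarrow>
    \<exists>w :: nat \<Rightarrow> rat. \<forall>d\<in>D. 0 < (\<Sum>i\<in>{1..s}. w i * of_int (d i))"
proof (induction s arbitrary: D)
  case 0
  \<comment> \<open>Without coordinates every vector is 0, which \<open>P\<close> excludes.\<close>
  have "D = {}"
  proof (rule ccontr)
    assume "D \<noteq> {}"
    then obtain d where d: "d \<in> D" by blast
    then have "d = (\<lambda>_. 0)" using 0(3) by auto
    then show False using nz 0(2) d by metis
  qed
  then show ?case by simp
next
  case (Suc s)
  \<comment> \<open>Iterated addition: \<open>P\<close> is stable under positive integer factors.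
    This is why the elimination stays with integer vectors although the weights are
    rational.\<close>
  have scale: "P (\<lambda>i. int (Suc m) * d i)" if "P d" for d m
  proof (induction m)
    case (Suc m)
    show ?case using add[OF that Suc] by (simp add: algebra_simps)
  qed (use that in simp)
  have scale: "P (\<lambda>i. c * d i)" if "P d" "0 < c" for d c
    using scale[OF that(1), of "nat (c - 1)"] that(2) by simp
  define l where "l = Suc s"
  define Dp where "Dp = {d\<in>D. 0 < d l}"
  define Dn where "Dn = {d\<in>D. d l < 0}"
  \<comment> \<open>For \<open>p\<close> with positive and \<open>m\<close> with negative last
    coordinate, the factors \<open>- m l\<close> and \<open>p l\<close> are positive and cancel that
    coordinate, so all of \<open>D'\<close> lives in dimension \<open>s\<close>.\<close>
  define D' where "D' = {d\<in>D. d l = 0} \<union> (\<lambda>(p, m). (\<lambda>i. (- m l) * p i + p l * m i)) ` (Dp \<times> Dn)"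
  have fin: "finite Dp" "finite Dn" "finite D'"
    unfolding Dp_def Dn_def D'_def using Suc.prems(1) by auto
  have "P d" if "d \<in> D'" for d
    using that unfolding D'_def
  proof
    assume "d \<in> {d\<in>D. d l = 0}"
    then show ?thesis using Suc.prems(2) by simp
  next
    assume "d \<in> (\<lambda>(p, m). (\<lambda>i. (- m l) * p i + p l * m i)) ` (Dp \<times> Dn)"
    then obtain p m where pm: "p \<in> Dp" "m \<in> Dn" "d = (\<lambda>i. (- m l) * p i + p l * m i)" by auto
    then have "P (\<lambda>i. (- m l) * p i)" "P (\<lambda>i. p l * m i)"
      using scale[of p "- m l"] scale[of m "p l"] Suc.prems(2) unfolding Dp_def Dn_def by auto
    then show ?thesis unfolding pm(3) by (rule add)
  qed
  moreover have "d i = 0" if "d \<in> D'" "i \<notin> {1..s}" for d i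
  proof (cases "i = l")
    case True
    then show ?thesis using that(1) unfolding D'_def by auto
  next
    case False
    then have "i \<notin> {1..Suc s}" using that(2) l_def by auto
    then have D: "D \<subseteq> {e. e i = 0}" using Suc.prems(3) by blast
    then show ?thesis using that(1) unfolding D'_def Dp_def Dn_def by (auto dest!: subsetD[OF D])
  qed
  ultimately obtain w where w: "\<forall>d\<in>D'. 0 < (\<Sum>i\<in>{1..s}. w i * (of_int (d i) :: rat))"
    using Suc.IH[OF fin(3)] by blast
  define W where "W d = (\<Sum>i\<in>{1..s}. w i * (of_int (d i) :: rat))" for d
  \<comment> \<open>Once the first \<open>s\<close> weights are fixed, the last weight t has to
    satisfy W d + t d(l) > 0. This is a lower bound for t if d(l) > 0 and an upper bound if d(l) <
    0.\<close>
  define L where "L = (\<lambda>p. - W p / of_int (p l)) ` Dp"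
  define U where "U = (\<lambda>m. W m / of_int (- m l)) ` Dn"
  have LU: "a < b" if "a \<in> L" "b \<in> U" for a b
  proof -
    obtain p m where p: "p \<in> Dp" "a = - W p / of_int (p l)" and m: "m \<in> Dn" "b = W m / of_int (- m l)"
      using \<open>a \<in> L\<close> \<open>b \<in> U\<close> unfolding L_def U_def by auto
    have "(\<lambda>i. (- m l) * p i + p l * m i) \<in> D'"
      using p m unfolding D'_def by auto
    \<comment> \<open>Positivity on the combined vector is the inequality between the two bounds,
      multiplied by the denominators.\<close>
    then have "0 < W (\<lambda>i. (- m l) * p i + p l * m i)" using w unfolding W_def by (rule bspec[rotated])
    also have "W (\<lambda>i. (- m l) * p i + p l * m i) = of_int (- m l) * W p + of_int (p l) * W m"
      unfolding W_def by (simp add: sum_distrib_left sum.distrib[symmetric] algebra_simps sum_subtractf sum_negf)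
    finally have pos: "0 < of_int (- m l) * W p + of_int (p l) * W m" .
    have "(0::rat) < of_int (p l)" "(0::rat) < of_int (- m l)"
      using p m unfolding Dp_def Dn_def by auto
    then show ?thesis using pos unfolding p(2) m(2)
      by (simp only: pos_divide_less_eq times_divide_eq_left pos_less_divide_eq) (simp add: algebra_simps)
  qed
  have "\<exists>t. (\<forall>a\<in>L. a < t) \<and> (\<forall>b\<in>U. t < b)"
  proof -
    have finLU: "finite L" "finite U" unfolding L_def U_def using fin by auto
    show ?thesis
    proof (cases "L = {}")
      case True
      show ?thesis
      proof (cases "U = {}")
        case False
        have "Min U - 1 < b" if "b \<in> U" for b using Min_le[OF finLU(2) that] by linarith
        then show ?thesis using True by blast
      qed (use True in auto)
    next
      case False
      show ?thesis
      proof (cases "U = {}")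
        case True
        have "a < Max L + 1" if "a \<in> L" for a using Max_ge[OF finLU(1) that] by linarith
        then show ?thesis using True by blast
      next
        case False
        have "Max L < Min U" using LU finLU \<open>L \<noteq> {}\<close> False by simp
        then obtain t where "Max L < t" "t < Min U" using dense by blast
        then show ?thesis using finLU \<open>L \<noteq> {}\<close> False by auto
      qed
    qed
  qed
  then obtain t where t: "\<And>a. a \<in> L \<Longrightarrow> a < t" "\<And>b. b \<in> U \<Longrightarrow> t < b" by blast
  have "0 < (\<Sum>i\<in>{1..Suc s}. (w(l := t)) i * of_int (d i))" if d: "d \<in> D" for d
  proof -
    have "(\<Sum>i\<in>{1..Suc s}. (w(l := t)) i * of_int (d i)) = W d + t * of_int (d l)"
    proof -
      have "(\<Sum>i\<in>{1..s}. (w(l := t)) i * of_int (d i)) = W d"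
        unfolding W_def l_def by (rule sum.cong) auto
      then show ?thesis by (simp add: l_def)
    qed
    moreover have "0 < W d + t * of_int (d l)"
    proof -
      consider "d l = 0" | "0 < d l" | "d l < 0" by linarith
      then show ?thesis
      proof cases
        case 1
        then show ?thesis using w d unfolding D'_def W_def by simp
      next
        case 2
        then have "- W d / of_int (d l) < t" using t(1) d unfolding L_def Dp_def by auto
        then show ?thesis using 2 by (simp add: field_simps)
      next
        case 3
        then have "t < W d / of_int (- d l)" using t(2) d unfolding U_def Dn_def by auto
        then show ?thesis using 3 by (simp add: field_simps)
      qed
    qed
    ultimately show ?thesis by simp
  qed
  then show ?case by blast
qed

section \<open>Positive integer weights realising finitely many comparisons\<close>

lemma common_denominator:
  fixes w :: "'i \<Rightarrow> rat"
  assumes "finite I"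
  shows "\<exists>N>0. \<forall>i\<in>I. \<exists>z. of_int N * w i = of_int z"
  using assms
proof (induction rule: finite_induct)
  case empty
  show ?case by (auto intro: exI[of _ 1])
next
  case (insert x I)
  then obtain N where N: "N > 0" "\<forall>i\<in>I. \<exists>z. of_int N * w i = of_int z" by blast
  obtain a b where ab: "w x = of_int a / of_int b" "b > 0"
    using quotient_of_div quotient_of_denom_pos by (cases "quotient_of (w x)") blast
  have "of_int (N * b) * w x = of_int (N * a)" using ab by simp
  moreover have "\<exists>z. of_int (N * b) * w i = of_int z" if i: "i \<in> I" for i
  proof -
    obtain z where "of_int N * w i = of_int z" using bspec[OF N(2) i] by (elim exE)
    then have "of_int (N * b) * w i = of_int (b * z)" by (simp add: algebra_simps)
    then show ?thesis by blast
  qed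
  ultimately have "\<forall>i\<in>insert x I. \<exists>z. of_int (N * b) * w i = of_int z" by blast
  moreover have "N * b > 0" using N ab by simp
  ultimately show ?case by blast
qed

definition vweight :: "nat \<Rightarrow> (nat \<Rightarrow> nat) \<Rightarrow> (nat \<Rightarrow> nat) \<Rightarrow> nat" where
  "vweight s w \<alpha> = (\<Sum>i\<in>{1..s}. w i * \<alpha> i)"

lemma vweight_vadd: "vweight s w (vadd \<alpha> \<beta>) = vweight s w \<alpha> + vweight s w \<beta>"
  by (simp add: vweight_def vadd_def algebra_simps sum.distrib)

lemma vweight_vzero [simp]: "vweight s w vzero = 0"
  by (simp add: vweight_def vzero_def)

lemma vweight_unitvec: "k \<in> {1..s} \<Longrightarrow> vweight s w (unitvec k) = w k"
proof -
  assume "k \<in> {1..s}"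
  moreover have "vweight s w (unitvec k) = (\<Sum>i\<in>{1..s}. if i = k then w k else 0)"
    unfolding vweight_def by (rule sum.cong) (auto simp: unitvec_def)
  ultimately show ?thesis by simp
qed

text \<open>The differences v - u with u below v satisfy the hypotheses of \<open>gordan\<close>:
  sums of strict comparisons are strict comparisons, and 0 is no such difference. The rational
  solution is then multiplied by a common denominator.\<close>

lemma (in adm_order) exists_weight:
  assumes "finite D" "\<And>u v. (u, v) \<in> D \<Longrightarrow> u \<in> Nvec n \<and> v \<in> Nvec n \<and> prec u v"
  shows "\<exists>w. (\<forall>i\<in>{1..n}. 0 < w i) \<and> (\<forall>(u, v)\<in>D. vweight n w u < vweight n w v)"
proof -
  define P where "P d \<longleftrightarrow> (\<exists>u\<in>Nvec n. \<exists>v\<in>Nvec n. prec u v \<and> d = (\<lambda>i. int (v i) - int (u i)))" for d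
  \<comment> \<open>The added comparisons of \<open>vzero\<close> with \<open>unitvec i\<close>
    force every single weight to be positive.\<close>
  define E where "E = (\<lambda>(u, v). (\<lambda>i. int (v i) - int (u i))) ` (D \<union> (\<lambda>i. (vzero, unitvec i)) ` {1..n})"
  have unit: "prec vzero (unitvec i)" if "i \<in> {1..n}" for i
  proof -
    have "vzero \<noteq> unitvec i" by (metis unitvec_def vzero_def zero_neq_one)
    then show ?thesis unfolding prec_def using that ordr_vzero by simp
  qed
  have "\<exists>w :: nat \<Rightarrow> rat. \<forall>d\<in>E. 0 < (\<Sum>i\<in>{1..n}. w i * of_int (d i))"
  proof (rule gordan[of P])
    fix d e assume "P d" "P e"
    then obtain u v u' v' where uv: "u \<in> Nvec n" "v \<in> Nvec n" "prec u v" "d = (\<lambda>i. int (v i) - int (u i))"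
      "u' \<in> Nvec n" "v' \<in> Nvec n" "prec u' v'" "e = (\<lambda>i. int (v' i) - int (u' i))"
      unfolding P_def by blast
    then have "prec (vadd u u') (vadd v v')" by (intro prec_add_both)
    moreover have "(\<lambda>i. d i + e i) = (\<lambda>i. int (vadd v v' i) - int (vadd u u' i))"
      using uv by (auto simp: vadd_def)
    ultimately show "P (\<lambda>i. d i + e i)" unfolding P_def using uv vadd_in_Nvec by blast
  next
    show "\<not> P (\<lambda>_. 0)"
    proof
      assume "P (\<lambda>_. 0)"
      then obtain u v where "prec u v" "(\<lambda>_. 0) = (\<lambda>i. int (v i) - int (u i))" unfolding P_def by blast
      then have "prec u v" "u = v" by (auto simp: fun_eq_iff)
      then show False unfolding prec_def by blast
    qed
  next
    show "finite E" unfolding E_def using assms(1) by auto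
    show "P d" if "d \<in> E" for d
    proof -
      obtain p where p: "p \<in> D \<union> (\<lambda>i. (vzero, unitvec i)) ` {1..n}"
          "d = (\<lambda>i. int (snd p i) - int (fst p i))"
        using \<open>d \<in> E\<close> unfolding E_def by (auto simp: case_prod_beta)
      define u v where "u = fst p" and "v = snd p"
      then have uv: "d = (\<lambda>i. int (v i) - int (u i))" "(u, v) \<in> D \<or> (\<exists>i\<in>{1..n}. u = vzero \<and> v = unitvec i)"
        using p by auto
      then have "u \<in> Nvec n \<and> v \<in> Nvec n \<and> prec u v"
        using assms(2) unit by (metis vzero_in_Nvec unitvec_in_Nvec)
      then show ?thesis unfolding P_def using uv(1) by blast
    qed
    show "d i = 0" if "d \<in> E" "i \<notin> {1..n}" for d i
    proof -
      have "\<forall>(u, v)\<in>D. u i = 0 \<and> v i = 0" using assms(2) that(2) unfolding Nvec_iff by blast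
      then show ?thesis using that unfolding E_def by (auto simp: unitvec_def vzero_def)
    qed
  qed
  then obtain w :: "nat \<Rightarrow> rat" where w: "\<And>d. d \<in> E \<Longrightarrow> 0 < (\<Sum>i\<in>{1..n}. w i * of_int (d i))" by blast
  obtain N where N: "N > 0" "\<forall>i\<in>{1..n}. \<exists>z. of_int N * w i = of_int z"
    using common_denominator[of "{1..n}" w] by blast
  then obtain z where z: "\<And>i. i \<in> {1..n} \<Longrightarrow> of_int N * w i = of_int (z i)" by metis
  have pos: "0 < (\<Sum>i\<in>{1..n}. z i * d i)" if "d \<in> E" for d
  proof -
    have "of_int N * (\<Sum>i\<in>{1..n}. w i * of_int (d i)) = of_int (\<Sum>i\<in>{1..n}. z i * d i)"
      using z by (simp add: sum_distrib_left mult.assoc[symmetric])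
    moreover have "0 < of_int N * (\<Sum>i\<in>{1..n}. w i * of_int (d i))" using w[OF that] N(1) by simp
    ultimately show ?thesis by (simp del: of_int_sum)
  qed
  have zpos: "0 < z i" if "i \<in> {1..n}" for i
  proof -
    have "(\<lambda>j. int (unitvec i j) - int (vzero j)) \<in> E" unfolding E_def using that by force
    from pos[OF this] have "0 < (\<Sum>j\<in>{1..n}. z j * (int (unitvec i j) - int (vzero j)))" .
    also have "\<dots> = (\<Sum>j\<in>{1..n}. if j = i then z i else 0)"
      by (rule sum.cong) (auto simp: unitvec_def vzero_def)
    finally show ?thesis using that by simp
  qed
  define w' where "w' i = nat (z i)" for i
  have w'z: "int (vweight n w' \<alpha>) = (\<Sum>i\<in>{1..n}. z i * int (\<alpha> i))" for \<alpha>
    unfolding vweight_def w'_def using less_imp_le[OF zpos] by (auto intro!: sum.cong)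
  have "vweight n w' u < vweight n w' v" if "(u, v) \<in> D" for u v
  proof -
    have "(\<lambda>i. int (v i) - int (u i)) \<in> E" unfolding E_def using that by force
    from pos[OF this] have "int (vweight n w' u) < int (vweight n w' v)"
      unfolding w'z by (simp add: right_diff_distrib sum_subtractf)
    then show ?thesis by simp
  qed
  moreover have "\<forall>i\<in>{1..n}. 0 < w' i" using zpos by (simp add: w'_def)
  ultimately show ?thesis by blast
qed

section \<open>Spans and independence over a subring\<close>

lemma (in abelian_monoid) finsum_Sigma:
  assumes "finite I" "\<And>i. i \<in> I \<Longrightarrow> finite (J i)"
    "\<And>i j. i \<in> I \<Longrightarrow> j \<in> J i \<Longrightarrow> f (i, j) \<in> carrier G"
  shows "(\<Oplus>p\<in>Sigma I J. f p) = (\<Oplus>i\<in>I. \<Oplus>j\<in>J i. f (i, j))"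
proof -
  have "(\<Oplus>p\<in>(\<Union>i\<in>I. Pair i ` J i). f p) = (\<Oplus>i\<in>I. \<Oplus>p\<in>Pair i ` J i. f p)"
    by (rule add.finprod_UN_disjoint) (use assms in \<open>auto simp: pairwise_def disjnt_def\<close>)
  also have "\<dots> = (\<Oplus>i\<in>I. \<Oplus>j\<in>J i. f (i, j))"
    by (rule finsum_cong')
      (use assms in \<open>auto simp: inj_on_def intro!: finsum_reindex finsum_closed\<close>)
  also have "(\<Union>i\<in>I. Pair i ` J i) = Sigma I J" by auto
  finally show ?thesis .
qed

lemma (in abelian_monoid) finsum_swap:
  assumes "finite I" "finite J" "\<And>i j. i \<in> I \<Longrightarrow> j \<in> J \<Longrightarrow> f i j \<in> carrier G"
  shows "(\<Oplus>i\<in>I. \<Oplus>j\<in>J. f i j) = (\<Oplus>j\<in>J. \<Oplus>i\<in>I. f i j)"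
proof -
  have "(\<Oplus>i\<in>I. \<Oplus>j\<in>J. f i j) = (\<Oplus>p\<in>I \<times> J. f (fst p) (snd p))"
    by (subst finsum_Sigma) (use assms in auto)
  also have "I \<times> J = prod.swap ` (J \<times> I)" by auto
  also have "(\<Oplus>p\<in>prod.swap ` (J \<times> I). f (fst p) (snd p)) = (\<Oplus>p\<in>J \<times> I. f (snd p) (fst p))"
    by (subst finsum_reindex) (use assms in auto)
  also have "\<dots> = (\<Oplus>j\<in>J. \<Oplus>i\<in>I. f i j)"
    by (subst finsum_Sigma) (use assms in auto)
  finally show ?thesis .
qed

lemma (in ring) finsum_minus:
  assumes "finite J" "f \<in> J \<rightarrow> carrier R"
  shows "(\<Oplus>i\<in>J. \<ominus> f i) = \<ominus> (\<Oplus>i\<in>J. f i)"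
  using assms
proof (induction rule: finite_induct)
  case (insert x J)
  then have "f x \<in> carrier R" "f \<in> J \<rightarrow> carrier R" by auto
  then show ?case using insert by (simp add: minus_add Pi_def finsum_closed)
qed simp

lemma (in abelian_group) additive_subgroup_finsum:
  assumes "additive_subgroup H G" "finite J" "\<And>i. i \<in> J \<Longrightarrow> f i \<in> H"
  shows "(\<Oplus>i\<in>J. f i) \<in> H"
proof -
  interpret H: additive_subgroup H G by fact
  show ?thesis using assms(2,3)
  proof (induction rule: finite_induct)
    case (insert x J)
    then have "(\<Oplus>i\<in>insert x J. f i) = f x \<oplus> (\<Oplus>i\<in>J. f i)"
      using H.a_Hcarr by (intro finsum_insert) auto
    then show ?case using insert H.a_closed by auto
  qed (simp add: H.zero_closed)
qed

lemma additive_subgroup_uminus: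
  assumes "ring R" "additive_subgroup H R" "a \<in> H"
  shows "\<ominus>\<^bsub>R\<^esub> a \<in> H"
proof -
  interpret ring R by fact
  interpret H: additive_subgroup H R by fact
  show ?thesis
    using subgroup.m_inv_closed[OF H.a_subgroup assms(3)] unfolding a_inv_def .
qed

lemma (in ring) additive_subgroup_minus:
  assumes "additive_subgroup H R" "a \<in> H" "b \<in> H"
  shows "a \<ominus> b \<in> H"
  using assms additive_subgroup_uminus[OF ring_axioms assms(1)]
  unfolding a_minus_def by (simp add: additive_subgroup.a_closed)

lemma (in ring) additive_subgroupI:
  assumes "H \<subseteq> carrier R" "\<zero> \<in> H" "\<And>a b. a \<in> H \<Longrightarrow> b \<in> H \<Longrightarrow> a \<oplus> b \<in> H"
    "\<And>a. a \<in> H \<Longrightarrow> \<ominus> a \<in> H"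
  shows "additive_subgroup H R"
  by (intro additive_subgroup.intro add.subgroupI)
    (use assms in \<open>auto simp: a_inv_def\<close>)

lemma (in ring) add_minus_cancel: "a \<in> carrier R \<Longrightarrow> b \<in> carrier R \<Longrightarrow> b \<oplus> (a \<ominus> b) = a"
  by (simp add: a_minus_def a_lcomm r_neg)

section \<open>Left spans and left independence of indexed families\<close>

text \<open>Indexed by \<open>I\<close> and not by the values of \<open>b\<close> as in
  \<open>left_span\<close>: two exponents might give the same ring element, and independence has to
  distinguish them. Membership asks for some finite index set and does not require its coefficients
  to be nonzero.\<close>

definition lspan :: "('r,'b) ring_scheme \<Rightarrow> 'r set \<Rightarrow> 'i set \<Rightarrow> ('i \<Rightarrow> 'r) \<Rightarrow> 'r set" where
  "lspan R A I b = {m. \<exists>J c. finite J \<and> J \<subseteq> I \<and> c \<in> J \<rightarrow> A \<and> m = (\<Oplus>\<^bsub>R\<^esub>i\<in>J. c i \<otimes>\<^bsub>R\<^esub> b i)}"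

definition lindep :: "('r,'b) ring_scheme \<Rightarrow> 'r set \<Rightarrow> 'i set \<Rightarrow> ('i \<Rightarrow> 'r) \<Rightarrow> bool" where
  "lindep R A I b \<longleftrightarrow> (\<forall>J c. finite J \<longrightarrow> J \<subseteq> I \<longrightarrow> c \<in> J \<rightarrow> A \<longrightarrow>
     (\<Oplus>\<^bsub>R\<^esub>i\<in>J. c i \<otimes>\<^bsub>R\<^esub> b i) = \<zero>\<^bsub>R\<^esub> \<longrightarrow> (\<forall>i\<in>J. c i = \<zero>\<^bsub>R\<^esub>))"

lemma lspanI: "finite J \<Longrightarrow> J \<subseteq> I \<Longrightarrow> c \<in> J \<rightarrow> A \<Longrightarrow> (\<Oplus>\<^bsub>R\<^esub>i\<in>J. c i \<otimes>\<^bsub>R\<^esub> b i) \<in> lspan R A I b"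
  unfolding lspan_def by blast

lemma lspanE:
  assumes "m \<in> lspan R A I b"
  obtains J c where "finite J" "J \<subseteq> I" "c \<in> J \<rightarrow> A" "m = (\<Oplus>\<^bsub>R\<^esub>i\<in>J. c i \<otimes>\<^bsub>R\<^esub> b i)"
  using assms unfolding lspan_def by blast

lemma lindepD:
  "\<lbrakk>lindep R A I b; finite J; J \<subseteq> I; c \<in> J \<rightarrow> A; (\<Oplus>\<^bsub>R\<^esub>i\<in>J. c i \<otimes>\<^bsub>R\<^esub> b i) = \<zero>\<^bsub>R\<^esub>; i \<in> J\<rbrakk> \<Longrightarrow> c i = \<zero>\<^bsub>R\<^esub>"
  unfolding lindep_def by blast

lemma lspan_mono: "I \<subseteq> I' \<Longrightarrow> lspan R A I b \<subseteq> lspan R A I' b"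
  unfolding lspan_def by blast

lemma lindep_mono: "lindep R A I' b \<Longrightarrow> I \<subseteq> I' \<Longrightarrow> lindep R A I b"
  unfolding lindep_def by blast

lemma ex1_eq: "\<exists>!x. P x \<Longrightarrow> P a \<Longrightarrow> P b \<Longrightarrow> a = b"
  by blast

locale left_family = ring R for R (structure) +
  fixes A :: "'a set" and I :: "'i set" and b :: "'i \<Rightarrow> 'a"
  assumes sub: "subring A R" and b_closed: "b \<in> I \<rightarrow> carrier R"
begin

lemma A_carr: "a \<in> A \<Longrightarrow> a \<in> carrier R"
  using subringE(1)[OF sub] by blast

lemma b_carr: "i \<in> I \<Longrightarrow> b i \<in> carrier R"
  using b_closed by blast

lemma smult_closed: "i \<in> I \<Longrightarrow> a \<in> A \<Longrightarrow> a \<otimes> b i \<in> carrier R"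
  using A_carr b_closed by auto

lemma term_closed: "J \<subseteq> I \<Longrightarrow> c \<in> J \<rightarrow> A \<Longrightarrow> (\<lambda>i. c i \<otimes> b i) \<in> J \<rightarrow> carrier R"
  using smult_closed by blast

text \<open>Padding by zero coefficients, used to write several combinations over one common finite
  index set.\<close>

lemma extend_sum:
  assumes "finite J'" "J \<subseteq> J'" "J' \<subseteq> I" "c \<in> J \<rightarrow> A"
  shows "(\<Oplus>i\<in>J. c i \<otimes> b i) = (\<Oplus>i\<in>J'. (if i \<in> J then c i else \<zero>) \<otimes> b i)"
proof (rule add.finprod_mono_neutral_cong_left)
  have "b i \<in> carrier R" if "i \<in> J'" for i using that assms b_carr by blast
  moreover have "c i \<in> carrier R" if "i \<in> J" for i using that assms A_carr by blast
  ultimately show "\<And>i. i \<in> J' - J \<Longrightarrow> (if i \<in> J then c i else \<zero>) \<otimes> b i = \<zero>"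
    "(\<lambda>i. (if i \<in> J then c i else \<zero>) \<otimes> b i) \<in> J' \<rightarrow> carrier R"
    by auto
qed (use assms in auto)

lemma lspan_additive: "additive_subgroup (lspan R A I b) R"
proof (rule additive_subgroupI)
  show "lspan R A I b \<subseteq> carrier R"
    using term_closed by (auto elim!: lspanE intro!: finsum_closed)
  show "\<zero> \<in> lspan R A I b"
    using lspanI[of "{}" I "\<lambda>_. \<zero>" A R b] by simp
next
  fix x y assume "x \<in> lspan R A I b" "y \<in> lspan R A I b"
  obtain J c where J: "finite J" "J \<subseteq> I" "c \<in> J \<rightarrow> A" "x = (\<Oplus>i\<in>J. c i \<otimes> b i)"
    using \<open>x \<in> lspan R A I b\<close> by (rule lspanE)
  obtain J' c' where J': "finite J'" "J' \<subseteq> I" "c' \<in> J' \<rightarrow> A" "y = (\<Oplus>i\<in>J'. c' i \<otimes> b i)"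
    using \<open>y \<in> lspan R A I b\<close> by (rule lspanE)
  let ?c = "\<lambda>i. if i \<in> J then c i else \<zero>" and ?c' = "\<lambda>i. if i \<in> J' then c' i else \<zero>"
  have cA: "?c \<in> J \<union> J' \<rightarrow> A" "?c' \<in> J \<union> J' \<rightarrow> A"
    using J J' subringE(2)[OF sub] by auto
  have "x = (\<Oplus>i\<in>J \<union> J'. ?c i \<otimes> b i)" "y = (\<Oplus>i\<in>J \<union> J'. ?c' i \<otimes> b i)"
    using J J' extend_sum[of "J \<union> J'" J c] extend_sum[of "J \<union> J'" J' c'] by simp_all
  then have "x \<oplus> y = (\<Oplus>i\<in>J \<union> J'. ?c i \<otimes> b i \<oplus> ?c' i \<otimes> b i)"
    using term_closed[OF _ cA(1)] term_closed[OF _ cA(2)] J J' by (simp only: finsum_addf Un_subset_iff)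
  also have "\<dots> = (\<Oplus>i\<in>J \<union> J'. (?c i \<oplus> ?c' i) \<otimes> b i)"
    by (rule finsum_cong') (use J J' cA A_carr b_closed in \<open>auto intro!: l_distr[symmetric] m_closed a_closed simp: Pi_iff subset_iff\<close>)
  also have "\<dots> \<in> lspan R A I b"
    by (rule lspanI) (use J(1,2) J'(1,2) cA subringE(7)[OF sub] in \<open>simp_all add: Pi_iff\<close>)
  finally show "x \<oplus> y \<in> lspan R A I b" .
next
  fix x assume "x \<in> lspan R A I b"
  then obtain J c where J: "finite J" "J \<subseteq> I" "c \<in> J \<rightarrow> A" "x = (\<Oplus>i\<in>J. c i \<otimes> b i)"
    by (rule lspanE)
  then have "\<ominus> x = (\<Oplus>i\<in>J. \<ominus> (c i \<otimes> b i))"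
    using term_closed finsum_minus[of J "\<lambda>i. c i \<otimes> b i"] by simp
  also have "\<dots> = (\<Oplus>i\<in>J. (\<ominus> c i) \<otimes> b i)"
    by (rule finsum_cong') (use J A_carr b_closed in \<open>auto intro!: l_minus[symmetric] m_closed a_inv_closed simp: Pi_iff subset_iff\<close>)
  finally show "\<ominus> x \<in> lspan R A I b"
    using J subringE(5)[OF sub] by (auto intro!: lspanI)
qed

lemma lspan_carr: "x \<in> lspan R A I b \<Longrightarrow> x \<in> carrier R"
  using additive_subgroup.a_Hcarr[OF lspan_additive] .

lemma lspan_smult:
  assumes "a \<in> A" "x \<in> lspan R A I b"
  shows "a \<otimes> x \<in> lspan R A I b"
proof -
  obtain J c where J: "finite J" "J \<subseteq> I" "c \<in> J \<rightarrow> A" "x = (\<Oplus>i\<in>J. c i \<otimes> b i)"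
    using assms(2) by (rule lspanE)
  then have "a \<otimes> x = (\<Oplus>i\<in>J. a \<otimes> (c i \<otimes> b i))"
    using term_closed A_carr assms(1) by (simp add: finsum_rdistr)
  also have "\<dots> = (\<Oplus>i\<in>J. (a \<otimes> c i) \<otimes> b i)"
    by (rule finsum_cong') (use J A_carr b_closed assms(1) in \<open>auto intro!: m_assoc[symmetric] m_closed simp: Pi_iff subset_iff\<close>)
  finally show ?thesis
    using J assms(1) subringE(6)[OF sub] by (auto intro!: lspanI)
qed

lemma lspan_base_smult:
  assumes "i \<in> I" "a \<in> A"
  shows "a \<otimes> b i \<in> lspan R A I b"
  using lspanI[of "{i}" I "\<lambda>_. a" A R b] assms smult_closed by simp

lemma lspan_base: "i \<in> I \<Longrightarrow> b i \<in> lspan R A I b"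
  using lspan_base_smult[of i \<one>] b_carr subringE(3)[OF sub] by auto

lemma lspan_finsum:
  "finite J \<Longrightarrow> (\<And>j. j \<in> J \<Longrightarrow> f j \<in> lspan R A I b) \<Longrightarrow> (\<Oplus>j\<in>J. f j) \<in> lspan R A I b"
  using additive_subgroup_finsum[OF lspan_additive] .

text \<open>The induction principle for spans. Assuming all \<open>a \<otimes> b i\<close> in
  \<open>H\<close>, instead of closure of \<open>H\<close> under scalars, admits sets such as the v
  with u v in a given subgroup, which are additive but not visibly stable under left
  multiplication.\<close>

lemma lspan_minimal:
  assumes "additive_subgroup H R" "\<And>i a. i \<in> I \<Longrightarrow> a \<in> A \<Longrightarrow> a \<otimes> b i \<in> H"
  shows "lspan R A I b \<subseteq> H"
  using additive_subgroup_finsum[OF assms(1)] assms(2) by (fastforce elim!: lspanE)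

lemma lindep_unique:
  assumes ind: "lindep R A I b" and "finite J" "J \<subseteq> I" "c \<in> J \<rightarrow> A" "c' \<in> J \<rightarrow> A"
    and eq: "(\<Oplus>i\<in>J. c i \<otimes> b i) = (\<Oplus>i\<in>J. c' i \<otimes> b i)" and "i \<in> J"
  shows "c i = c' i"
proof -
  have "(\<Oplus>i\<in>J. (c i \<ominus> c' i) \<otimes> b i) = (\<Oplus>i\<in>J. c i \<otimes> b i \<oplus> \<ominus> (c' i \<otimes> b i))"
    by (rule finsum_cong') (use assms A_carr b_closed in \<open>auto simp: a_minus_def Pi_iff subset_iff l_distr l_minus\<close>)
  also have "\<dots> = (\<Oplus>i\<in>J. c i \<otimes> b i) \<oplus> \<ominus> (\<Oplus>i\<in>J. c' i \<otimes> b i)"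
    using assms(2-5) term_closed finsum_minus[of J "\<lambda>i. c' i \<otimes> b i"]
    by (subst finsum_addf) (auto simp: Pi_iff)
  also have "\<dots> = \<zero>"
    unfolding eq using term_closed assms by (auto intro!: r_neg finsum_closed)
  finally have "c i \<ominus> c' i = \<zero>"
    by (rule lindepD[OF ind, rotated 3])
      (use assms subringE(5,7)[OF sub] in \<open>auto simp: a_minus_def Pi_iff\<close>)
  then show ?thesis
    using r_right_minus_eq[of "c i" "c' i"] funcset_mem[OF assms(4,7)] funcset_mem[OF assms(5,7)] A_carr by simp
qed

text \<open>Uniqueness of the coefficients of 0 is independence; this is where 0 in \<open>M\<close>
  enters. The difference in form is that \<open>left_basis\<close> uses total coefficient functions
  that vanish off \<open>I\<close> and have finite support, whereas \<open>lspan\<close> and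
  \<open>lindep\<close> use partial ones on a finite set. Only the inclusion of \<open>M\<close> in
  the span is expressed.\<close>

lemma left_basis_iff:
  assumes "\<zero> \<in> M"
  shows "left_basis R A I b M \<longleftrightarrow> M \<subseteq> lspan R A I b \<and> lindep R A I b"
proof
  let ?rep = "\<lambda>m c. (\<forall>i. c i \<in> (if i \<in> I then A else {\<zero>})) \<and> finite {i. c i \<noteq> \<zero>} \<and>
                 m = finsum R (\<lambda>i. c i \<otimes> b i) {i. c i \<noteq> \<zero>}"
  {
    assume L: "left_basis R A I b M"
    then have ex: "\<And>m. m \<in> M \<Longrightarrow> \<exists>!c. ?rep m c" unfolding left_basis_def by blast
    have "m \<in> lspan R A I b" if m: "m \<in> M" for m
    proof -
      obtain c where c: "?rep m c" using ex[OF m] by blast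
      then have "{i. c i \<noteq> \<zero>} \<subseteq> I" by (auto split: if_splits)
      moreover have "c \<in> {i. c i \<noteq> \<zero>} \<rightarrow> A" using c by (auto split: if_splits)
      ultimately show ?thesis using c lspanI[of "{i. c i \<noteq> \<zero>}" I c A R b] by simp
    qed
    moreover have "lindep R A I b"
      unfolding lindep_def
    proof (intro allI impI ballI)
      fix J c i assume J: "finite J" "J \<subseteq> I" "c \<in> J \<rightarrow> A" "(\<Oplus>i\<in>J. c i \<otimes> b i) = \<zero>" "i \<in> J"
      define c' where "c' i = (if i \<in> J then c i else \<zero>)" for i
      have sup: "{i. c' i \<noteq> \<zero>} \<subseteq> J" unfolding c'_def by auto
      have "(\<Oplus>i\<in>{i. c' i \<noteq> \<zero>}. c' i \<otimes> b i) = (\<Oplus>i\<in>J. c i \<otimes> b i)"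
        by (rule add.finprod_mono_neutral_cong_left)
          (use J sup term_closed[OF J(2,3)] b_carr in \<open>auto simp: c'_def subset_iff\<close>)
      moreover have "c' i \<in> (if i \<in> I then A else {\<zero>})" for i
        using J(2,3) subringE(2)[OF sub] by (auto simp: c'_def)
      ultimately have "?rep \<zero> c'" using J(1,4) finite_subset[OF sup] by simp
      moreover have "?rep \<zero> (\<lambda>_. \<zero>)" using subringE(2)[OF sub] by simp
      ultimately have "c' = (\<lambda>_. \<zero>)" by (rule ex1_eq[OF ex[OF assms]])
      then show "c i = \<zero>" using J(5) unfolding c'_def by metis
    qed
    ultimately show "M \<subseteq> lspan R A I b \<and> lindep R A I b" by blast
  }
  {
    assume R: "M \<subseteq> lspan R A I b \<and> lindep R A I b"
    show "left_basis R A I b M" unfolding left_basis_def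
    proof (intro ballI ex_ex1I)
      fix m assume "m \<in> M"
      then have "m \<in> lspan R A I b" using R by blast
      then obtain J c where J: "finite J" "J \<subseteq> I" "c \<in> J \<rightarrow> A" "m = (\<Oplus>i\<in>J. c i \<otimes> b i)"
        by (rule lspanE)
      define c' where "c' i = (if i \<in> J then c i else \<zero>)" for i
      have sup: "{i. c' i \<noteq> \<zero>} \<subseteq> J" unfolding c'_def by auto
      have "(\<Oplus>i\<in>{i. c' i \<noteq> \<zero>}. c' i \<otimes> b i) = (\<Oplus>i\<in>J. c i \<otimes> b i)"
        by (rule add.finprod_mono_neutral_cong_left)
          (use J sup term_closed[OF J(2,3)] b_carr in \<open>auto simp: c'_def subset_iff\<close>)
      moreover have "c' i \<in> (if i \<in> I then A else {\<zero>})" for i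
        using J(2,3) subringE(2)[OF sub] by (auto simp: c'_def)
      ultimately have "?rep m c'" using J(1,4) finite_subset[OF sup] by simp
      then show "\<exists>c. ?rep m c" by (intro exI[of _ c'])
    next
      fix m c c' assume c: "?rep m c" and c': "?rep m c'"
      let ?J = "{i. c i \<noteq> \<zero>} \<union> {i. c' i \<noteq> \<zero>}"
      have JI: "?J \<subseteq> I" and fin: "finite ?J" using c c' by (auto split: if_splits)
      have "e i \<in> A" if "?rep m e" "i \<in> ?J" for e i
        using that(1)[THEN conjunct1, rule_format, of i] subsetD[OF JI that(2)] by simp
      then have A: "c \<in> ?J \<rightarrow> A" "c' \<in> ?J \<rightarrow> A" using c c' by blast+
      have "m = (\<Oplus>i\<in>?J. e i \<otimes> b i)" if e: "?rep m e" "e \<in> ?J \<rightarrow> A" "{i. e i \<noteq> \<zero>} \<subseteq> ?J" for e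
      proof -
        have "(\<Oplus>i\<in>{i. e i \<noteq> \<zero>}. e i \<otimes> b i) = (\<Oplus>i\<in>?J. e i \<otimes> b i)"
          by (rule add.finprod_mono_neutral_cong_left)
            (use JI fin e(3) term_closed[OF JI e(2)] b_carr in \<open>auto simp: subset_iff\<close>)
        then show ?thesis using e(1) by metis
      qed
      then have "m = (\<Oplus>i\<in>?J. c i \<otimes> b i)" "m = (\<Oplus>i\<in>?J. c' i \<otimes> b i)"
        using c c' A by blast+
      then have "c i = c' i" if "i \<in> ?J" for i
        using lindep_unique[of ?J c c' i] R fin JI A that by metis
      then have "c i = c' i" for i by (cases "i \<in> ?J") auto
      then show "c = c'" ..
    qed
  }
qed

end

text \<open>Write the element also over \<open>I'\<close> and compare both expansions on a common
  index set: by independence a coefficient outside \<open>I'\<close> equals its padded value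
  0.\<close>

lemma (in left_family) lindep_support:
  assumes ind: "lindep R A I b" and I': "I' \<subseteq> I" and J: "finite J" "J \<subseteq> I" "c \<in> J \<rightarrow> A"
    and mem: "(\<Oplus>i\<in>J. c i \<otimes> b i) \<in> lspan R A I' b" and i: "i \<in> J" "c i \<noteq> \<zero>"
  shows "i \<in> I'"
proof (rule ccontr)
  assume "i \<notin> I'"
  obtain J' c' where J': "finite J'" "J' \<subseteq> I'" "c' \<in> J' \<rightarrow> A" "(\<Oplus>i\<in>J. c i \<otimes> b i) = (\<Oplus>i\<in>J'. c' i \<otimes> b i)"
    using mem by (rule lspanE)
  let ?c = "\<lambda>i. if i \<in> J then c i else \<zero>" and ?c' = "\<lambda>i. if i \<in> J' then c' i else \<zero>"
  have U: "finite (J \<union> J')" "J \<union> J' \<subseteq> I" using J J' I' by auto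
  have "(\<Oplus>i\<in>J \<union> J'. ?c i \<otimes> b i) = (\<Oplus>i\<in>J \<union> J'. ?c' i \<otimes> b i)"
    using extend_sum[OF U(1) _ U(2) J(3)] extend_sum[OF U(1) _ U(2) J'(3)] J'(4) by simp
  then have "?c i = ?c' i"
    by (rule lindep_unique[OF ind U, rotated 2]) (use i J J' subringE(2)[OF sub] in auto)
  moreover have "i \<notin> J'" using \<open>i \<notin> I'\<close> J'(2) by blast
  ultimately show False using i by simp
qed

lemma (in left_family) lspan_cong:
  assumes "\<And>i. i \<in> I \<Longrightarrow> b i = b' i"
  shows "lspan R A I b = lspan R A I b'"
proof -
  have "(\<Oplus>i\<in>J. c i \<otimes> b' i) = (\<Oplus>i\<in>J. c i \<otimes> b i)" if "J \<subseteq> I" "c \<in> J \<rightarrow> A" for J c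
    by (rule finsum_cong') (use that assms term_closed in auto)
  then show ?thesis unfolding lspan_def by (intro Collect_cong ex_cong1 conj_cong refl) simp
qed

lemma (in left_family) lindep_cong:
  assumes "\<And>i. i \<in> I \<Longrightarrow> b i = b' i"
  shows "lindep R A I b \<longleftrightarrow> lindep R A I b'"
proof -
  have "(\<Oplus>i\<in>J. c i \<otimes> b' i) = (\<Oplus>i\<in>J. c i \<otimes> b i)" if "J \<subseteq> I" "c \<in> J \<rightarrow> A" for J c
    by (rule finsum_cong') (use that assms term_closed in auto)
  then show ?thesis unfolding lindep_def by (intro all_cong1 imp_cong refl) simp
qed

text \<open>Needed to view an exponent vector as a pair of a shorter exponent and the power of the
  last variable.\<close>

lemma lspan_reindex:
  fixes R (structure)
  assumes "left_family R A (f ` I) b" "inj_on f I"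
  shows "lspan R A (f ` I) b = lspan R A I (b \<circ> f)"
proof -
  interpret left_family R A "f ` I" b by fact
  have eq: "(\<Oplus>i\<in>f ` J. c i \<otimes> b i) = (\<Oplus>i\<in>J. c (f i) \<otimes> b (f i))" if "J \<subseteq> I" "c \<in> f ` J \<rightarrow> A" for J c
    by (rule finsum_reindex) (use that assms(2) term_closed[of "f ` J" c] inj_on_subset in auto)
  show ?thesis
  proof
    show "lspan R A (f ` I) b \<subseteq> lspan R A I (b \<circ> f)"
    proof
      fix m assume "m \<in> lspan R A (f ` I) b"
      then obtain J c where J: "finite J" "J \<subseteq> f ` I" "c \<in> J \<rightarrow> A" "m = (\<Oplus>i\<in>J. c i \<otimes> b i)"
        by (rule lspanE)
      obtain J' where J': "J' \<subseteq> I" "J = f ` J'" "finite J'"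
        using finite_subset_image[OF J(1,2)] by blast
      then have "m = (\<Oplus>i\<in>J'. (c \<circ> f) i \<otimes> (b \<circ> f) i)" using eq J by simp
      moreover have "c \<circ> f \<in> J' \<rightarrow> A" using J J' by auto
      ultimately show "m \<in> lspan R A I (b \<circ> f)" using lspanI[OF J'(3,1)] by blast
    qed
    show "lspan R A I (b \<circ> f) \<subseteq> lspan R A (f ` I) b"
    proof
      fix m assume "m \<in> lspan R A I (b \<circ> f)"
      then obtain J c where J: "finite J" "J \<subseteq> I" "c \<in> J \<rightarrow> A" "m = (\<Oplus>i\<in>J. c i \<otimes> (b \<circ> f) i)"
        by (rule lspanE)
      let ?c = "c \<circ> inv_into I f"
      have c: "?c (f i) = c i" if "i \<in> J" for i using that J(2) assms(2) by auto
      have "(\<Oplus>i\<in>f ` J. ?c i \<otimes> b i) = (\<Oplus>i\<in>J. ?c (f i) \<otimes> b (f i))"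
        by (rule eq) (use J c in auto)
      also have "\<dots> = m" unfolding J(4)
        by (rule finsum_cong') (use J c smult_closed in \<open>auto simp: Pi_iff subset_iff\<close>)
      finally have "m = (\<Oplus>i\<in>f ` J. ?c i \<otimes> b i)" ..
      moreover have "?c \<in> f ` J \<rightarrow> A" using J(3) c by auto
      ultimately show "m \<in> lspan R A (f ` I) b"
        using J(1,2) lspanI[of "f ` J" "f ` I" ?c A R b] by (simp add: image_mono)
    qed
  qed
qed

lemma lindep_reindex:
  fixes R (structure)
  assumes "left_family R A (f ` I) b" "inj_on f I"
  shows "lindep R A (f ` I) b \<longleftrightarrow> lindep R A I (b \<circ> f)"
proof -
  interpret left_family R A "f ` I" b by fact
  have eq: "(\<Oplus>i\<in>f ` J. c i \<otimes> b i) = (\<Oplus>i\<in>J. c (f i) \<otimes> b (f i))" if "J \<subseteq> I" "c \<in> f ` J \<rightarrow> A" for J c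
    by (rule finsum_reindex) (use that assms(2) term_closed[of "f ` J" c] inj_on_subset in auto)
  show ?thesis
  proof
    assume L: "lindep R A (f ` I) b"
    show "lindep R A I (b \<circ> f)" unfolding lindep_def
    proof (intro allI impI ballI)
      fix J c i assume J: "finite J" "J \<subseteq> I" "c \<in> J \<rightarrow> A" "(\<Oplus>i\<in>J. c i \<otimes> (b \<circ> f) i) = \<zero>" "i \<in> J"
      let ?c = "c \<circ> inv_into I f"
      have c: "?c (f i) = c i" if "i \<in> J" for i using that J(2) assms(2) by auto
      have "(\<Oplus>i\<in>f ` J. ?c i \<otimes> b i) = (\<Oplus>i\<in>J. ?c (f i) \<otimes> b (f i))"
        by (rule eq) (use J c in auto)
      also have "\<dots> = (\<Oplus>i\<in>J. c i \<otimes> (b \<circ> f) i)"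
        by (rule finsum_cong') (use J c smult_closed in \<open>auto simp: Pi_iff subset_iff\<close>)
      also have "\<dots> = \<zero>" by (rule J(4))
      finally have "?c (f i) = \<zero>"
        by (rule lindepD[OF L, rotated 3]) (use J c in auto)
      then show "c i = \<zero>" using c J(5) by simp
    qed
  next
    assume L: "lindep R A I (b \<circ> f)"
    show "lindep R A (f ` I) b" unfolding lindep_def
    proof (intro allI impI ballI)
      fix J c i assume J: "finite J" "J \<subseteq> f ` I" "c \<in> J \<rightarrow> A" "(\<Oplus>i\<in>J. c i \<otimes> b i) = \<zero>" "i \<in> J"
      obtain J' where J': "J' \<subseteq> I" "J = f ` J'" "finite J'"
        using finite_subset_image[OF J(1,2)] by blast
      obtain i' where i': "i' \<in> J'" "i = f i'" using J J' by auto
      have "(\<Oplus>i\<in>J'. (c \<circ> f) i \<otimes> (b \<circ> f) i) = \<zero>"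
        using eq[of J' c] J J' by simp
      then have "(c \<circ> f) i' = \<zero>"
        by (rule lindepD[OF L, rotated 3]) (use J J' i' in auto)
      then show "c i = \<zero>" using i' by simp
    qed
  qed
qed

text \<open>\<open>fin_gen_left\<close> wants a finite set of generators, so the family is replaced
  by its image. Equal generators merge there, and the two spans are compared by minimality in both
  directions.\<close>

lemma (in ring) fin_gen_left_lspan:
  assumes L: "subring L R" and I: "finite I" "b \<in> I \<rightarrow> carrier R"
  shows "fin_gen_left R L (lspan R L I b)"
proof -
  interpret left_family R L I b
    by (intro left_family.intro left_family_axioms.intro ring_axioms L I)
  interpret S: left_family R L "b ` I" "\<lambda>v. v"
    by (intro left_family.intro left_family_axioms.intro ring_axioms L) (use I in auto)
  have "left_span R L (b ` I) = lspan R L (b ` I) (\<lambda>v. v)"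
  proof
    show "left_span R L (b ` I) \<subseteq> lspan R L (b ` I) (\<lambda>v. v)"
      unfolding left_span_def using I lspanI[of "b ` I" "b ` I" _ L R "\<lambda>v. v"] by auto
    show "lspan R L (b ` I) (\<lambda>v. v) \<subseteq> left_span R L (b ` I)"
    proof
      fix m assume "m \<in> lspan R L (b ` I) (\<lambda>v. v)"
      then obtain J c where J: "finite J" "J \<subseteq> b ` I" "c \<in> J \<rightarrow> L" "m = (\<Oplus>v\<in>J. c v \<otimes> v)"
        by (rule lspanE)
      then have "m = (\<Oplus>v\<in>b ` I. (if v \<in> J then c v else \<zero>) \<otimes> v)"
        using S.extend_sum[of "b ` I" J c] I by simp
      then show "m \<in> left_span R L (b ` I)"
        unfolding left_span_def using J(3) subringE(2)[OF L]
        by (intro CollectI exI[of _ "\<lambda>v. if v \<in> J then c v else \<zero>"]) auto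
    qed
  qed
  also have "\<dots> = lspan R L I b"
  proof
    show "lspan R L (b ` I) (\<lambda>v. v) \<subseteq> lspan R L I b"
      by (rule S.lspan_minimal[OF lspan_additive]) (auto intro: lspan_base_smult)
    show "lspan R L I b \<subseteq> lspan R L (b ` I) (\<lambda>v. v)"
      by (rule lspan_minimal[OF S.lspan_additive]) (auto intro: S.lspan_base_smult)
  qed
  finally show ?thesis
    unfolding fin_gen_left_def using I(1) lspan_base by (intro exI[of _ "b ` I"]) auto
qed

section \<open>Bases in a tower of subrings\<close>

text \<open>The setting for transitivity of bases. For one Ore step, \<open>B\<close> is the ring of
  the earlier variables, \<open>b\<close> its monomials and \<open>d\<close> the powers of the next
  variable; the products \<open>b i \<otimes> d k\<close> are then the monomials in one variable
  more.\<close>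

locale tower = ring R for R (structure) +
  fixes A B :: "'a set" and I :: "'i set" and K :: "'k set" and b :: "'i \<Rightarrow> 'a" and d :: "'k \<Rightarrow> 'a"
  assumes sub: "subring A R" "subring B R" and AB: "A \<subseteq> B"
    and b_closed: "b \<in> I \<rightarrow> B" and d_closed: "d \<in> K \<rightarrow> carrier R"
    and B_span: "B \<subseteq> lspan R A I b"
begin

lemma carr: "a \<in> B \<Longrightarrow> a \<in> carrier R" "a \<in> A \<Longrightarrow> a \<in> carrier R"
  using subringE(1)[OF sub(1)] subringE(1)[OF sub(2)] by blast+

sublocale bA: left_family R A I b
proof (intro left_family.intro left_family_axioms.intro)
  show "ring R" by (rule ring_axioms)
  show "subring A R" by (rule sub)
  show "b \<in> I \<rightarrow> carrier R" using b_closed carr(1) by blast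
qed

sublocale dB: left_family R B K d
proof (intro left_family.intro left_family_axioms.intro)
  show "ring R" by (rule ring_axioms)
  show "subring B R" by (rule sub)
  show "d \<in> K \<rightarrow> carrier R" by (rule d_closed)
qed

sublocale bd: left_family R A "I \<times> K" "\<lambda>(i, k). b i \<otimes> d k"
proof (intro left_family.intro left_family_axioms.intro)
  show "ring R" by (rule ring_axioms)
  show "subring A R" by (rule sub)
  show "(\<lambda>(i, k). b i \<otimes> d k) \<in> I \<times> K \<rightarrow> carrier R"
    using bA.b_closed d_closed by (auto intro!: m_closed)
qed

lemma lspan_eq: "lspan R B K d = lspan R A (I \<times> K) (\<lambda>(i, k). b i \<otimes> d k)"
proof
  show "lspan R B K d \<subseteq> lspan R A (I \<times> K) (\<lambda>(i, k). b i \<otimes> d k)"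
  proof (rule dB.lspan_minimal[OF bd.lspan_additive])
    fix k a assume k: "k \<in> K" and "a \<in> B"
    have "a \<in> lspan R A I b" using B_span \<open>a \<in> B\<close> by blast
    then obtain J c where J: "finite J" "J \<subseteq> I" "c \<in> J \<rightarrow> A" "a = (\<Oplus>i\<in>J. c i \<otimes> b i)"
      by (rule lspanE)
    then have "a \<otimes> d k = (\<Oplus>i\<in>J. c i \<otimes> b i \<otimes> d k)"
      using bA.term_closed[OF J(2,3)] d_closed k by (auto intro!: finsum_ldistr)
    moreover have "c i \<otimes> b i \<otimes> d k \<in> lspan R A (I \<times> K) (\<lambda>(i, k). b i \<otimes> d k)" if "i \<in> J" for i
    proof -
      have "c i \<otimes> b i \<otimes> d k = c i \<otimes> (b i \<otimes> d k)"
        using that J carr b_closed d_closed k by (intro m_assoc) (auto simp: Pi_iff subset_iff)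
      then show ?thesis
        using bd.lspan_base_smult[of "(i, k)" "c i"] that J k by auto
    qed
    ultimately show "a \<otimes> d k \<in> lspan R A (I \<times> K) (\<lambda>(i, k). b i \<otimes> d k)"
      using bd.lspan_finsum[OF J(1)] by simp
  qed
  show "lspan R A (I \<times> K) (\<lambda>(i, k). b i \<otimes> d k) \<subseteq> lspan R B K d"
  proof (rule bd.lspan_minimal[OF dB.lspan_additive])
    fix p a assume p: "p \<in> I \<times> K" and a: "a \<in> A"
    obtain i k where ik: "p = (i, k)" "i \<in> I" "k \<in> K" using p by auto
    have "a \<otimes> (b i \<otimes> d k) = (a \<otimes> b i) \<otimes> d k"
      using ik a carr b_closed d_closed by (intro m_assoc[symmetric]) auto
    then show "a \<otimes> (case p of (i, k) \<Rightarrow> b i \<otimes> d k) \<in> lspan R B K d"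
      using dB.lspan_base_smult[of k "a \<otimes> b i"] ik a AB b_closed subringE(6)[OF sub(2)] by auto
  qed
qed

text \<open>Regroups a combination of products as one over \<open>B\<close>. The index set is a full
  rectangle so that all inner sums run over the same \<open>I'\<close>; general supports are first
  enclosed in one.\<close>

lemma rectangle_sum:
  assumes "finite I'" "finite K'" "I' \<subseteq> I" "K' \<subseteq> K" "c \<in> I' \<times> K' \<rightarrow> A"
  shows "(\<Oplus>p\<in>I' \<times> K'. c p \<otimes> (case p of (i, k) \<Rightarrow> b i \<otimes> d k))
       = (\<Oplus>k\<in>K'. (\<Oplus>i\<in>I'. c (i, k) \<otimes> b i) \<otimes> d k)"
proof -
  have cl: "c (i, k) \<in> carrier R" "b i \<in> carrier R" "d k \<in> carrier R" if "i \<in> I'" "k \<in> K'" for i k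
    using that assms carr b_closed d_closed by (auto simp: Pi_iff subset_iff)
  have "(\<Oplus>p\<in>I' \<times> K'. c p \<otimes> (case p of (i, k) \<Rightarrow> b i \<otimes> d k))
      = (\<Oplus>i\<in>I'. \<Oplus>k\<in>K'. c (i, k) \<otimes> (b i \<otimes> d k))"
    by (subst finsum_Sigma) (use assms cl in auto)
  also have "\<dots> = (\<Oplus>k\<in>K'. \<Oplus>i\<in>I'. c (i, k) \<otimes> (b i \<otimes> d k))"
    by (rule finsum_swap) (use assms cl in auto)
  also have "\<dots> = (\<Oplus>k\<in>K'. (\<Oplus>i\<in>I'. c (i, k) \<otimes> b i) \<otimes> d k)"
  proof (rule finsum_cong'[OF refl])
    show "(\<lambda>k. (\<Oplus>i\<in>I'. c (i, k) \<otimes> b i) \<otimes> d k) \<in> K' \<rightarrow> carrier R"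
      using cl assms(4) d_closed by (auto intro!: m_closed finsum_closed)
    fix k assume k: "k \<in> K'"
    have "(\<Oplus>i\<in>I'. c (i, k) \<otimes> b i) \<otimes> d k = (\<Oplus>i\<in>I'. c (i, k) \<otimes> b i \<otimes> d k)"
      by (rule finsum_ldistr) (use cl k assms d_closed in auto)
    also have "\<dots> = (\<Oplus>i\<in>I'. c (i, k) \<otimes> (b i \<otimes> d k))"
      by (rule finsum_cong') (use cl k in \<open>auto intro!: m_assoc\<close>)
    finally show "(\<Oplus>i\<in>I'. c (i, k) \<otimes> (b i \<otimes> d k)) = (\<Oplus>i\<in>I'. c (i, k) \<otimes> b i) \<otimes> d k" ..
  qed
  finally show ?thesis .
qed

lemma lindep_up:
  assumes "lindep R A I b" "lindep R B K d"
  shows "lindep R A (I \<times> K) (\<lambda>(i, k). b i \<otimes> d k)"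
  unfolding lindep_def
proof (intro allI impI ballI)
  fix J c p
  assume J: "finite J" "J \<subseteq> I \<times> K" "c \<in> J \<rightarrow> A" "(\<Oplus>p\<in>J. c p \<otimes> (case p of (i, k) \<Rightarrow> b i \<otimes> d k)) = \<zero>" "p \<in> J"
  \<comment> \<open>The smallest rectangle around the support; the new coefficients are set to
    0.\<close>
  define I' K' where "I' = fst ` J" and "K' = snd ` J"
  have IK: "finite I'" "finite K'" "I' \<subseteq> I" "K' \<subseteq> K" "J \<subseteq> I' \<times> K'"
    using J(1,2) unfolding I'_def K'_def by force+
  define c' where "c' p = (if p \<in> J then c p else \<zero>)" for p
  have c': "c' \<in> I' \<times> K' \<rightarrow> A" using J(3) subringE(2)[OF sub(1)] unfolding c'_def by auto
  have "(\<Oplus>p\<in>I' \<times> K'. c' p \<otimes> (case p of (i, k) \<Rightarrow> b i \<otimes> d k)) = \<zero>"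
    using bd.extend_sum[of "I' \<times> K'" J c] IK J Sigma_mono[of I' I "\<lambda>_. K'" "\<lambda>_. K"] unfolding c'_def by simp
  then have 0: "(\<Oplus>k\<in>K'. (\<Oplus>i\<in>I'. c' (i, k) \<otimes> b i) \<otimes> d k) = \<zero>"
    using rectangle_sum[OF IK(1-4) c'] by simp
  obtain i k where p: "p = (i, k)" "i \<in> I'" "k \<in> K'" using IK(5) J(5) by auto
  have inB: "(\<Oplus>i\<in>I'. c' (i, k) \<otimes> b i) \<in> B" if "k \<in> K'" for k
    by (rule additive_subgroup_finsum[OF additive_subgroup.intro])
      (use that sub(2) IK c' AB b_closed subringE(6)[OF sub(2)] subring.axioms(1)
        in \<open>auto simp: Pi_iff subset_iff\<close>)
  have "(\<Oplus>i\<in>I'. c' (i, k) \<otimes> b i) = \<zero>"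
    by (rule lindepD[OF assms(2) IK(2,4) _ 0 p(3)]) (use inB in auto)
  then have "c' (i, k) = \<zero>"
    by (rule lindepD[OF assms(1) IK(1,3), rotated]) (use p c' in auto)
  then show "c p = \<zero>" using p J(5) by (simp add: c'_def)
qed

text \<open>Expand each coefficient from \<open>B\<close> over \<open>A\<close>. The union of the
  finitely many supports turns the relation over \<open>B\<close> into a relation over
  \<open>A\<close> among the products, so every expansion has zero coefficients.\<close>

lemma lindep_down:
  assumes ind: "lindep R A (I \<times> K) (\<lambda>(i, k). b i \<otimes> d k)"
  shows "lindep R B K d"
  unfolding lindep_def
proof (intro allI impI ballI)
  fix J c k
  assume J: "finite J" "J \<subseteq> K" "c \<in> J \<rightarrow> B" "(\<Oplus>k\<in>J. c k \<otimes> d k) = \<zero>" "k \<in> J"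
  have "\<exists>I' e. finite I' \<and> I' \<subseteq> I \<and> e \<in> I' \<rightarrow> A \<and> c k = (\<Oplus>i\<in>I'. e i \<otimes> b i)" if "k \<in> J" for k
  proof -
    have "c k \<in> lspan R A I b" using that J(3) B_span by blast
    then show ?thesis unfolding lspan_def by blast
  qed
  then obtain I' e where Ie: "\<And>k. k \<in> J \<Longrightarrow> finite (I' k) \<and> I' k \<subseteq> I \<and> e k \<in> I' k \<rightarrow> A \<and>
      c k = (\<Oplus>i\<in>I' k. e k i \<otimes> b i)" by metis
  define U where "U = (\<Union>k\<in>J. I' k)"
  define f where "f = (\<lambda>(i, k). if i \<in> I' k then e k i else \<zero>)"
  have U: "finite U" "U \<subseteq> I" using Ie J(1) unfolding U_def by auto
  have f: "f \<in> U \<times> J \<rightarrow> A" using Ie subringE(2)[OF sub(1)] unfolding f_def by fastforce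
  have ck: "c k = (\<Oplus>i\<in>U. f (i, k) \<otimes> b i)" if "k \<in> J" for k
    using bA.extend_sum[of U "I' k" "e k"] Ie[OF that] U that unfolding f_def U_def by auto
  have "(\<Oplus>p\<in>U \<times> J. f p \<otimes> (case p of (i, k) \<Rightarrow> b i \<otimes> d k)) = (\<Oplus>k\<in>J. c k \<otimes> d k)"
    unfolding rectangle_sum[OF U(1) J(1) U(2) J(2) f]
    by (rule finsum_cong') (use ck dB.term_closed[OF J(2,3)] in auto)
  then have "(\<Oplus>p\<in>U \<times> J. f p \<otimes> (case p of (i, k) \<Rightarrow> b i \<otimes> d k)) = \<zero>" using J(4) by simp
  then have f0: "f (i, k) = \<zero>" if "i \<in> U" for i
    by (rule lindepD[OF ind, rotated 3]) (use U J f that in auto)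
  show "c k = \<zero>"
    unfolding ck[OF J(5)] using f0 U bA.b_carr
    by (intro add.finprod_one_eqI) (auto simp: subset_iff)
qed

end

section \<open>Standard monomials\<close>

text \<open>The defining \<open>foldr\<close> splits off the first variable. Ore extensions adjoin
  the last variable on the right, which calls for this factorisation.\<close>

lemma (in ring) std_monom_Suc:
  assumes "\<And>k. k \<in> {1..Suc j} \<Longrightarrow> x k \<in> carrier R"
  shows "std_monom R x (Suc j) \<alpha> = std_monom R x j \<alpha> \<otimes> x (Suc j) [^] \<alpha> (Suc j)"
proof -
  have cl: "foldr (\<lambda>k p. (x k [^] \<alpha> k) \<otimes> p) xs z \<in> carrier R"
    if "set xs \<subseteq> {1..Suc j}" "z \<in> carrier R" for xs z
    using that assms by (induction xs) auto
  have "foldr (\<lambda>k p. (x k [^] \<alpha> k) \<otimes> p) xs z = foldr (\<lambda>k p. (x k [^] \<alpha> k) \<otimes> p) xs \<one> \<otimes> z"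
    if "set xs \<subseteq> {1..Suc j}" "z \<in> carrier R" for xs z
    using that
  proof (induction xs)
    case (Cons a xs)
    then have "x a [^] \<alpha> a \<in> carrier R" using assms by auto
    then show ?case using Cons cl[of xs \<one>] by (simp add: m_assoc)
  qed simp
  from this[of "[1..<Suc j]" "x (Suc j) [^] \<alpha> (Suc j)"]
  have "foldr (\<lambda>k p. (x k [^] \<alpha> k) \<otimes> p) [1..<Suc j] (x (Suc j) [^] \<alpha> (Suc j))
      = std_monom R x j \<alpha> \<otimes> x (Suc j) [^] \<alpha> (Suc j)"
    unfolding std_monom_def using assms by (simp del: upt_Suc add: atLeastLessThanSuc_atLeastAtMost)
  moreover have "[1..<Suc (Suc j)] = [1..<Suc j] @ [Suc j]" by simp
  ultimately show ?thesis unfolding std_monom_def using assms by (simp only: foldr_append) simp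
qed

lemma std_monom_0 [simp]: "std_monom R x 0 \<alpha> = \<one>\<^bsub>R\<^esub>"
  by (simp add: std_monom_def)

lemma std_monom_cong:
  assumes "\<And>i. i \<in> {1..s} \<Longrightarrow> \<alpha> i = \<beta> i"
  shows "std_monom R x s \<alpha> = std_monom R x s \<beta>"
  unfolding std_monom_def by (rule foldr_cong) (use assms in auto)

locale monomials = ring R for R (structure) +
  fixes x :: "nat \<Rightarrow> 'a" and s :: nat
  assumes x_closed: "k \<in> {1..s} \<Longrightarrow> x k \<in> carrier R"
begin

abbreviation mon :: "(nat \<Rightarrow> nat) \<Rightarrow> 'a" where "mon \<equiv> std_monom R x s"

lemma std_monom_closed: "j \<le> s \<Longrightarrow> std_monom R x j \<alpha> \<in> carrier R"
proof (induction j)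
  case (Suc j)
  then show ?case by (subst std_monom_Suc) (use x_closed in auto)
qed simp

lemma mon_closed [simp]: "mon \<alpha> \<in> carrier R"
  by (simp add: std_monom_closed)

lemma std_monom_trunc:
  assumes "j \<le> s" "\<And>i. j < i \<Longrightarrow> i \<le> s \<Longrightarrow> \<alpha> i = 0"
  shows "mon \<alpha> = std_monom R x j \<alpha>"
proof -
  have "std_monom R x (j + m) \<alpha> = std_monom R x j \<alpha>" if "j + m \<le> s" for m
    using that
  proof (induction m)
    case (Suc m)
    then have "std_monom R x (Suc (j + m)) \<alpha> = std_monom R x (j + m) \<alpha>"
      using assms(2)[of "Suc (j + m)"] std_monom_closed[of "j + m" \<alpha>]
      by (subst std_monom_Suc) (use x_closed in auto)
    then show ?case using Suc by simp
  qed simp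
  from this[of "s - j"] show ?thesis using assms(1) by simp
qed

lemma mon_snoc:
  assumes "j \<in> {1..s}" "\<alpha> \<in> Nvec (j - 1)"
  shows "mon (\<alpha>(j := k)) = mon \<alpha> \<otimes> x j [^] k"
proof -
  obtain i where i: "j = Suc i" using assms(1) by (cases j) auto
  have "mon (\<alpha>(j := k)) = std_monom R x j (\<alpha>(j := k))"
    by (rule std_monom_trunc) (use assms i in \<open>auto simp: Nvec_iff\<close>)
  also have "\<dots> = std_monom R x i (\<alpha>(j := k)) \<otimes> x j [^] k"
    unfolding i by (subst std_monom_Suc) (use x_closed assms i in auto)
  also have "std_monom R x i (\<alpha>(j := k)) = std_monom R x i \<alpha>"
    by (rule std_monom_cong) (use i in auto)
  also have "\<dots> = mon \<alpha>"
    by (rule std_monom_trunc[symmetric]) (use assms i in \<open>auto simp: Nvec_iff\<close>)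
  finally show ?thesis .
qed

lemma mon_vzero [simp]: "mon vzero = \<one>"
  using std_monom_trunc[of 0 vzero] by (simp add: vzero_def)

lemma mon_unitvec:
  assumes "k \<in> {1..s}"
  shows "mon (unitvec k) = x k"
proof -
  have "unitvec k = vzero(k := 1)" by (auto simp: unitvec_def vzero_def)
  then show ?thesis using mon_snoc[of k vzero 1] assms x_closed by simp
qed

text \<open>No commutation takes place: without variables of index below \<open>k\<close>, the
  product is already sorted. The trailing factors are added one at a time by induction.\<close>

lemma mon_Cons:
  assumes k: "k \<in> {1..s}" and 0: "\<And>i. i \<in> {1..<k} \<Longrightarrow> \<beta> i = 0"
  shows "x k \<otimes> mon \<beta> = mon (vadd (unitvec k) \<beta>)"
proof -
  have xk: "x k \<in> carrier R" using x_closed k .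
  have "x k \<otimes> std_monom R x (k + m) \<beta> = std_monom R x (k + m) (vadd (unitvec k) \<beta>)" if "k + m \<le> s" for m
    using that
  proof (induction m)
    case 0
    obtain i where i: "k = Suc i" using k by (cases k) auto
    have "std_monom R x i \<gamma> = \<one>" if "\<And>j. j \<in> {1..i} \<Longrightarrow> \<gamma> j = 0" for \<gamma>
    proof -
      have "std_monom R x i \<gamma> = std_monom R x i vzero"
        by (rule std_monom_cong) (use that in \<open>auto simp: vzero_def\<close>)
      also have "\<dots> = mon vzero"
        by (rule std_monom_trunc[symmetric]) (use k i in \<open>auto simp: vzero_def\<close>)
      finally show ?thesis by simp
    qed
    then have "std_monom R x i \<beta> = \<one>" "std_monom R x i (vadd (unitvec k) \<beta>) = \<one>"
      using assms(2) i by (auto simp: vadd_def unitvec_def)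
    then have "std_monom R x k \<beta> = x k [^] \<beta> k" "std_monom R x k (vadd (unitvec k) \<beta>) = x k [^] Suc (\<beta> k)"
      unfolding i using x_closed k i
      by (subst std_monom_Suc; simp add: vadd_def unitvec_def del: nat_pow_Suc)+
    then show ?case using xk nat_pow_Suc2[of "x k" "\<beta> k"] by simp
  next
    case (Suc m)
    have "x k \<otimes> std_monom R x (Suc (k + m)) \<beta>
        = x k \<otimes> std_monom R x (k + m) \<beta> \<otimes> x (Suc (k + m)) [^] \<beta> (Suc (k + m))"
      using Suc.prems x_closed xk std_monom_closed[of "k + m" \<beta>]
      by (subst std_monom_Suc) (auto intro!: m_assoc[symmetric])
    also have "\<dots> = std_monom R x (Suc (k + m)) (vadd (unitvec k) \<beta>)"
      using Suc x_closed by (subst std_monom_Suc) (auto simp: vadd_def unitvec_def)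
    finally show ?case by simp
  qed
  from this[of "s - k"] show ?thesis using k by simp
qed

end

lemma Nvec_least_index:
  assumes "\<beta> \<in> Nvec s" "\<beta> \<noteq> vzero"
  obtains i \<beta>' where "i \<in> {1..s}" "\<beta>' \<in> Nvec s" "\<beta> = vadd (unitvec i) \<beta>'" "\<And>j. j < i \<Longrightarrow> \<beta> j = 0"
proof -
  have ex: "\<exists>i. \<beta> i \<noteq> 0" using assms(2) by (auto simp: vzero_def)
  define i where "i = (LEAST i. \<beta> i \<noteq> 0)"
  have i: "\<beta> i \<noteq> 0" unfolding i_def using ex by (rule LeastI_ex)
  have "\<And>j. j < i \<Longrightarrow> \<beta> j = 0" unfolding i_def using not_less_Least by blast
  moreover have "i \<in> {1..s}" using i assms(1) by (metis Nvec_iff)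
  moreover have "\<beta>(i := \<beta> i - 1) \<in> Nvec s" using assms(1) calculation(2) by (auto simp: Nvec_iff)
  moreover have "\<beta> = vadd (unitvec i) (\<beta>(i := \<beta> i - 1))"
    using i by (auto simp: vadd_def unitvec_def fun_eq_iff)
  ultimately show ?thesis using that by blast
qed

text \<open>Exponents are built by prepending the leftmost variable, so that \<open>mon_Cons\<close>
  applies in each step. The total degree drops by 1.\<close>

lemma Nvec_induct [consumes 1, case_names vzero unitvec]:
  assumes "\<beta> \<in> Nvec s" "P vzero"
    and step: "\<And>i \<beta>. \<lbrakk>i \<in> {1..s}; \<beta> \<in> Nvec s; \<And>j. j < i \<Longrightarrow> \<beta> j = 0; P \<beta>\<rbrakk> \<Longrightarrow> P (vadd (unitvec i) \<beta>)"
  shows "P \<beta>"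
  using assms(1)
proof (induction "\<Sum>i\<in>{1..s}. \<beta> i" arbitrary: \<beta> rule: less_induct)
  case less
  show ?case
  proof (cases "\<beta> = vzero")
    case False
    then obtain i \<beta>' where i: "i \<in> {1..s}" "\<beta>' \<in> Nvec s" "\<beta> = vadd (unitvec i) \<beta>'" "\<And>j. j < i \<Longrightarrow> \<beta> j = 0"
      using Nvec_least_index[OF less.prems] by blast
    have "(\<Sum>j\<in>{1..s}. \<beta> j) = (\<Sum>j\<in>{1..s}. unitvec i j) + (\<Sum>j\<in>{1..s}. \<beta>' j)"
      unfolding i(3) vadd_def by (rule sum.distrib)
    moreover have "(\<Sum>j\<in>{1..s}. unitvec i j) = 1" using i(1) by (simp add: unitvec_def)
    ultimately have "P \<beta>'" using less.hyps[of \<beta>'] i(2) by simp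
    moreover have "\<beta>' j = 0" if "j < i" for j using i(3,4) that by (auto simp: vadd_def unitvec_def)
    ultimately show ?thesis using step i by simp
  qed (use assms(2) in simp)
qed

section \<open>The associated graded ring\<close>

locale filtered_ring = ring R + adm_order n ordr
  for R (structure) and n :: nat and ordr :: "(nat \<Rightarrow> nat) \<Rightarrow> (nat \<Rightarrow> nat) \<Rightarrow> bool" +
  fixes F :: "(nat \<Rightarrow> nat) \<Rightarrow> 'a set"
  assumes F_add: "\<alpha> \<in> Nvec n \<Longrightarrow> additive_subgroup (F \<alpha>) R"
    and F_mono: "\<lbrakk>\<alpha> \<in> Nvec n; \<beta> \<in> Nvec n; ordr \<alpha> \<beta>\<rbrakk> \<Longrightarrow> F \<alpha> \<subseteq> F \<beta>"
    and F_mult: "\<lbrakk>\<alpha> \<in> Nvec n; \<beta> \<in> Nvec n; a \<in> F \<alpha>; b \<in> F \<beta>\<rbrakk> \<Longrightarrow> a \<otimes> b \<in> F (vadd \<alpha> \<beta>)"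
    and F_one: "\<one> \<in> F vzero"
begin

abbreviation "Rees \<equiv> rees R n F"
abbreviation "Low \<equiv> rees_lower R n ordr F"
abbreviation "Fp \<equiv> Fprec R n ordr F"
abbreviation "G \<equiv> assoc_graded R n ordr F"
abbreviation "cl \<equiv> gclass R n ordr F"

lemma F_carr: "\<alpha> \<in> Nvec n \<Longrightarrow> a \<in> F \<alpha> \<Longrightarrow> a \<in> carrier R"
  by (rule additive_subgroup.a_Hcarr[OF F_add])

lemma F_zero: "\<alpha> \<in> Nvec n \<Longrightarrow> \<zero> \<in> F \<alpha>"
  by (rule additive_subgroup.zero_closed[OF F_add])

lemma Fp_iff: "a \<in> Fp \<alpha> \<longleftrightarrow> a = \<zero> \<or> (\<exists>\<beta>\<in>Nvec n. prec \<beta> \<alpha> \<and> a \<in> F \<beta>)"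
  unfolding Fprec_def prec_def by auto

lemma Fp_subset: "\<alpha> \<in> Nvec n \<Longrightarrow> Fp \<alpha> \<subseteq> F \<alpha>"
  using F_mono F_zero unfolding Fp_iff subset_iff prec_def by blast

text \<open>Nothing lies below 0, and the inserted 0 makes the empty union a subgroup. Hence the
  degree-zero part of the graded ring is \<Lambda> itself.\<close>

lemma Fp_vzero: "Fp vzero = {\<zero>}"
proof -
  have "\<not> prec \<beta> vzero" if "\<beta> \<in> Nvec n" for \<beta>
    using that prec_not_ordr[OF that vzero_in_Nvec] ordr_vzero by blast
  then show ?thesis using Fp_iff by blast
qed

text \<open>A union along a chain: by totality two elements lie in a common member of the
  filtration.\<close>

lemma Fp_add:
  assumes \<alpha>: "\<alpha> \<in> Nvec n"
  shows "additive_subgroup (Fp \<alpha>) R"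
proof (rule additive_subgroupI)
  show "Fp \<alpha> \<subseteq> carrier R" using Fp_subset F_carr \<alpha> by blast
  show "\<zero> \<in> Fp \<alpha>" by (simp add: Fp_iff)
  show "\<ominus> a \<in> Fp \<alpha>" if "a \<in> Fp \<alpha>" for a
    using that additive_subgroup_uminus[OF ring_axioms F_add] unfolding Fp_iff by auto
  show "a \<oplus> b \<in> Fp \<alpha>" if ab: "a \<in> Fp \<alpha>" "b \<in> Fp \<alpha>" for a b
  proof (cases "a = \<zero> \<or> b = \<zero>")
    case True
    then show ?thesis using ab \<open>Fp \<alpha> \<subseteq> carrier R\<close> by auto
  next
    case False
    then obtain \<beta> \<gamma> where bg: "\<beta> \<in> Nvec n" "prec \<beta> \<alpha>" "a \<in> F \<beta>" "\<gamma> \<in> Nvec n" "prec \<gamma> \<alpha>" "b \<in> F \<gamma>"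
      using ab unfolding Fp_iff by blast
    from ordr_total[OF bg(1,4)] show ?thesis
    proof
      assume "ordr \<beta> \<gamma>"
      then have "a \<in> F \<gamma>" using F_mono bg by blast
      then have "a \<oplus> b \<in> F \<gamma>" using bg additive_subgroup.a_closed[OF F_add] by simp
      then show ?thesis using bg unfolding Fp_iff by blast
    next
      assume "ordr \<gamma> \<beta>"
      then have "b \<in> F \<beta>" using F_mono bg by blast
      then have "a \<oplus> b \<in> F \<beta>" using bg additive_subgroup.a_closed[OF F_add] by simp
      then show ?thesis using bg unfolding Fp_iff by blast
    qed
  qed
qed

lemma Fp_mult_right:
  assumes "\<alpha> \<in> Nvec n" "\<beta> \<in> Nvec n" "a \<in> F \<alpha>" "b \<in> Fp \<beta>"
  shows "a \<otimes> b \<in> Fp (vadd \<alpha> \<beta>)"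
proof (cases "b = \<zero>")
  case True
  then show ?thesis using assms F_carr by (simp add: Fp_iff)
next
  case False
  then obtain \<gamma> where \<gamma>: "\<gamma> \<in> Nvec n" "prec \<gamma> \<beta>" "b \<in> F \<gamma>" using assms(4) Fp_iff by blast
  then have "a \<otimes> b \<in> F (vadd \<alpha> \<gamma>)" "prec (vadd \<gamma> \<alpha>) (vadd \<beta> \<alpha>)"
    using F_mult prec_add assms by blast+
  then show ?thesis unfolding Fp_iff using \<gamma> assms vadd_comm by (metis vadd_in_Nvec)
qed

lemma Fp_mult_left:
  assumes "\<alpha> \<in> Nvec n" "\<beta> \<in> Nvec n" "a \<in> Fp \<alpha>" "b \<in> F \<beta>"
  shows "a \<otimes> b \<in> Fp (vadd \<alpha> \<beta>)"
proof (cases "a = \<zero>")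
  case True
  then show ?thesis using assms F_carr by (simp add: Fp_iff)
next
  case False
  then obtain \<gamma> where \<gamma>: "\<gamma> \<in> Nvec n" "prec \<gamma> \<alpha>" "a \<in> F \<gamma>" using assms(3) Fp_iff by blast
  then have "a \<otimes> b \<in> F (vadd \<gamma> \<beta>)" "prec (vadd \<gamma> \<beta>) (vadd \<alpha> \<beta>)"
    using F_mult prec_add assms by blast+
  then show ?thesis unfolding Fp_iff using \<gamma> assms by (metis vadd_in_Nvec)
qed

section \<open>The Rees ring of the filtration\<close>

lemma Rees_zero [simp]: "\<zero>\<^bsub>Rees\<^esub> = (\<lambda>_. \<zero>)"
  and Rees_add [simp]: "f \<oplus>\<^bsub>Rees\<^esub> g = (\<lambda>\<alpha>. f \<alpha> \<oplus> g \<alpha>)"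
  and Rees_one: "\<one>\<^bsub>Rees\<^esub> = (\<lambda>\<alpha>. if \<alpha> = vzero then \<one> else \<zero>)"
  and Rees_mult: "(f \<otimes>\<^bsub>Rees\<^esub> g) \<gamma> = (if \<gamma> \<in> Nvec n
      then (\<Oplus>\<alpha>\<in>{\<alpha>. \<forall>i. \<alpha> i \<le> \<gamma> i}. f \<alpha> \<otimes> g (\<lambda>i. \<gamma> i - \<alpha> i)) else \<zero>)"
  by (simp_all add: rees_def)

lemma Rees_carrier_iff: "f \<in> carrier Rees \<longleftrightarrow>
    (\<forall>\<alpha>\<in>Nvec n. f \<alpha> \<in> F \<alpha>) \<and> (\<forall>\<alpha>. \<alpha> \<notin> Nvec n \<longrightarrow> f \<alpha> = \<zero>) \<and> finite {\<alpha>. f \<alpha> \<noteq> \<zero>}"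
  by (auto simp: rees_def split: if_splits)

lemma Rees_comp: "f \<in> carrier Rees \<Longrightarrow> f \<alpha> \<in> carrier R"
  using F_carr by (cases "\<alpha> \<in> Nvec n") (auto simp: Rees_carrier_iff)

lemma Rees_compF: "f \<in> carrier Rees \<Longrightarrow> \<alpha> \<in> Nvec n \<Longrightarrow> f \<alpha> \<in> F \<alpha>"
  by (auto simp: Rees_carrier_iff)

lemma vadd_split: "\<forall>i. \<alpha> i \<le> \<gamma> i \<Longrightarrow> vadd \<alpha> (\<lambda>i. \<gamma> i - \<alpha> i) = \<gamma>"
  by (auto simp: vadd_def)

lemma Rees_mult_closed:
  assumes f: "f \<in> carrier Rees" and g: "g \<in> carrier Rees"
  shows "f \<otimes>\<^bsub>Rees\<^esub> g \<in> carrier Rees"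
proof -
  have mem: "f \<alpha> \<otimes> g (\<lambda>i. \<gamma> i - \<alpha> i) \<in> F \<gamma>" if "\<gamma> \<in> Nvec n" "\<forall>i. \<alpha> i \<le> \<gamma> i" for \<alpha> \<gamma>
  proof -
    have "\<alpha> \<in> Nvec n" using Nvec_le that by blast
    then have "f \<alpha> \<otimes> g (\<lambda>i. \<gamma> i - \<alpha> i) \<in> F (vadd \<alpha> (\<lambda>i. \<gamma> i - \<alpha> i))"
      using f g that Rees_compF Nvec_minus by (intro F_mult) auto
    then show ?thesis by (simp add: vadd_split[OF that(2)])
  qed
  have "(f \<otimes>\<^bsub>Rees\<^esub> g) \<gamma> \<in> F \<gamma>" if "\<gamma> \<in> Nvec n" for \<gamma>
    unfolding Rees_mult using that mem
    by (auto intro!: additive_subgroup_finsum F_add finite_vectors_below)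
  \<comment> \<open>Finite support: a nonzero convolution value needs a nonzero summand, so its
    index is a sum of indices from the two supports.\<close>
  moreover have "{\<gamma>. (f \<otimes>\<^bsub>Rees\<^esub> g) \<gamma> \<noteq> \<zero>} \<subseteq> (\<lambda>(\<alpha>, \<beta>). vadd \<alpha> \<beta>) ` ({\<alpha>. f \<alpha> \<noteq> \<zero>} \<times> {\<beta>. g \<beta> \<noteq> \<zero>})"
  proof
    fix \<gamma> assume "\<gamma> \<in> {\<gamma>. (f \<otimes>\<^bsub>Rees\<^esub> g) \<gamma> \<noteq> \<zero>}"
    then have nz: "(\<Oplus>\<alpha>\<in>{\<alpha>. \<forall>i. \<alpha> i \<le> \<gamma> i}. f \<alpha> \<otimes> g (\<lambda>i. \<gamma> i - \<alpha> i)) \<noteq> \<zero>"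
      by (auto simp: Rees_mult split: if_splits)
    have "\<exists>\<alpha>. (\<forall>i. \<alpha> i \<le> \<gamma> i) \<and> f \<alpha> \<otimes> g (\<lambda>i. \<gamma> i - \<alpha> i) \<noteq> \<zero>"
    proof (rule ccontr)
      assume "\<not> ?thesis"
      then have "(\<Oplus>\<alpha>\<in>{\<alpha>. \<forall>i. \<alpha> i \<le> \<gamma> i}. f \<alpha> \<otimes> g (\<lambda>i. \<gamma> i - \<alpha> i)) = \<zero>"
        by (intro add.finprod_one_eqI) blast
      then show False using nz by blast
    qed
    then obtain \<alpha> where \<alpha>: "\<forall>i. \<alpha> i \<le> \<gamma> i" "f \<alpha> \<otimes> g (\<lambda>i. \<gamma> i - \<alpha> i) \<noteq> \<zero>" by blast
    then have "f \<alpha> \<noteq> \<zero>" "g (\<lambda>i. \<gamma> i - \<alpha> i) \<noteq> \<zero>" using Rees_comp[OF f] Rees_comp[OF g] by auto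
    then show "\<gamma> \<in> (\<lambda>(\<alpha>, \<beta>). vadd \<alpha> \<beta>) ` ({\<alpha>. f \<alpha> \<noteq> \<zero>} \<times> {\<beta>. g \<beta> \<noteq> \<zero>})"
      using vadd_split[OF \<alpha>(1)] by (intro image_eqI[of _ _ "(\<alpha>, \<lambda>i. \<gamma> i - \<alpha> i)"]) auto
  qed
  then have "finite {\<gamma>. (f \<otimes>\<^bsub>Rees\<^esub> g) \<gamma> \<noteq> \<zero>}"
    by (rule finite_subset) (use f g in \<open>auto simp: Rees_carrier_iff\<close>)
  ultimately show ?thesis unfolding Rees_carrier_iff by (auto simp: Rees_mult)
qed

text \<open>Both sides are sums over the ways to write \<gamma> as a sum of three vectors. In
  \<open>S\<close> a decomposition is recorded by the sum of the first two parts together with the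
  first, in \<open>S'\<close> by the first two parts; the map from \<open>S\<close> to
  \<open>S'\<close> subtracts. Truncated subtraction is harmless because all vectors stay pointwise
  below \<gamma>.\<close>

lemma Rees_assoc:
  assumes f: "f \<in> carrier Rees" and g: "g \<in> carrier Rees" and h: "h \<in> carrier Rees"
  shows "(f \<otimes>\<^bsub>Rees\<^esub> g) \<otimes>\<^bsub>Rees\<^esub> h = f \<otimes>\<^bsub>Rees\<^esub> (g \<otimes>\<^bsub>Rees\<^esub> h)"
proof
  fix \<gamma>
  show "((f \<otimes>\<^bsub>Rees\<^esub> g) \<otimes>\<^bsub>Rees\<^esub> h) \<gamma> = (f \<otimes>\<^bsub>Rees\<^esub> (g \<otimes>\<^bsub>Rees\<^esub> h)) \<gamma>"
  proof (cases "\<gamma> \<in> Nvec n")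
    case True
    let ?B = "\<lambda>\<gamma>::nat \<Rightarrow> nat. {\<alpha>. \<forall>i. \<alpha> i \<le> \<gamma> i}"
    let ?m = "\<lambda>\<gamma> \<alpha> i. \<gamma> i - \<alpha> i :: nat"
    note c = Rees_comp[OF f] Rees_comp[OF g] Rees_comp[OF h]
    have B: "finite (?B \<gamma>)" "\<And>\<alpha>. \<alpha> \<in> ?B \<gamma> \<Longrightarrow> finite (?B \<alpha>)"
      "\<And>\<alpha>. finite (?B (?m \<gamma> \<alpha>))" "\<And>\<alpha>. \<alpha> \<in> ?B \<gamma> \<Longrightarrow> \<alpha> \<in> Nvec n" "\<And>\<alpha>. ?m \<gamma> \<alpha> \<in> Nvec n"
      using True Nvec_le Nvec_minus finite_vectors_below by blast+
    define S where "S = Sigma (?B \<gamma>) ?B"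
    define S' where "S' = Sigma (?B \<gamma>) (\<lambda>\<beta>. ?B (?m \<gamma> \<beta>))"
    define t where "t = (\<lambda>p. f (fst p) \<otimes> (g (snd p) \<otimes> h (?m (?m \<gamma> (fst p)) (snd p))))"
    have "((f \<otimes>\<^bsub>Rees\<^esub> g) \<otimes>\<^bsub>Rees\<^esub> h) \<gamma> = (\<Oplus>\<alpha>\<in>?B \<gamma>. (\<Oplus>\<beta>\<in>?B \<alpha>. f \<beta> \<otimes> g (?m \<alpha> \<beta>)) \<otimes> h (?m \<gamma> \<alpha>))"
      using True B(4) c
      by (simp add: Rees_mult[of "f \<otimes>\<^bsub>Rees\<^esub> g"]) (rule finsum_cong', auto simp: Rees_mult)
    also have "\<dots> = (\<Oplus>\<alpha>\<in>?B \<gamma>. \<Oplus>\<beta>\<in>?B \<alpha>. t (\<beta>, ?m \<alpha> \<beta>))"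
    proof (rule finsum_cong'[OF refl])
      show "(\<lambda>\<alpha>. \<Oplus>\<beta>\<in>?B \<alpha>. t (\<beta>, ?m \<alpha> \<beta>)) \<in> ?B \<gamma> \<rightarrow> carrier R"
        using c by (auto simp: t_def intro!: finsum_closed)
      fix \<alpha> assume \<alpha>: "\<alpha> \<in> ?B \<gamma>"
      have "(\<Oplus>\<beta>\<in>?B \<alpha>. f \<beta> \<otimes> g (?m \<alpha> \<beta>)) \<otimes> h (?m \<gamma> \<alpha>)
          = (\<Oplus>\<beta>\<in>?B \<alpha>. f \<beta> \<otimes> g (?m \<alpha> \<beta>) \<otimes> h (?m \<gamma> \<alpha>))"
        using c B(2)[OF \<alpha>] by (intro finsum_ldistr) auto
      also have "\<dots> = (\<Oplus>\<beta>\<in>?B \<alpha>. t (\<beta>, ?m \<alpha> \<beta>))"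
      proof (rule finsum_cong'[OF refl])
        show "(\<lambda>\<beta>. t (\<beta>, ?m \<alpha> \<beta>)) \<in> ?B \<alpha> \<rightarrow> carrier R" using c by (auto simp: t_def)
        fix \<beta> assume "\<beta> \<in> ?B \<alpha>"
        then have "?m (?m \<gamma> \<beta>) (?m \<alpha> \<beta>) = ?m \<gamma> \<alpha>" using \<alpha> by (auto simp: fun_eq_iff)
        then show "f \<beta> \<otimes> g (?m \<alpha> \<beta>) \<otimes> h (?m \<gamma> \<alpha>) = t (\<beta>, ?m \<alpha> \<beta>)"
          using c by (simp add: t_def m_assoc)
      qed
      finally show "(\<Oplus>\<beta>\<in>?B \<alpha>. f \<beta> \<otimes> g (?m \<alpha> \<beta>)) \<otimes> h (?m \<gamma> \<alpha>) = (\<Oplus>\<beta>\<in>?B \<alpha>. t (\<beta>, ?m \<alpha> \<beta>))" .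
    qed
    also have "\<dots> = (\<Oplus>p\<in>S. t (snd p, ?m (fst p) (snd p)))"
      unfolding S_def by (subst finsum_Sigma) (use B c in \<open>auto simp: t_def\<close>)
    also have "\<dots> = (\<Oplus>p\<in>(\<lambda>p. (snd p, ?m (fst p) (snd p))) ` S. t p)"
    proof (rule finsum_reindex[symmetric])
      show "t \<in> (\<lambda>p. (snd p, ?m (fst p) (snd p))) ` S \<rightarrow> carrier R" using c by (auto simp: t_def)
      show "inj_on (\<lambda>p. (snd p, ?m (fst p) (snd p))) S"
      proof (rule inj_onI)
        fix p p' assume p: "p \<in> S" "p' \<in> S" and eq: "(snd p, ?m (fst p) (snd p)) = (snd p', ?m (fst p') (snd p'))"
        have "fst p = vadd (snd p) (?m (fst p) (snd p))" "fst p' = vadd (snd p') (?m (fst p') (snd p'))"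
          using p by (auto simp: S_def vadd_split)
        then show "p = p'" using eq by (metis prod.collapse prod.inject)
      qed
    qed
    also have "(\<lambda>p. (snd p, ?m (fst p) (snd p))) ` S = S'"
    proof
      show "(\<lambda>p. (snd p, ?m (fst p) (snd p))) ` S \<subseteq> S'"
        unfolding S_def S'_def by (auto intro: diff_le_mono) (meson le_trans)
      show "S' \<subseteq> (\<lambda>p. (snd p, ?m (fst p) (snd p))) ` S"
      proof
        fix p assume "p \<in> S'"
        then obtain \<beta> \<delta> where p: "p = (\<beta>, \<delta>)" "\<And>i. \<beta> i \<le> \<gamma> i" "\<And>i. \<delta> i \<le> \<gamma> i - \<beta> i"
          unfolding S'_def by auto
        have "vadd \<beta> \<delta> i \<le> \<gamma> i" for i using p(2)[of i] p(3)[of i] by (simp add: vadd_def)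
        then have "(vadd \<beta> \<delta>, \<beta>) \<in> S" unfolding S_def by (auto simp: vadd_def)
        moreover have "p = (snd (vadd \<beta> \<delta>, \<beta>), ?m (fst (vadd \<beta> \<delta>, \<beta>)) (snd (vadd \<beta> \<delta>, \<beta>)))"
          using p(1) by (auto simp: vadd_def)
        ultimately show "p \<in> (\<lambda>p. (snd p, ?m (fst p) (snd p))) ` S" by (rule rev_image_eqI)
      qed
    qed
    also have "(\<Oplus>p\<in>S'. t p) = (\<Oplus>\<beta>\<in>?B \<gamma>. \<Oplus>\<delta>\<in>?B (?m \<gamma> \<beta>). t (\<beta>, \<delta>))"
      unfolding S'_def by (rule finsum_Sigma) (use B c in \<open>auto simp: t_def\<close>)
    also have "\<dots> = (\<Oplus>\<beta>\<in>?B \<gamma>. f \<beta> \<otimes> (\<Oplus>\<delta>\<in>?B (?m \<gamma> \<beta>). g \<delta> \<otimes> h (?m (?m \<gamma> \<beta>) \<delta>)))"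
      by (rule finsum_cong'[OF refl])
        (use B c in \<open>auto simp: t_def intro!: finsum_rdistr[symmetric] m_closed finsum_closed\<close>)
    also have "\<dots> = (f \<otimes>\<^bsub>Rees\<^esub> (g \<otimes>\<^bsub>Rees\<^esub> h)) \<gamma>"
      using True B(5) by (simp add: Rees_mult)
    finally show ?thesis .
  qed (simp add: Rees_mult)
qed

definition single :: "(nat \<Rightarrow> nat) \<Rightarrow> 'a \<Rightarrow> (nat \<Rightarrow> nat) \<Rightarrow> 'a" where
  "single \<alpha> r = (\<lambda>\<beta>. if \<beta> = \<alpha> then r else \<zero>)"

lemma single_closed: "\<alpha> \<in> Nvec n \<Longrightarrow> r \<in> F \<alpha> \<Longrightarrow> single \<alpha> r \<in> carrier Rees"
proof -
  assume "\<alpha> \<in> Nvec n" "r \<in> F \<alpha>"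
  moreover have "{\<beta>. single \<alpha> r \<beta> \<noteq> \<zero>} \<subseteq> {\<alpha>}" by (auto simp: single_def)
  ultimately show ?thesis
    unfolding Rees_carrier_iff using F_zero by (auto simp: single_def)
qed

lemma single_mult:
  assumes "\<alpha> \<in> Nvec n" "g \<in> carrier Rees" "r \<in> F \<alpha>" "\<gamma> \<in> Nvec n"
  shows "(single \<alpha> r \<otimes>\<^bsub>Rees\<^esub> g) \<gamma> = (if \<forall>i. \<alpha> i \<le> \<gamma> i then r \<otimes> g (\<lambda>i. \<gamma> i - \<alpha> i) else \<zero>)"
proof -
  have r: "r \<in> carrier R" using F_carr assms by blast
  have "(single \<alpha> r \<otimes>\<^bsub>Rees\<^esub> g) \<gamma>
      = (\<Oplus>\<beta>\<in>{\<beta>. \<forall>i. \<beta> i \<le> \<gamma> i}. if \<alpha> = \<beta> then r \<otimes> g (\<lambda>i. \<gamma> i - \<beta> i) else \<zero>)"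
    using assms(4) r Rees_comp[OF assms(2)]
    by (simp add: Rees_mult) (rule finsum_cong', auto simp: single_def)
  also have "\<dots> = (if \<forall>i. \<alpha> i \<le> \<gamma> i then r \<otimes> g (\<lambda>i. \<gamma> i - \<alpha> i) else \<zero>)"
  proof (cases "\<forall>i. \<alpha> i \<le> \<gamma> i")
    case True
    then show ?thesis
      using finsum_singleton[of \<alpha> "{\<beta>. \<forall>i. \<beta> i \<le> \<gamma> i}" "\<lambda>\<beta>. r \<otimes> g (\<lambda>i. \<gamma> i - \<beta> i)"]
        finite_vectors_below[OF assms(4)] r Rees_comp[OF assms(2)] by simp
  next
    case False
    then have "(\<Oplus>\<beta>\<in>{\<beta>. \<forall>i. \<beta> i \<le> \<gamma> i}. if \<alpha> = \<beta> then r \<otimes> g (\<lambda>i. \<gamma> i - \<beta> i) else \<zero>) = \<zero>"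
      by (intro add.finprod_one_eqI) auto
    then show ?thesis using False by auto
  qed
  finally show ?thesis .
qed

lemma mult_single_vzero:
  assumes "f \<in> carrier Rees"
  shows "f \<otimes>\<^bsub>Rees\<^esub> single vzero \<one> = f"
proof
  fix \<gamma>
  show "(f \<otimes>\<^bsub>Rees\<^esub> single vzero \<one>) \<gamma> = f \<gamma>"
  proof (cases "\<gamma> \<in> Nvec n")
    case True
    have "(f \<otimes>\<^bsub>Rees\<^esub> single vzero \<one>) \<gamma>
        = (\<Oplus>\<alpha>\<in>{\<alpha>. \<forall>i. \<alpha> i \<le> \<gamma> i}. f \<alpha> \<otimes> single vzero \<one> (\<lambda>i. \<gamma> i - \<alpha> i))"
      using True by (simp add: Rees_mult)
    also have "\<dots> = (\<Oplus>\<alpha>\<in>{\<alpha>. \<forall>i. \<alpha> i \<le> \<gamma> i}. if \<gamma> = \<alpha> then f \<alpha> else \<zero>)"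
    proof (rule finsum_cong'[OF refl])
      fix \<alpha> assume "\<alpha> \<in> {\<alpha>. \<forall>i. \<alpha> i \<le> \<gamma> i}"
      then have "(\<lambda>i. \<gamma> i - \<alpha> i) = vzero \<longleftrightarrow> \<gamma> = \<alpha>"
        by (auto simp: vzero_def fun_eq_iff intro: le_antisym)
      then show "f \<alpha> \<otimes> single vzero \<one> (\<lambda>i. \<gamma> i - \<alpha> i) = (if \<gamma> = \<alpha> then f \<alpha> else \<zero>)"
        using Rees_comp[OF assms] by (simp add: single_def)
    qed (use Rees_comp[OF assms] in auto)
    also have "\<dots> = f \<gamma>"
      by (rule finsum_singleton) (use finite_vectors_below[OF True] Rees_comp[OF assms] in auto)
    finally show ?thesis .
  next
    case False
    then show ?thesis using assms by (simp add: Rees_mult Rees_carrier_iff)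
  qed
qed

lemma Rees_one_single: "\<one>\<^bsub>Rees\<^esub> = single vzero \<one>"
  by (auto simp: Rees_one single_def)

lemma Rees_add_closed:
  assumes "f \<in> carrier Rees" "g \<in> carrier Rees"
  shows "(\<lambda>\<alpha>. f \<alpha> \<oplus> g \<alpha>) \<in> carrier Rees"
proof -
  have "{\<alpha>. f \<alpha> \<oplus> g \<alpha> \<noteq> \<zero>} \<subseteq> {\<alpha>. f \<alpha> \<noteq> \<zero>} \<union> {\<alpha>. g \<alpha> \<noteq> \<zero>}" by auto
  then have "finite {\<alpha>. f \<alpha> \<oplus> g \<alpha> \<noteq> \<zero>}"
    by (rule finite_subset) (use assms in \<open>auto simp: Rees_carrier_iff\<close>)
  then show ?thesis
    using assms F_add additive_subgroup.a_closed[OF F_add] by (auto simp: Rees_carrier_iff)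
qed

lemma Rees_uminus_closed:
  assumes "f \<in> carrier Rees"
  shows "(\<lambda>\<alpha>. \<ominus> f \<alpha>) \<in> carrier Rees"
proof -
  have "{\<alpha>. \<ominus> f \<alpha> \<noteq> \<zero>} \<subseteq> {\<alpha>. f \<alpha> \<noteq> \<zero>}" by auto
  then have "finite {\<alpha>. \<ominus> f \<alpha> \<noteq> \<zero>}"
    by (rule finite_subset) (use assms in \<open>auto simp: Rees_carrier_iff\<close>)
  then show ?thesis
    using assms additive_subgroup_uminus[OF ring_axioms F_add] by (auto simp: Rees_carrier_iff)
qed

lemma Rees_zero_closed: "(\<lambda>_. \<zero>) \<in> carrier Rees"
  using F_zero by (auto simp: Rees_carrier_iff)

lemma Rees_ring: "ring Rees"
proof (rule ringI)
  show "abelian_group Rees"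
  proof (rule abelian_groupI)
    fix f assume f: "f \<in> carrier Rees"
    have "(\<lambda>\<alpha>. \<ominus> f \<alpha> \<oplus> f \<alpha>) = (\<lambda>_. \<zero>)" using Rees_comp[OF f] by (auto simp: l_neg)
    then show "\<exists>g\<in>carrier Rees. g \<oplus>\<^bsub>Rees\<^esub> f = \<zero>\<^bsub>Rees\<^esub>"
      using Rees_uminus_closed[OF f] by (intro bexI[of _ "\<lambda>\<alpha>. \<ominus> f \<alpha>"]) simp_all
  qed (use Rees_comp in \<open>auto simp: Rees_add_closed Rees_zero_closed a_ac fun_eq_iff\<close>)
  show "monoid Rees"
  proof (rule monoidI)
    show "\<one>\<^bsub>Rees\<^esub> \<in> carrier Rees" unfolding Rees_one_single using single_closed F_one by simp
    fix f assume f: "f \<in> carrier Rees"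
    show "f \<otimes>\<^bsub>Rees\<^esub> \<one>\<^bsub>Rees\<^esub> = f" unfolding Rees_one_single by (rule mult_single_vzero[OF f])
    show "\<one>\<^bsub>Rees\<^esub> \<otimes>\<^bsub>Rees\<^esub> f = f"
    proof
      fix \<gamma>
      show "(\<one>\<^bsub>Rees\<^esub> \<otimes>\<^bsub>Rees\<^esub> f) \<gamma> = f \<gamma>"
      proof (cases "\<gamma> \<in> Nvec n")
        case True
        then show ?thesis
          unfolding Rees_one_single using single_mult[OF vzero_in_Nvec f F_one True] Rees_comp[OF f]
          by (simp add: vzero_def)
      next
        case False
        then show ?thesis using f by (simp add: Rees_mult Rees_carrier_iff)
      qed
    qed
  qed (use Rees_mult_closed Rees_assoc in auto)
  fix f g h assume fgh: "f \<in> carrier Rees" "g \<in> carrier Rees" "h \<in> carrier Rees"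
  note c = Rees_comp[OF fgh(1)] Rees_comp[OF fgh(2)] Rees_comp[OF fgh(3)]
  show "(f \<oplus>\<^bsub>Rees\<^esub> g) \<otimes>\<^bsub>Rees\<^esub> h = f \<otimes>\<^bsub>Rees\<^esub> h \<oplus>\<^bsub>Rees\<^esub> g \<otimes>\<^bsub>Rees\<^esub> h"
    using c by (auto simp: fun_eq_iff Rees_mult l_distr finsum_addf)
  show "h \<otimes>\<^bsub>Rees\<^esub> (f \<oplus>\<^bsub>Rees\<^esub> g) = h \<otimes>\<^bsub>Rees\<^esub> f \<oplus>\<^bsub>Rees\<^esub> h \<otimes>\<^bsub>Rees\<^esub> g"
    using c by (auto simp: fun_eq_iff Rees_mult r_distr finsum_addf)
qed

sublocale Rs: ring Rees
  by (rule Rees_ring)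

lemma Rees_uminus: "f \<in> carrier Rees \<Longrightarrow> \<ominus>\<^bsub>Rees\<^esub> f = (\<lambda>\<alpha>. \<ominus> f \<alpha>)"
  by (rule Rs.minus_equality) (use Rees_comp in \<open>auto simp: l_neg Rees_uminus_closed\<close>)

lemma Low_iff: "f \<in> Low \<longleftrightarrow> f \<in> carrier Rees \<and> (\<forall>\<alpha>\<in>Nvec n. f \<alpha> \<in> Fp \<alpha>)"
  by (simp add: rees_lower_def)

text \<open>Every summand of a convolution has one factor in a lower piece, and compatibility of the
  order with addition keeps the product in the lower piece of the sum of the degrees.\<close>

lemma Low_ideal: "ideal Low Rees"
proof (rule idealI[OF Rees_ring])
  show "subgroup Low (add_monoid Rees)"
  proof (rule additive_subgroup.a_subgroup, rule Rs.additive_subgroupI)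
    show "\<zero>\<^bsub>Rees\<^esub> \<in> Low" using Rees_zero_closed by (simp add: Low_iff Fp_iff)
    show "f \<oplus>\<^bsub>Rees\<^esub> g \<in> Low" if "f \<in> Low" "g \<in> Low" for f g
      using that Rees_add_closed additive_subgroup.a_closed[OF Fp_add] by (auto simp: Low_iff)
    show "\<ominus>\<^bsub>Rees\<^esub> f \<in> Low" if "f \<in> Low" for f
      using that Rees_uminus_closed additive_subgroup_uminus[OF ring_axioms Fp_add]
      by (auto simp: Low_iff Rees_uminus)
  qed (auto simp: Low_iff)
  fix f g assume f: "f \<in> Low" and g: "g \<in> carrier Rees"
  then have fR: "f \<in> carrier Rees" by (simp add: Low_iff)
  show "g \<otimes>\<^bsub>Rees\<^esub> f \<in> Low"
    unfolding Low_iff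
  proof (intro conjI ballI)
    show "g \<otimes>\<^bsub>Rees\<^esub> f \<in> carrier Rees" using g fR by simp
    fix \<gamma> assume \<gamma>: "\<gamma> \<in> Nvec n"
    have "g \<alpha> \<otimes> f (\<lambda>i. \<gamma> i - \<alpha> i) \<in> Fp \<gamma>" if "\<forall>i. \<alpha> i \<le> \<gamma> i" for \<alpha>
      using Fp_mult_right[of \<alpha> "\<lambda>i. \<gamma> i - \<alpha> i" "g \<alpha>" "f (\<lambda>i. \<gamma> i - \<alpha> i)"] that \<gamma> f
        Rees_compF[OF g] Nvec_le Nvec_minus by (auto simp: vadd_split Low_iff)
    then show "(g \<otimes>\<^bsub>Rees\<^esub> f) \<gamma> \<in> Fp \<gamma>"
      using \<gamma> additive_subgroup_finsum[OF Fp_add finite_vectors_below] by (simp add: Rees_mult)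
  qed
  show "f \<otimes>\<^bsub>Rees\<^esub> g \<in> Low"
    unfolding Low_iff
  proof (intro conjI ballI)
    show "f \<otimes>\<^bsub>Rees\<^esub> g \<in> carrier Rees" using g fR by simp
    fix \<gamma> assume \<gamma>: "\<gamma> \<in> Nvec n"
    have "f \<alpha> \<otimes> g (\<lambda>i. \<gamma> i - \<alpha> i) \<in> Fp \<gamma>" if "\<forall>i. \<alpha> i \<le> \<gamma> i" for \<alpha>
      using Fp_mult_left[of \<alpha> "\<lambda>i. \<gamma> i - \<alpha> i" "f \<alpha>" "g (\<lambda>i. \<gamma> i - \<alpha> i)"] that \<gamma> f
        Rees_compF[OF g] Nvec_le Nvec_minus by (auto simp: vadd_split Low_iff)
    then show "(f \<otimes>\<^bsub>Rees\<^esub> g) \<gamma> \<in> Fp \<gamma>"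
      using \<gamma> additive_subgroup_finsum[OF Fp_add finite_vectors_below] by (simp add: Rees_mult)
  qed
qed

section \<open>Homogeneous classes in the associated graded ring\<close>

definition proj :: "((nat \<Rightarrow> nat) \<Rightarrow> 'a) \<Rightarrow> ((nat \<Rightarrow> nat) \<Rightarrow> 'a) set" where
  "proj = a_r_coset Rees Low"

sublocale pr: ring_hom_ring Rees G proj
  unfolding proj_def assoc_graded_def by (rule ideal.rcos_ring_hom_ring[OF Low_ideal])

lemma G_ring: "ring G"
  by (rule pr.S.ring_axioms)

lemma cl_eq: "cl \<alpha> r = proj (single \<alpha> r)"
  by (simp add: gclass_def proj_def single_def)

lemma proj_zero_iff:
  assumes "f \<in> carrier Rees"
  shows "proj f = \<zero>\<^bsub>G\<^esub> \<longleftrightarrow> f \<in> Low"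
proof -
  have "\<zero>\<^bsub>G\<^esub> = Low" by (simp add: assoc_graded_def FactRing_def)
  then show ?thesis
    unfolding proj_def using assms ideal.rcos_const_imp_mem[OF Low_ideal] Rs.a_rcos_zero[OF Low_ideal] by auto
qed

lemma proj_surj: "g \<in> carrier G \<Longrightarrow> \<exists>f\<in>carrier Rees. g = proj f"
  by (auto simp: assoc_graded_def FactRing_def proj_def A_RCOSETS_def')

lemma cl_closed: "\<alpha> \<in> Nvec n \<Longrightarrow> r \<in> F \<alpha> \<Longrightarrow> cl \<alpha> r \<in> carrier G"
  unfolding cl_eq using single_closed by simp

lemma cl_one: "cl vzero \<one> = \<one>\<^bsub>G\<^esub>"
  unfolding cl_eq Rees_one_single[symmetric] by simp

lemma cl_add:
  assumes "\<alpha> \<in> Nvec n" "r \<in> F \<alpha>" "t \<in> F \<alpha>"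
  shows "cl \<alpha> (r \<oplus> t) = cl \<alpha> r \<oplus>\<^bsub>G\<^esub> cl \<alpha> t"
proof -
  have "single \<alpha> (r \<oplus> t) = single \<alpha> r \<oplus>\<^bsub>Rees\<^esub> single \<alpha> t" by (auto simp: single_def)
  then show ?thesis unfolding cl_eq using pr.hom_add single_closed assms by metis
qed

lemma cl_mult:
  assumes "\<alpha> \<in> Nvec n" "\<beta> \<in> Nvec n" "r \<in> F \<alpha>" "t \<in> F \<beta>"
  shows "cl \<alpha> r \<otimes>\<^bsub>G\<^esub> cl \<beta> t = cl (vadd \<alpha> \<beta>) (r \<otimes> t)"
proof -
  have r: "r \<in> carrier R" using assms F_carr by blast
  have "single \<alpha> r \<otimes>\<^bsub>Rees\<^esub> single \<beta> t = single (vadd \<alpha> \<beta>) (r \<otimes> t)"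
  proof
    fix \<gamma>
    show "(single \<alpha> r \<otimes>\<^bsub>Rees\<^esub> single \<beta> t) \<gamma> = single (vadd \<alpha> \<beta>) (r \<otimes> t) \<gamma>"
    proof (cases "\<gamma> \<in> Nvec n")
      case True
      have "(\<forall>i. \<alpha> i \<le> \<gamma> i) \<and> (\<lambda>i. \<gamma> i - \<alpha> i) = \<beta> \<longleftrightarrow> \<gamma> = vadd \<alpha> \<beta>"
        by (auto simp: vadd_def fun_eq_iff) (metis le_add_diff_inverse)
      then show ?thesis
        using single_mult[OF assms(1) single_closed[OF assms(2,4)] assms(3) True] r
        by (auto simp: single_def)
    next
      case False
      then have "\<gamma> \<noteq> vadd \<alpha> \<beta>" using assms by auto
      then show ?thesis using False by (simp add: Rees_mult single_def)
    qed
  qed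
  then show ?thesis unfolding cl_eq using pr.hom_mult single_closed assms by metis
qed

lemma Rees_finsum_eval:
  assumes "finite S" "f \<in> S \<rightarrow> carrier Rees"
  shows "finsum Rees f S \<alpha> = (\<Oplus>i\<in>S. f i \<alpha>)"
  using assms
proof (induction rule: finite_induct)
  case (insert x S)
  then have "finsum Rees f (insert x S) = f x \<oplus>\<^bsub>Rees\<^esub> finsum Rees f S"
    by (intro Rs.finsum_insert) auto
  then show ?case using insert Rees_comp by (subst finsum_insert) (auto simp: Pi_iff)
qed simp

lemma proj_finsum:
  assumes "finite S" "f \<in> S \<rightarrow> carrier Rees"
  shows "proj (finsum Rees f S) = (\<Oplus>\<^bsub>G\<^esub>i\<in>S. proj (f i))"
  using assms
proof (induction rule: finite_induct)
  case (insert x S)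
  then have "finsum Rees f (insert x S) = f x \<oplus>\<^bsub>Rees\<^esub> finsum Rees f S"
    by (intro Rs.finsum_insert) auto
  moreover have "proj (f x \<oplus>\<^bsub>Rees\<^esub> finsum Rees f S) = proj (f x) \<oplus>\<^bsub>G\<^esub> proj (finsum Rees f S)"
    using insert by (intro pr.hom_add Rs.finsum_closed) auto
  moreover have "(\<Oplus>\<^bsub>G\<^esub>i\<in>insert x S. proj (f i)) = proj (f x) \<oplus>\<^bsub>G\<^esub> (\<Oplus>\<^bsub>G\<^esub>i\<in>S. proj (f i))"
    using insert by (intro pr.S.finsum_insert) (auto simp: Pi_iff)
  ultimately show ?case using insert by auto
qed (use pr.hom_zero in simp)

text \<open>A class vanishes exactly if its representative is lower in each degree. Several summands
  may share a degree, so they are collected before the test.\<close>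

lemma finsum_cl_zero_iff:
  assumes "finite S" "\<And>i. i \<in> S \<Longrightarrow> w i \<in> Nvec n" "\<And>i. i \<in> S \<Longrightarrow> r i \<in> F (w i)"
  shows "(\<Oplus>\<^bsub>G\<^esub>i\<in>S. cl (w i) (r i)) = \<zero>\<^bsub>G\<^esub> \<longleftrightarrow> (\<forall>\<alpha>\<in>Nvec n. (\<Oplus>i\<in>{i\<in>S. w i = \<alpha>}. r i) \<in> Fp \<alpha>)"
proof -
  let ?f = "\<lambda>i. single (w i) (r i)"
  have f: "?f \<in> S \<rightarrow> carrier Rees" using assms single_closed by auto
  have fin: "finsum Rees ?f S \<in> carrier Rees" using f by (rule Rs.finsum_closed)
  have ev: "finsum Rees ?f S \<alpha> = (\<Oplus>i\<in>{i\<in>S. w i = \<alpha>}. r i)" for \<alpha>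
    unfolding Rees_finsum_eval[OF assms(1) f]
    by (rule add.finprod_mono_neutral_cong_right)
      (use assms(1) F_carr[OF assms(2,3)] in \<open>auto simp: single_def\<close>)
  have "(\<Oplus>\<^bsub>G\<^esub>i\<in>S. cl (w i) (r i)) = proj (finsum Rees ?f S)"
    unfolding cl_eq using proj_finsum[OF assms(1) f] by simp
  then show ?thesis
    using proj_zero_iff[OF fin] fin unfolding Low_iff ev by simp
qed

lemma cl_zero_iff:
  assumes "\<alpha> \<in> Nvec n" "r \<in> F \<alpha>"
  shows "cl \<alpha> r = \<zero>\<^bsub>G\<^esub> \<longleftrightarrow> r \<in> Fp \<alpha>"
proof -
  have "single \<alpha> r \<in> Low \<longleftrightarrow> r \<in> Fp \<alpha>"
    unfolding Low_iff using single_closed[OF assms] assms by (auto simp: single_def Fp_iff)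
  then show ?thesis unfolding cl_eq using proj_zero_iff[OF single_closed[OF assms]] by simp
qed

lemma cl_uminus:
  assumes "\<alpha> \<in> Nvec n" "r \<in> F \<alpha>"
  shows "cl \<alpha> (\<ominus> r) = \<ominus>\<^bsub>G\<^esub> cl \<alpha> r"
proof -
  have m: "\<ominus> r \<in> F \<alpha>" using assms additive_subgroup_uminus[OF ring_axioms F_add] by simp
  have "cl \<alpha> (\<ominus> r) \<oplus>\<^bsub>G\<^esub> cl \<alpha> r = cl \<alpha> (\<ominus> r \<oplus> r)" using cl_add assms m by simp
  also have "\<dots> = \<zero>\<^bsub>G\<^esub>"
    using assms F_carr F_zero cl_zero_iff[of \<alpha> \<zero>] by (simp add: l_neg Fp_iff)
  finally show ?thesis
    using cl_closed assms m by (intro pr.S.minus_equality[symmetric]) auto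
qed

lemma cl_finsum:
  assumes "finite S" "\<alpha> \<in> Nvec n" "\<And>i. i \<in> S \<Longrightarrow> r i \<in> F \<alpha>"
  shows "cl \<alpha> (\<Oplus>i\<in>S. r i) = (\<Oplus>\<^bsub>G\<^esub>i\<in>S. cl \<alpha> (r i))"
proof -
  have f: "(\<lambda>i. single \<alpha> (r i)) \<in> S \<rightarrow> carrier Rees" using assms single_closed by auto
  have "single \<alpha> (\<Oplus>i\<in>S. r i) = finsum Rees (\<lambda>i. single \<alpha> (r i)) S"
    unfolding fun_eq_iff Rees_finsum_eval[OF assms(1) f] by (simp add: single_def)
  then show ?thesis unfolding cl_eq using proj_finsum[OF assms(1) f] by simp
qed

lemma cl_eq_iff:
  assumes "\<alpha> \<in> Nvec n" "r \<in> F \<alpha>" "t \<in> F \<alpha>"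
  shows "cl \<alpha> r = cl \<alpha> t \<longleftrightarrow> r \<ominus> t \<in> Fp \<alpha>"
proof -
  have m: "\<ominus> t \<in> F \<alpha>" using assms additive_subgroup_uminus[OF ring_axioms F_add] by simp
  have "cl \<alpha> (r \<ominus> t) = cl \<alpha> r \<ominus>\<^bsub>G\<^esub> cl \<alpha> t"
    unfolding a_minus_def using cl_add cl_uminus assms m by simp
  moreover have "r \<ominus> t \<in> F \<alpha>" using additive_subgroup_minus[OF F_add] assms by blast
  ultimately show ?thesis
    using cl_zero_iff[OF assms(1)] pr.S.r_right_minus_eq cl_closed assms by metis
qed

text \<open>Reads off the component in degree \<alpha>: summands of other degrees do not contribute
  to it and nothing has to be known about them. This is how an expansion of \<sigma> is reduced to
  its relevant part.\<close>

lemma cl_eq_finsum: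
  assumes "finite S" "\<And>i. i \<in> S \<Longrightarrow> w i \<in> Nvec n" "\<And>i. i \<in> S \<Longrightarrow> r i \<in> F (w i)"
    and \<alpha>: "\<alpha> \<in> Nvec n" "t \<in> F \<alpha>" and eq: "cl \<alpha> t = (\<Oplus>\<^bsub>G\<^esub>i\<in>S. cl (w i) (r i))"
  shows "t \<ominus> (\<Oplus>i\<in>{i\<in>S. w i = \<alpha>}. r i) \<in> Fp \<alpha>"
proof -
  let ?f = "\<lambda>i. single (w i) (r i)"
  have f: "?f \<in> S \<rightarrow> carrier Rees" using assms single_closed by auto
  have fin: "finsum Rees ?f S \<in> carrier Rees" using f by (rule Rs.finsum_closed)
  have ev: "finsum Rees ?f S \<alpha> = (\<Oplus>i\<in>{i\<in>S. w i = \<alpha>}. r i)"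
    unfolding Rees_finsum_eval[OF assms(1) f]
    by (rule add.finprod_mono_neutral_cong_right)
      (use assms(1) F_carr[OF assms(2,3)] in \<open>auto simp: single_def\<close>)
  have "proj (single \<alpha> t) = proj (finsum Rees ?f S)"
    using eq unfolding cl_eq using proj_finsum[OF assms(1) f] by simp
  moreover have "proj (single \<alpha> t \<ominus>\<^bsub>Rees\<^esub> finsum Rees ?f S) = proj (single \<alpha> t) \<ominus>\<^bsub>G\<^esub> proj (finsum Rees ?f S)"
    unfolding a_minus_def using fin single_closed[OF \<alpha>] by (simp del: Rees_add)
  ultimately have "proj (single \<alpha> t \<ominus>\<^bsub>Rees\<^esub> finsum Rees ?f S) = \<zero>\<^bsub>G\<^esub>"
    using fin by (simp add: a_minus_def pr.S.r_neg)
  then have "single \<alpha> t \<ominus>\<^bsub>Rees\<^esub> finsum Rees ?f S \<in> Low"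
    using fin single_closed[OF \<alpha>] by (subst (asm) proj_zero_iff) auto
  then have "(single \<alpha> t \<ominus>\<^bsub>Rees\<^esub> finsum Rees ?f S) \<alpha> \<in> Fp \<alpha>"
    using \<alpha> Low_iff by blast
  moreover have "(single \<alpha> t \<ominus>\<^bsub>Rees\<^esub> finsum Rees ?f S) \<alpha> = t \<ominus> (\<Oplus>i\<in>{i\<in>S. w i = \<alpha>}. r i)"
    unfolding a_minus_def using fin by (simp add: Rees_uminus ev[symmetric] single_def)
  ultimately show ?thesis by simp
qed

text \<open>Lift to the Rees ring and split a finitely supported function into its values at single
  degrees.\<close>

lemma cl_span:
  assumes "g \<in> carrier G"
  shows "\<exists>S r. finite S \<and> S \<subseteq> Nvec n \<and> (\<forall>\<alpha>\<in>S. r \<alpha> \<in> F \<alpha>) \<and> g = (\<Oplus>\<^bsub>G\<^esub>\<alpha>\<in>S. cl \<alpha> (r \<alpha>))"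
proof -
  obtain f where f: "f \<in> carrier Rees" "g = proj f" using proj_surj assms by blast
  let ?S = "{\<alpha>. f \<alpha> \<noteq> \<zero>}"
  have S: "finite ?S" "?S \<subseteq> Nvec n" using f by (auto simp: Rees_carrier_iff)
  have c: "(\<lambda>\<alpha>. single \<alpha> (f \<alpha>)) \<in> ?S \<rightarrow> carrier Rees"
    using S(2) f(1) single_closed Rees_compF by blast
  have "f = finsum Rees (\<lambda>\<alpha>. single \<alpha> (f \<alpha>)) ?S"
  proof
    fix \<beta>
    have "finsum Rees (\<lambda>\<alpha>. single \<alpha> (f \<alpha>)) ?S \<beta> = (\<Oplus>\<alpha>\<in>?S. single \<alpha> (f \<alpha>) \<beta>)"
      by (rule Rees_finsum_eval[OF S(1) c])
    also have "\<dots> = (\<Oplus>\<alpha>\<in>?S \<inter> {\<beta>}. f \<alpha>)"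
      by (rule add.finprod_mono_neutral_cong_right)
        (use S Rees_comp[OF f(1)] in \<open>auto simp: single_def\<close>)
    also have "\<dots> = f \<beta>"
      using Rees_comp[OF f(1), of \<beta>] by (cases "f \<beta> = \<zero>") (auto simp: Int_insert_right)
    finally show "f \<beta> = finsum Rees (\<lambda>\<alpha>. single \<alpha> (f \<alpha>)) ?S \<beta>" ..
  qed
  then have "g = (\<Oplus>\<^bsub>G\<^esub>\<alpha>\<in>?S. cl \<alpha> (f \<alpha>))"
    unfolding cl_eq f(2) using proj_finsum[OF S(1) c] by simp
  then show ?thesis using S f(1) Rees_compF by blast
qed

end

section \<open>Monomial bases of iterated Ore extensions\<close>

context monomials
begin

lemma mon_family: "subring A R \<Longrightarrow> left_family R A I mon"
  by (intro left_family.intro left_family_axioms.intro ring_axioms) auto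

lemma mon_in_subring:
  assumes B: "subring B R" and j: "j \<le> s" "\<And>i. i \<in> {1..j} \<Longrightarrow> x i \<in> B" and \<alpha>: "\<alpha> \<in> Nvec j"
  shows "mon \<alpha> \<in> B"
proof -
  have pow: "a [^] k \<in> B" if "a \<in> B" for a and k :: nat
    using that subringE[OF B] by (induction k) auto
  have "std_monom R x i \<alpha> \<in> B" if "i \<le> j" for i
    using that
  proof (induction i)
    case (Suc i)
    then show ?case
      using subringE(6)[OF B] j pow x_closed by (subst std_monom_Suc) auto
  qed (use subringE[OF B] in simp)
  moreover have "mon \<alpha> = std_monom R x j \<alpha>"
    by (rule std_monom_trunc) (use j \<alpha> in \<open>auto simp: Nvec_iff\<close>)
  ultimately show ?thesis by simp
qed

lemma Nvec_update_image:
  assumes "j \<in> {1..s}"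
  shows "(\<lambda>(\<alpha>, k). \<alpha>(j := k)) ` (Nvec (j - 1) \<times> UNIV) = Nvec j"
    and "inj_on (\<lambda>(\<alpha>, k). \<alpha>(j := k)) (Nvec (j - 1) \<times> (UNIV :: nat set))"
proof -
  show "(\<lambda>(\<alpha>, k). \<alpha>(j := k)) ` (Nvec (j - 1) \<times> UNIV) = Nvec j"
  proof
    show "Nvec j \<subseteq> (\<lambda>(\<alpha>, k). \<alpha>(j := k)) ` (Nvec (j - 1) \<times> UNIV)"
    proof
      fix \<beta> assume "\<beta> \<in> Nvec j"
      then have "\<beta>(j := 0) \<in> Nvec (j - 1)" using assms unfolding Nvec_iff by auto
      then show "\<beta> \<in> (\<lambda>(\<alpha>, k). \<alpha>(j := k)) ` (Nvec (j - 1) \<times> UNIV)"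
        by (intro image_eqI[of _ _ "(\<beta>(j := 0), \<beta> j)"]) auto
    qed
  qed (use assms in \<open>auto simp: Nvec_iff\<close>)
  show "inj_on (\<lambda>(\<alpha>, k). \<alpha>(j := k)) (Nvec (j - 1) \<times> (UNIV :: nat set))"
  proof (rule inj_onI, clarify)
    fix \<alpha> \<alpha>' :: "nat \<Rightarrow> nat" and k k' :: nat
    assume \<alpha>: "\<alpha> \<in> Nvec (j - 1)" "\<alpha>' \<in> Nvec (j - 1)" and eq: "\<alpha>(j := k) = \<alpha>'(j := k')"
    have "\<alpha> j = 0" "\<alpha>' j = 0" using \<alpha> assms by (auto simp: Nvec_iff)
    then have "\<alpha> = \<alpha>'" using eq by (metis fun_upd_triv fun_upd_upd)
    moreover have "k = k'" using eq by (metis fun_upd_same)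
    ultimately show "\<alpha> = \<alpha>' \<and> k = k'" by simp
  qed
qed

text \<open>An exponent on \<open>j\<close> variables is the pair of its restriction to
  \<open>j - 1\<close> variables and its last entry, which is the index set that
  \<open>tower\<close> works with.\<close>

lemma mon_split:
  assumes A: "subring A R" and j: "j \<in> {1..s}"
  shows "lspan R A (Nvec j) mon = lspan R A (Nvec (j - 1) \<times> (UNIV :: nat set)) (\<lambda>(\<alpha>, k). mon \<alpha> \<otimes> x j [^] k)"
    and "lindep R A (Nvec j) mon \<longleftrightarrow> lindep R A (Nvec (j - 1) \<times> (UNIV :: nat set)) (\<lambda>(\<alpha>, k). mon \<alpha> \<otimes> x j [^] k)"
proof -
  define f :: "(nat \<Rightarrow> nat) \<times> nat \<Rightarrow> nat \<Rightarrow> nat" where "f = (\<lambda>(\<alpha>, k). \<alpha>(j := k))"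
  let ?I = "Nvec (j - 1) \<times> (UNIV :: nat set)"
  have f: "f ` ?I = Nvec j" "inj_on f ?I" unfolding f_def using Nvec_update_image[OF j] by auto
  have fam: "left_family R A (f ` ?I) mon" using mon_family[OF A] .
  interpret fam': left_family R A ?I "mon \<circ> f"
    by (intro left_family.intro left_family_axioms.intro ring_axioms A) auto
  have eq: "(mon \<circ> f) p = (case p of (\<alpha>, k) \<Rightarrow> mon \<alpha> \<otimes> x j [^] k)" if "p \<in> ?I" for p
    using that mon_snoc[OF j] by (auto simp: f_def)
  show "lspan R A (Nvec j) mon = lspan R A ?I (\<lambda>(\<alpha>, k). mon \<alpha> \<otimes> x j [^] k)"
    using lspan_reindex[OF fam f(2)] fam'.lspan_cong[OF eq] unfolding f(1) by simp
  show "lindep R A (Nvec j) mon \<longleftrightarrow> lindep R A ?I (\<lambda>(\<alpha>, k). mon \<alpha> \<otimes> x j [^] k)"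
    using lindep_reindex[OF fam f(2)] fam'.lindep_cong[OF eq] unfolding f(1) by simp
qed

lemma Nvec_0: "Nvec 0 = {vzero}"
  by (auto simp: Nvec_iff vzero_def)

lemma lspan_Nvec_0:
  assumes A: "subring A R"
  shows "lspan R A (Nvec 0) mon = A"
proof -
  interpret left_family R A "Nvec 0" mon using mon_family[OF A] .
  show ?thesis
  proof
    show "lspan R A (Nvec 0) mon \<subseteq> A"
      by (rule lspan_minimal)
        (use A A_carr subring.axioms(1) in \<open>auto simp: Nvec_0 intro: additive_subgroup.intro\<close>)
    show "A \<subseteq> lspan R A (Nvec 0) mon"
      using lspan_base_smult[of vzero] A_carr by (auto simp: Nvec_0)
  qed
qed

lemma lindep_Nvec_0:
  assumes A: "subring A R"
  shows "lindep R A (Nvec 0) mon"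
  unfolding lindep_def Nvec_0
proof (intro allI impI ballI)
  fix J c i assume J: "finite J" "J \<subseteq> {vzero}" "c \<in> J \<rightarrow> A" "(\<Oplus>i\<in>J. c i \<otimes> mon i) = \<zero>" "i \<in> J"
  then have "J = {vzero}" "i = vzero" by auto
  moreover have "c vzero \<in> carrier R" using J calculation subringE(1)[OF A] by auto
  ultimately show "c i = \<zero>" using J(4) by simp
qed

lemma ore_stage_facts:
  assumes "subring A R" "j \<le> s"
  shows "subring (ore_stage R A x j) R" "A \<subseteq> ore_stage R A x j"
    "\<And>i. i \<in> {1..j} \<Longrightarrow> x i \<in> ore_stage R A x j"
proof -
  have "A \<union> x ` {1..j} \<subseteq> carrier R" using subringE(1)[OF assms(1)] x_closed assms(2) by auto
  then show "subring (ore_stage R A x j) R" unfolding ore_stage_def by (rule generate_ring_is_subring)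
qed (auto simp: ore_stage_def intro: generate_ring.incl)

text \<open>In each step the powers of the new variable form a basis over the previous stage, and
  the previous monomials form one over \<open>A\<close>. Transitivity of bases multiplies the
  two.\<close>

lemma iterated_ore_monomial_basis:
  assumes A: "subring A R"
    and ore: "\<And>j. j \<in> {1..s} \<Longrightarrow> \<exists>\<sigma>. ore_step R (ore_stage R A x (j - 1)) (x j) \<sigma> (ore_stage R A x j)"
    and "j \<le> s"
  shows "ore_stage R A x j \<subseteq> lspan R A (Nvec j) mon \<and> lindep R A (Nvec j) mon"
  using assms(3)
proof (induction j)
  case 0
  have "ore_stage R A x 0 \<subseteq> A"
    unfolding ore_stage_def using generate_ring_min_subring1[OF _ A] subringE(1)[OF A] by simp
  then show ?case using lspan_Nvec_0[OF A] lindep_Nvec_0[OF A] by simp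
next
  case (Suc j)
  let ?B = "ore_stage R A x j"
  have j: "Suc j \<in> {1..s}" using Suc.prems by simp
  have IH: "?B \<subseteq> lspan R A (Nvec j) mon" "lindep R A (Nvec j) mon" using Suc by auto
  note st = ore_stage_facts[OF A, of j] ore_stage_facts[OF A, of "Suc j"]
  interpret tower R A ?B "Nvec j" "UNIV :: nat set" mon "\<lambda>k. x (Suc j) [^] k"
  proof (intro tower.intro tower_axioms.intro ring_axioms A IH(1))
    show "subring ?B R" "A \<subseteq> ?B" using st Suc.prems by auto
    show "mon \<in> Nvec j \<rightarrow> ?B"
      using mon_in_subring[of ?B j] st Suc.prems by auto
    show "(\<lambda>k. x (Suc j) [^] k) \<in> (UNIV :: nat set) \<rightarrow> carrier R" using x_closed[OF j] by auto
  qed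
  have "left_basis R ?B UNIV (\<lambda>k. x (Suc j) [^] (k :: nat)) (ore_stage R A x (Suc j))"
    using ore[OF j] unfolding ore_step_def by auto
  then have "ore_stage R A x (Suc j) \<subseteq> lspan R ?B UNIV (\<lambda>k. x (Suc j) [^] (k :: nat))"
    "lindep R ?B UNIV (\<lambda>k. x (Suc j) [^] (k :: nat))"
    using dB.left_basis_iff[of "ore_stage R A x (Suc j)"] subringE(2)[OF st(4)] Suc.prems by auto
  then show ?case
    using mon_split[OF A j] lspan_eq lindep_up[OF IH(2)] by simp
qed

end

section \<open>Lifting the variables to the filtered ring\<close>

text \<open>Serves both directions: with representatives \<open>x i\<close> chosen for given
  homogeneous \<open>y i\<close>, and with given \<open>x i\<close> whose classes in the weight
  filtration are the \<open>y i\<close>.\<close>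

locale filtered_elements = filtered_ring R n ordr F
  for R (structure) and n ordr F +
  fixes s :: nat and x :: "nat \<Rightarrow> 'a" and \<delta> :: "nat \<Rightarrow> nat \<Rightarrow> nat" and y :: "nat \<Rightarrow> ((nat \<Rightarrow> nat) \<Rightarrow> 'a) set"
  assumes \<delta>_Nvec: "i \<in> {1..s} \<Longrightarrow> \<delta> i \<in> Nvec n"
    and x_F: "i \<in> {1..s} \<Longrightarrow> x i \<in> F (\<delta> i)"
    and y_cl: "i \<in> {1..s} \<Longrightarrow> y i = gclass R n ordr F (\<delta> i) (x i)"
begin

abbreviation "L \<equiv> F vzero"

definition wt :: "(nat \<Rightarrow> nat) \<Rightarrow> nat \<Rightarrow> nat" where
  "wt \<alpha> = (\<lambda>j. \<Sum>i\<in>{1..s}. \<alpha> i * \<delta> i j)"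

lemma wt_Nvec [simp]: "wt \<alpha> \<in> Nvec n"
  unfolding wt_def using \<delta>_Nvec unfolding Nvec_iff by auto

lemma wt_vadd: "wt (vadd \<alpha> \<beta>) = vadd (wt \<alpha>) (wt \<beta>)"
  by (auto simp: wt_def vadd_def algebra_simps sum.distrib)

lemma wt_vzero [simp]: "wt vzero = vzero"
  by (auto simp: wt_def vzero_def)

lemma wt_unitvec: "k \<in> {1..s} \<Longrightarrow> wt (unitvec k) = \<delta> k"
proof
  fix j assume "k \<in> {1..s}"
  moreover have "wt (unitvec k) j = (\<Sum>i\<in>{1..s}. if i = k then \<delta> k j else 0)"
    unfolding wt_def by (rule sum.cong) (auto simp: unitvec_def)
  ultimately show "wt (unitvec k) j = \<delta> k j" by simp
qed

lemma L_subring: "subring L R"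
  using F_carr[of vzero] F_one F_mult[of vzero vzero] additive_subgroup.a_closed[OF F_add[of vzero]]
    additive_subgroup_uminus[OF ring_axioms F_add[of vzero]]
  by (intro subringI) auto

sublocale X: monomials R x s
  using x_F F_carr \<delta>_Nvec by (intro monomials.intro monomials_axioms.intro ring_axioms) auto

sublocale Y: monomials G y s
  using x_F cl_closed \<delta>_Nvec y_cl by (intro monomials.intro monomials_axioms.intro G_ring) auto

lemma power_cl:
  assumes "\<beta> \<in> Nvec n" "a \<in> F \<beta>"
  shows "a [^] k \<in> F (\<lambda>j. k * \<beta> j) \<and> cl \<beta> a [^]\<^bsub>G\<^esub> k = cl (\<lambda>j. k * \<beta> j) (a [^] k)"
proof (induction k)
  case 0
  have "(\<lambda>j. 0 * \<beta> j) = vzero" by (auto simp: vzero_def)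
  then show ?case using F_one cl_one by simp
next
  case (Suc k)
  have k: "(\<lambda>j. k * \<beta> j) \<in> Nvec n" using assms(1) by (auto simp: Nvec_iff)
  have "vadd (\<lambda>j. k * \<beta> j) \<beta> = (\<lambda>j. Suc k * \<beta> j)" by (auto simp: vadd_def)
  then show ?case
    using F_mult[OF k assms(1), of "a [^] k" a] cl_mult[OF k assms(1), of "a [^] k" a] Suc assms
    by simp
qed

text \<open>The product rule for classes also holds when a product drops to a lower degree (both
  sides are then 0), so no regularity of the graded ring is required.\<close>

lemma mon_cl: "X.mon \<alpha> \<in> F (wt \<alpha>)" "Y.mon \<alpha> = cl (wt \<alpha>) (X.mon \<alpha>)"
proof -
  define w where "w j = (\<lambda>l. \<Sum>i\<in>{1..j}. \<alpha> i * \<delta> i l)" for j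
  have "w j \<in> Nvec n \<and> std_monom R x j \<alpha> \<in> F (w j) \<and> std_monom G y j \<alpha> = cl (w j) (std_monom R x j \<alpha>)"
    if "j \<le> s" for j
    using that
  proof (induction j)
    case 0
    have "w 0 = vzero" by (auto simp: w_def vzero_def)
    then show ?case using F_one cl_one by simp
  next
    case (Suc j)
    then have j: "Suc j \<in> {1..s}" by simp
    let ?b = "\<lambda>l. \<alpha> (Suc j) * \<delta> (Suc j) l"
    have b: "?b \<in> Nvec n" using \<delta>_Nvec[OF j] by (auto simp: Nvec_iff)
    have p: "x (Suc j) [^] \<alpha> (Suc j) \<in> F ?b"
      "y (Suc j) [^]\<^bsub>G\<^esub> \<alpha> (Suc j) = cl ?b (x (Suc j) [^] \<alpha> (Suc j))"
      using power_cl[OF \<delta>_Nvec[OF j] x_F[OF j]] y_cl[OF j] by auto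
    have w: "w (Suc j) = vadd (w j) ?b" by (auto simp: w_def vadd_def)
    have IH: "w j \<in> Nvec n" "std_monom R x j \<alpha> \<in> F (w j)"
      "std_monom G y j \<alpha> = cl (w j) (std_monom R x j \<alpha>)" using Suc by auto
    have "std_monom R x (Suc j) \<alpha> = std_monom R x j \<alpha> \<otimes> x (Suc j) [^] \<alpha> (Suc j)"
      by (rule std_monom_Suc) (use X.x_closed Suc.prems in auto)
    moreover have "std_monom G y (Suc j) \<alpha> = std_monom G y j \<alpha> \<otimes>\<^bsub>G\<^esub> y (Suc j) [^]\<^bsub>G\<^esub> \<alpha> (Suc j)"
      by (rule pr.S.std_monom_Suc) (use Y.x_closed Suc.prems in auto)
    ultimately show ?case
      unfolding w using cl_mult[OF IH(1) b IH(2) p(1)] F_mult[OF IH(1) b IH(2) p(1)] IH p b by simp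
  qed
  moreover have "w s = wt \<alpha>" by (simp add: w_def wt_def)
  ultimately show "X.mon \<alpha> \<in> F (wt \<alpha>)" "Y.mon \<alpha> = cl (wt \<alpha>) (X.mon \<alpha>)" by (metis order_refl)+
qed

lemma smult_mon_F: "c \<in> L \<Longrightarrow> c \<otimes> X.mon \<alpha> \<in> F (wt \<alpha>)"
  using F_mult[OF vzero_in_Nvec wt_Nvec _ mon_cl(1)] by simp

lemma smult_mon_cl: "c \<in> L \<Longrightarrow> cl vzero c \<otimes>\<^bsub>G\<^esub> Y.mon \<alpha> = cl (wt \<alpha>) (c \<otimes> X.mon \<alpha>)"
  using cl_mult[OF vzero_in_Nvec wt_Nvec _ mon_cl(1)] mon_cl(2) by simp

lemma cl_L_zero_iff: "c \<in> L \<Longrightarrow> cl vzero c = \<zero>\<^bsub>G\<^esub> \<longleftrightarrow> c = \<zero>"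
  using cl_zero_iff[of vzero c] Fp_vzero by simp

lemma LG_subring: "subring (cl vzero ` L) G"
proof (rule pr.S.subringI)
  note c = cl_closed[OF vzero_in_Nvec]
  show "cl vzero ` L \<subseteq> carrier G" using c by auto
  show "\<one>\<^bsub>G\<^esub> \<in> cl vzero ` L" using cl_one F_one by (metis imageI)
  show "\<ominus>\<^bsub>G\<^esub> h \<in> cl vzero ` L" if "h \<in> cl vzero ` L" for h
    using that cl_uminus[OF vzero_in_Nvec] subringE(5)[OF L_subring] by (fastforce intro!: image_eqI)
  show "h \<oplus>\<^bsub>G\<^esub> h' \<in> cl vzero ` L" if "h \<in> cl vzero ` L" "h' \<in> cl vzero ` L" for h h'
    using that cl_add[OF vzero_in_Nvec] subringE(7)[OF L_subring] by (fastforce intro!: image_eqI)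
  show "h \<otimes>\<^bsub>G\<^esub> h' \<in> cl vzero ` L" if "h \<in> cl vzero ` L" "h' \<in> cl vzero ` L" for h h'
    using that cl_mult[OF vzero_in_Nvec vzero_in_Nvec] subringE(6)[OF L_subring] by (fastforce intro!: image_eqI)
qed

sublocale XL: left_family R L "Nvec s" X.mon
  using X.mon_family[OF L_subring] .

sublocale YL: left_family G "cl vzero ` L" "Nvec s" Y.mon
  using Y.mon_family[OF LG_subring] .

lemma comb_cl:
  assumes "c \<in> J \<rightarrow> L"
  shows "(\<Oplus>\<^bsub>G\<^esub>i\<in>J. cl vzero (c i) \<otimes>\<^bsub>G\<^esub> Y.mon i) = (\<Oplus>\<^bsub>G\<^esub>i\<in>J. cl (wt i) (c i \<otimes> X.mon i))"
  by (rule pr.S.finsum_cong') (use assms in \<open>auto intro!: smult_mon_cl smult_mon_F cl_closed\<close>)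

lemma lspan_G_E:
  assumes "g \<in> lspan G (cl vzero ` L) I Y.mon"
  obtains J c where "finite J" "J \<subseteq> I" "c \<in> J \<rightarrow> L" "g = (\<Oplus>\<^bsub>G\<^esub>i\<in>J. cl (wt i) (c i \<otimes> X.mon i))"
proof -
  obtain J c' where J: "finite J" "J \<subseteq> I" "c' \<in> J \<rightarrow> cl vzero ` L" "g = (\<Oplus>\<^bsub>G\<^esub>i\<in>J. c' i \<otimes>\<^bsub>G\<^esub> Y.mon i)"
    using assms by (rule lspanE)
  have "\<forall>i\<in>J. \<exists>a\<in>L. c' i = cl vzero a" using J(3) by blast
  then obtain c where c: "\<And>i. i \<in> J \<Longrightarrow> c i \<in> L \<and> c' i = cl vzero (c i)" by metis
  have "g = (\<Oplus>\<^bsub>G\<^esub>i\<in>J. cl vzero (c i) \<otimes>\<^bsub>G\<^esub> Y.mon i)"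
    unfolding J(4) by (rule pr.S.finsum_cong') (use c cl_closed[OF vzero_in_Nvec] in auto)
  then have "g = (\<Oplus>\<^bsub>G\<^esub>i\<in>J. cl (wt i) (c i \<otimes> X.mon i))" using comb_cl[of c J] c by auto
  then show thesis using that[of J c] J c by auto
qed

lemma leading_coeffs_zero:
  assumes ind: "lindep G (cl vzero ` L) (Nvec s) Y.mon"
    and J: "finite J" "J \<subseteq> Nvec s" "c \<in> J \<rightarrow> L"
    and sum: "\<And>\<alpha>. \<alpha> \<in> Nvec n \<Longrightarrow> (\<Oplus>i\<in>{i\<in>J. wt i = \<alpha>}. c i \<otimes> X.mon i) \<in> Fp \<alpha>"
    and "i \<in> J"
  shows "c i = \<zero>"
proof -
  have "(\<Oplus>\<^bsub>G\<^esub>i\<in>J. cl (wt i) (c i \<otimes> X.mon i)) = \<zero>\<^bsub>G\<^esub>"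
    by (rule finsum_cl_zero_iff[OF J(1), THEN iffD2]) (use sum J(3) in \<open>auto intro!: smult_mon_F\<close>)
  then have "(\<Oplus>\<^bsub>G\<^esub>i\<in>J. cl vzero (c i) \<otimes>\<^bsub>G\<^esub> Y.mon i) = \<zero>\<^bsub>G\<^esub>" using comb_cl[OF J(3)] by simp
  then have "cl vzero (c i) = \<zero>\<^bsub>G\<^esub>"
    by (rule lindepD[OF ind J(1,2), rotated]) (use J assms(6) in auto)
  then show ?thesis using cl_L_zero_iff J(3) assms(6) by auto
qed

text \<open>Otherwise let \<mu> be the largest degree in the support that is not below \<alpha>. The
  whole sum lies in \<open>Fp \<alpha>\<close>, hence in \<open>Fp \<mu>\<close>, and so do all
  terms of degree other than \<mu>. Thus the terms of degree \<mu> add up to an element of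
  \<open>Fp \<mu>\<close>, which is a relation in the graded ring and forces their coefficients to
  vanish.\<close>

lemma support_bound:
  assumes ind: "lindep G (cl vzero ` L) (Nvec s) Y.mon"
    and J: "finite J" "J \<subseteq> Nvec s" "c \<in> J \<rightarrow> L" and \<alpha>: "\<alpha> \<in> Nvec n"
    and r: "(\<Oplus>i\<in>J. c i \<otimes> X.mon i) \<in> Fp \<alpha>" and i: "i \<in> J" "c i \<noteq> \<zero>"
  shows "prec (wt i) \<alpha>"
proof (rule ccontr)
  assume np: "\<not> prec (wt i) \<alpha>"
  define B where "B = {i\<in>J. c i \<noteq> \<zero> \<and> \<not> prec (wt i) \<alpha>}"
  have "finite (wt ` B)" "wt ` B \<noteq> {}" "wt ` B \<subseteq> Nvec n" using J(1) i np unfolding B_def by auto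
  then obtain \<mu> where \<mu>: "\<mu> \<in> wt ` B" "\<forall>\<beta>\<in>wt ` B. ordr \<beta> \<mu>" using finite_has_maximal by blast
  then obtain b where b: "b \<in> B" "\<mu> = wt b" by blast
  have \<mu>N: "\<mu> \<in> Nvec n" using b by simp
  have \<alpha>\<mu>: "ordr \<alpha> \<mu>" using b not_prec[OF wt_Nvec \<alpha>] unfolding B_def by blast
  \<comment> \<open>The top part. Terms with zero coefficient are left out, since their degrees are
    not controlled by \<mu>.\<close>
  define T where "T = {i\<in>J. c i \<noteq> \<zero> \<and> wt i = \<mu>}"
  have T: "finite T" "T \<subseteq> J" "finite (J - T)" using J(1) unfolding T_def by auto
  have low: "c k \<otimes> X.mon k \<in> Fp \<mu>" if k: "k \<in> J - T" for k
  proof (cases "c k = \<zero>")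
    case True
    then show ?thesis by (simp add: Fp_iff)
  next
    case False
    then have ne: "wt k \<noteq> \<mu>" using k unfolding T_def by blast
    have "ordr (wt k) \<mu>"
    proof (cases "prec (wt k) \<alpha>")
      case True
      then show ?thesis using prec_ordr_trans[OF wt_Nvec \<alpha> \<mu>N _ \<alpha>\<mu>] unfolding prec_def by blast
    next
      case False
      then have "k \<in> B" using k \<open>c k \<noteq> \<zero>\<close> unfolding B_def by blast
      then show ?thesis using \<mu>(2) by blast
    qed
    then have "prec (wt k) \<mu>" using ne by (simp add: prec_def)
    moreover have "c k \<otimes> X.mon k \<in> F (wt k)" using smult_mon_F J(3) k by auto
    ultimately show ?thesis using Fp_iff wt_Nvec by blast
  qed
  have cl: "(\<lambda>i. c i \<otimes> X.mon i) \<in> J \<rightarrow> carrier R" using XL.term_closed[OF J(2,3)] .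
  have "(\<Oplus>i\<in>J. c i \<otimes> X.mon i) = (\<Oplus>i\<in>T. c i \<otimes> X.mon i) \<oplus> (\<Oplus>i\<in>J - T. c i \<otimes> X.mon i)"
    using finsum_Un_disjoint[OF T(1,3), of "\<lambda>i. c i \<otimes> X.mon i"] cl T(2)
    by (simp add: Un_absorb1 Pi_iff subset_iff)
  moreover have "(\<Oplus>i\<in>T. c i \<otimes> X.mon i) \<in> carrier R" "(\<Oplus>i\<in>J - T. c i \<otimes> X.mon i) \<in> carrier R"
    using cl T by (auto intro!: finsum_closed)
  ultimately have "(\<Oplus>i\<in>T. c i \<otimes> X.mon i) = (\<Oplus>i\<in>J. c i \<otimes> X.mon i) \<ominus> (\<Oplus>i\<in>J - T. c i \<otimes> X.mon i)"
    by (simp add: a_minus_def a_assoc r_neg)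
  moreover have "(\<Oplus>i\<in>J - T. c i \<otimes> X.mon i) \<in> Fp \<mu>"
    by (rule additive_subgroup_finsum[OF Fp_add[OF \<mu>N] T(3) low])
  moreover have "Fp \<alpha> \<subseteq> Fp \<mu>"
    using prec_ordr_trans[OF _ \<alpha> \<mu>N _ \<alpha>\<mu>] unfolding Fp_iff subset_iff by blast
  ultimately have top: "(\<Oplus>i\<in>T. c i \<otimes> X.mon i) \<in> Fp \<mu>"
    using additive_subgroup_minus[OF Fp_add[OF \<mu>N]] r by auto
  have "c b = \<zero>"
  proof (rule leading_coeffs_zero[OF ind T(1), where c = c and i = b])
    show "T \<subseteq> Nvec s" "c \<in> T \<rightarrow> L" using J T by auto
    show "b \<in> T" using b unfolding B_def T_def by blast
    fix \<beta> assume "\<beta> \<in> Nvec n"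
    have "{i\<in>T. wt i = \<beta>} = (if \<beta> = \<mu> then T else {})" unfolding T_def by auto
    then show "(\<Oplus>i\<in>{i\<in>T. wt i = \<beta>}. c i \<otimes> X.mon i) \<in> Fp \<beta>" using top by (simp add: Fp_iff)
  qed
  then show False using b unfolding B_def by blast
qed

text \<open>The case of degree 0 of \<open>support_bound\<close>: a sum equal to 0 lies in
  \<open>Fp vzero\<close>, and no degree precedes 0.\<close>

lemma monomials_lindep:
  assumes ind: "lindep G (cl vzero ` L) (Nvec s) Y.mon"
  shows "lindep R L (Nvec s) X.mon"
  unfolding lindep_def
proof (intro allI impI ballI)
  fix J c i assume J: "finite J" "J \<subseteq> Nvec s" "c \<in> J \<rightarrow> L" "(\<Oplus>i\<in>J. c i \<otimes> X.mon i) = \<zero>" "i \<in> J"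
  show "c i = \<zero>"
  proof (rule ccontr)
    assume "c i \<noteq> \<zero>"
    then have "prec (wt i) vzero" using support_bound[OF ind J(1-3) vzero_in_Nvec] J by (simp add: Fp_iff)
    then show False using prec_not_ordr[OF wt_Nvec vzero_in_Nvec] ordr_vzero by simp
  qed
qed

text \<open>Expand the class of r in the graded ring and subtract the part of degree \<alpha>, read
  in \<open>R\<close>. The difference is 0 or lies in some \<open>F \<beta>\<close> with \<beta>
  below \<alpha>, to which well-founded induction applies.\<close>

lemma monomials_span:
  assumes span: "carrier G \<subseteq> lspan G (cl vzero ` L) (Nvec s) Y.mon" and "\<alpha> \<in> Nvec n"
  shows "F \<alpha> \<subseteq> lspan R L (Nvec s) X.mon"
  using assms(2)
proof (induction \<alpha> rule: wf_induct_rule[OF wf_prec])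
  case (1 \<alpha>)
  show ?case
  proof
    fix r assume r: "r \<in> F \<alpha>"
    have "cl \<alpha> r \<in> lspan G (cl vzero ` L) (Nvec s) Y.mon" using span cl_closed 1(2) r by blast
    then obtain J c where J: "finite J" "J \<subseteq> Nvec s" "c \<in> J \<rightarrow> L"
      "cl \<alpha> r = (\<Oplus>\<^bsub>G\<^esub>i\<in>J. cl (wt i) (c i \<otimes> X.mon i))" by (rule lspan_G_E)
    let ?S = "\<Oplus>i\<in>{i\<in>J. wt i = \<alpha>}. c i \<otimes> X.mon i"
    have S: "?S \<in> lspan R L (Nvec s) X.mon"
      by (rule lspanI) (use J in auto)
    have "r \<ominus> ?S \<in> Fp \<alpha>"
      by (rule cl_eq_finsum[OF J(1) _ _ 1(2) r J(4)]) (use J(3) in \<open>auto intro!: smult_mon_F\<close>)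
    then have "r \<ominus> ?S \<in> lspan R L (Nvec s) X.mon"
      using 1 additive_subgroup.zero_closed[OF XL.lspan_additive] unfolding Fp_iff by auto
    then have "(r \<ominus> ?S) \<oplus> ?S \<in> lspan R L (Nvec s) X.mon"
      using additive_subgroup.a_closed[OF XL.lspan_additive] S by blast
    moreover have "(r \<ominus> ?S) \<oplus> ?S = r"
      using F_carr[OF 1(2) r] XL.lspan_carr[OF S] by (simp add: a_minus_def a_assoc l_neg)
    ultimately show "r \<in> lspan R L (Nvec s) X.mon" by simp
  qed
qed

text \<open>The finitely many generators of \<open>F \<alpha>\<close> involve a finite set
  \<open>U\<close> of exponents, hence so does every element of \<open>F \<alpha>\<close>. For
  elements of \<open>Fp \<alpha>\<close>, \<open>support_bound\<close> removes the exponents whose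
  degree is not below \<alpha>. The result depends on \<alpha> alone.\<close>

lemma finite_support_below:
  assumes ind: "lindep G (cl vzero ` L) (Nvec s) Y.mon"
    and span: "carrier G \<subseteq> lspan G (cl vzero ` L) (Nvec s) Y.mon"
    and \<alpha>: "\<alpha> \<in> Nvec n" and fg: "fin_gen_left R L (F \<alpha>)"
  shows "\<exists>\<Gamma>. finite \<Gamma> \<and> \<Gamma> \<subseteq> Nvec s \<and> (\<forall>\<gamma>\<in>\<Gamma>. prec (wt \<gamma>) \<alpha>) \<and>
    (\<forall>r\<in>Fp \<alpha>. \<exists>c. (\<forall>\<gamma>. c \<gamma> \<in> L) \<and> r = (\<Oplus>\<gamma>\<in>\<Gamma>. c \<gamma> \<otimes> X.mon \<gamma>))"
proof -
  obtain S where S: "finite S" "S \<subseteq> F \<alpha>" "F \<alpha> = left_span R L S" using fg unfolding fin_gen_left_def by blast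
  have "\<exists>J. finite J \<and> J \<subseteq> Nvec s \<and> v \<in> lspan R L J X.mon" if v: "v \<in> S" for v
  proof -
    have "v \<in> lspan R L (Nvec s) X.mon" using monomials_span[OF span \<alpha>] S v by blast
    then obtain J c where J: "finite J" "J \<subseteq> Nvec s" "c \<in> J \<rightarrow> L" "v = (\<Oplus>i\<in>J. c i \<otimes> X.mon i)"
      by (rule lspanE)
    then show ?thesis using lspanI[of J J c L R X.mon] by blast
  qed
  then obtain J where J: "\<And>v. v \<in> S \<Longrightarrow> finite (J v) \<and> J v \<subseteq> Nvec s \<and> v \<in> lspan R L (J v) X.mon" by metis
  define U where "U = (\<Union>v\<in>S. J v)"
  have U: "finite U" "U \<subseteq> Nvec s" using S J unfolding U_def by auto
  interpret U: left_family R L U X.mon using X.mon_family[OF L_subring] .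
  have SU: "v \<in> lspan R L U X.mon" if "v \<in> S" for v
    using J[OF that] lspan_mono[of "J v" U R L X.mon] that unfolding U_def by blast
  have FU: "F \<alpha> \<subseteq> lspan R L U X.mon"
  proof
    fix r assume "r \<in> F \<alpha>"
    then obtain a where "a \<in> S \<rightarrow> L" "r = (\<Oplus>v\<in>S. a v \<otimes> v)" unfolding S(3) left_span_def by blast
    then show "r \<in> lspan R L U X.mon" using U.lspan_finsum[OF S(1)] U.lspan_smult SU by (simp add: Pi_iff)
  qed
  define \<Gamma> where "\<Gamma> = {\<gamma>\<in>U. prec (wt \<gamma>) \<alpha>}"
  have \<Gamma>: "finite \<Gamma>" "\<Gamma> \<subseteq> U" using U unfolding \<Gamma>_def by auto
  have "\<exists>c. (\<forall>\<gamma>. c \<gamma> \<in> L) \<and> r = (\<Oplus>\<gamma>\<in>\<Gamma>. c \<gamma> \<otimes> X.mon \<gamma>)" if r: "r \<in> Fp \<alpha>" for r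
  proof -
    have "r \<in> lspan R L U X.mon" using r Fp_subset[OF \<alpha>] FU by blast
    then obtain J c where Jc: "finite J" "J \<subseteq> U" "c \<in> J \<rightarrow> L" "r = (\<Oplus>i\<in>J. c i \<otimes> X.mon i)"
      by (rule lspanE)
    have JN: "J \<subseteq> Nvec s" using Jc U by blast
    have sup: "prec (wt i) \<alpha>" if "i \<in> J" "c i \<noteq> \<zero>" for i
      using support_bound[OF ind Jc(1) JN Jc(3) \<alpha>] r Jc(4) that by simp
    define T where "T = {i\<in>J. c i \<noteq> \<zero>}"
    have T: "T \<subseteq> \<Gamma>" "T \<subseteq> J" using sup Jc(2) unfolding T_def \<Gamma>_def by auto
    have "r = (\<Oplus>i\<in>T. c i \<otimes> X.mon i)"
      unfolding Jc(4) by (rule add.finprod_mono_neutral_cong_right)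
        (use Jc U.term_closed[OF Jc(2,3)] in \<open>auto simp: T_def\<close>)
    also have "\<dots> = (\<Oplus>i\<in>\<Gamma>. (if i \<in> T then c i else \<zero>) \<otimes> X.mon i)"
      by (rule U.extend_sum) (use \<Gamma> T Jc in auto)
    finally show ?thesis
      using T Jc(3) F_zero[OF vzero_in_Nvec] by (intro exI[of _ "\<lambda>i. if i \<in> T then c i else \<zero>"]) auto
  qed
  then show ?thesis using \<Gamma> U unfolding \<Gamma>_def by (intro exI[of _ "{\<gamma>\<in>U. prec (wt \<gamma>) \<alpha>}"]) auto
qed

end

text \<open>Condition (iii) for fixed data. \<Gamma>2 holds the supports of the remainders from
  swapping two variables, \<Gamma>1 those from moving a variable past a scalar.\<close>

locale pbw_relations =
  fixes R :: "('r,'b) ring_scheme" (structure) and \<Lambda> :: "'r set" and s :: nat and q :: "nat \<Rightarrow> nat \<Rightarrow> 'r"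
    and x :: "nat \<Rightarrow> 'r" and ordr' :: "(nat \<Rightarrow> nat) \<Rightarrow> (nat \<Rightarrow> nat) \<Rightarrow> bool"
    and \<Gamma>2 :: "nat \<Rightarrow> nat \<Rightarrow> (nat \<Rightarrow> nat) set" and \<Gamma>1 :: "nat \<Rightarrow> (nat \<Rightarrow> nat) set"
  assumes x: "\<forall>k\<in>{1..s}. x k \<in> carrier R"
    and adm: "admissible_order s ordr'"
    and \<Gamma>2: "\<forall>i j. 1 \<le> i \<and> i < j \<and> j \<le> s \<longrightarrow>
           finite (\<Gamma>2 j i) \<and> \<Gamma>2 j i \<subseteq> Nvec s \<and>
           (\<forall>\<gamma>\<in>\<Gamma>2 j i. ordr' \<gamma> (vadd (unitvec i) (unitvec j)) \<and> \<gamma> \<noteq> vadd (unitvec i) (unitvec j))"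
    and \<Gamma>1: "\<forall>k\<in>{1..s}. finite (\<Gamma>1 k) \<and> \<Gamma>1 k \<subseteq> Nvec s \<and>
           (\<forall>\<gamma>\<in>\<Gamma>1 k. ordr' \<gamma> (unitvec k) \<and> \<gamma> \<noteq> unitvec k)"
    and basis: "left_basis R \<Lambda> (Nvec s) (std_monom R x s) (carrier R)"
    and rel2: "\<forall>i j. 1 \<le> i \<and> i < j \<and> j \<le> s \<longrightarrow>
           (\<exists>c. (\<forall>\<alpha>. c \<alpha> \<in> \<Lambda>) \<and>
              x j \<otimes> x i = (q j i \<otimes> x i \<otimes> x j) \<oplus> (\<Oplus>\<alpha>\<in>\<Gamma>2 j i. c \<alpha> \<otimes> std_monom R x s \<alpha>))"
    and rel1: "\<forall>a\<in>\<Lambda>. \<forall>k\<in>{1..s}. \<exists>a'\<in>\<Lambda>. \<exists>c. (\<forall>\<alpha>. c \<alpha> \<in> \<Lambda>) \<and>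
              x k \<otimes> a = (a' \<otimes> x k) \<oplus> (\<Oplus>\<alpha>\<in>\<Gamma>1 k. c \<alpha> \<otimes> std_monom R x s \<alpha>)"

context filtered_elements
begin

lemma x_carr: "i \<in> {1..s} \<Longrightarrow> x i \<in> carrier R"
  by (rule X.x_closed)

text \<open>A generator of degree 0 lies in the base ring, where it is dependent on 1.\<close>
lemma degree_nonzero:
  assumes ind: "lindep R L (Nvec s) X.mon" and nt: "\<one> \<noteq> \<zero>" and i: "i \<in> {1..s}"
  shows "\<delta> i \<noteq> vzero"
proof
  assume "\<delta> i = vzero"
  then have xL: "x i \<in> L" using x_F[OF i] by simp
  have ne: "unitvec i \<noteq> vzero" by (metis unitvec_def vzero_def zero_neq_one)
  let ?c = "\<lambda>\<alpha>. if \<alpha> = vzero then \<ominus> x i else \<one>"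
  have "(\<Oplus>\<alpha>\<in>{unitvec i, vzero}. ?c \<alpha> \<otimes> X.mon \<alpha>) = \<one> \<otimes> X.mon (unitvec i) \<oplus> (\<ominus> x i) \<otimes> X.mon vzero"
    using ne x_carr[OF i] by (simp add: finsum_insert Pi_def)
  also have "\<dots> = \<zero>" using X.mon_unitvec[OF i] x_carr[OF i] by (simp add: r_neg)
  finally have "?c (unitvec i) = \<zero>"
    by (rule lindepD[OF ind, rotated 3]) (use i xL subringE(3,5)[OF L_subring] in auto)
  then show False using ne nt by simp
qed

text \<open>All entries are nonnegative, so nothing cancels in the sum of the degrees.\<close>

lemma wt_zero_imp:
  assumes "\<And>i. i \<in> {1..s} \<Longrightarrow> \<delta> i \<noteq> vzero" "\<alpha> \<in> Nvec s" "wt \<alpha> = vzero"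
  shows "\<alpha> = vzero"
proof (rule ccontr)
  assume "\<alpha> \<noteq> vzero"
  then obtain k where k: "\<alpha> k \<noteq> 0" by (auto simp: vzero_def)
  then have ks: "k \<in> {1..s}" using assms(2) by (metis Nvec_iff)
  then obtain j where j: "\<delta> k j \<noteq> 0" using assms(1) by (auto simp: vzero_def fun_eq_iff)
  have "\<alpha> k * \<delta> k j \<le> wt \<alpha> j" unfolding wt_def using ks by (intro member_le_sum) auto
  then show False using assms(3) k j by (simp add: vzero_def)
qed

lemma presentation:
  assumes fg: "\<And>\<alpha>. \<alpha> \<in> Nvec n \<Longrightarrow> fin_gen_left R L (F \<alpha>)"
    and union: "(\<Union>\<alpha>\<in>Nvec n. F \<alpha>) = carrier R"
    and q: "\<And>i j. 1 \<le> i \<Longrightarrow> i < j \<Longrightarrow> j \<le> s \<Longrightarrow> q j i \<in> L"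
    and stage: "carrier G = ore_stage G (cl vzero ` L) y s"
    and ore: "\<And>j. j \<in> {1..s} \<Longrightarrow> \<exists>\<sigma>. ore_step G (ore_stage G (cl vzero ` L) y (j - 1)) (y j) \<sigma> (ore_stage G (cl vzero ` L) y j) \<and>
          (\<forall>i\<in>{1..<j}. \<sigma> (y i) = cl vzero (q j i) \<otimes>\<^bsub>G\<^esub> y i)"
  shows "\<exists>x ordr' \<Gamma>2 \<Gamma>1. pbw_relations R L s q x ordr' \<Gamma>2 \<Gamma>1"
proof -
  let ?A = "cl vzero ` L"
  have basis: "ore_stage G ?A y j \<subseteq> lspan G ?A (Nvec j) Y.mon \<and> lindep G ?A (Nvec j) Y.mon" if "j \<le> s" for j
    by (rule Y.iterated_ore_monomial_basis[OF LG_subring _ that]) (use ore in blast)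
  have span: "carrier G \<subseteq> lspan G ?A (Nvec s) Y.mon" and ind: "lindep G ?A (Nvec s) Y.mon"
    using basis[of s] stage by auto
  have spanR: "carrier R \<subseteq> lspan R L (Nvec s) X.mon"
    using monomials_span[OF span] union by blast
  have indR: "lindep R L (Nvec s) X.mon" by (rule monomials_lindep[OF ind])
  \<comment> \<open>One support for each degree, chosen once for all: a swap of \<open>x j\<close>
    and \<open>x i\<close> uses the degree \<delta>(i) + \<delta>(j), a scalar relation for
    \<open>x k\<close> the degree \<delta>(k).\<close>
  have "\<forall>\<alpha>\<in>Nvec n. \<exists>\<Gamma>. finite \<Gamma> \<and> \<Gamma> \<subseteq> Nvec s \<and> (\<forall>\<gamma>\<in>\<Gamma>. prec (wt \<gamma>) \<alpha>) \<and>
    (\<forall>r\<in>Fp \<alpha>. \<exists>c. (\<forall>\<gamma>. c \<gamma> \<in> L) \<and> r = (\<Oplus>\<gamma>\<in>\<Gamma>. c \<gamma> \<otimes> X.mon \<gamma>))"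
    using finite_support_below[OF ind span] fg by blast
  from bchoice[OF this] obtain \<Gamma> where \<Gamma>0: "\<forall>\<alpha>\<in>Nvec n. finite (\<Gamma> \<alpha>) \<and> \<Gamma> \<alpha> \<subseteq> Nvec s \<and>
    (\<forall>\<gamma>\<in>\<Gamma> \<alpha>. prec (wt \<gamma>) \<alpha>) \<and>
    (\<forall>r\<in>Fp \<alpha>. \<exists>c. (\<forall>\<gamma>. c \<gamma> \<in> L) \<and> r = (\<Oplus>\<gamma>\<in>\<Gamma> \<alpha>. c \<gamma> \<otimes> X.mon \<gamma>))" ..
  have \<Gamma>: "\<And>\<alpha>. \<alpha> \<in> Nvec n \<Longrightarrow> finite (\<Gamma> \<alpha>) \<and> \<Gamma> \<alpha> \<subseteq> Nvec s \<and> (\<forall>\<gamma>\<in>\<Gamma> \<alpha>. prec (wt \<gamma>) \<alpha>)"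
    and \<Gamma>c: "\<And>\<alpha> r. \<alpha> \<in> Nvec n \<Longrightarrow> r \<in> Fp \<alpha> \<Longrightarrow> \<exists>c. (\<forall>\<gamma>. c \<gamma> \<in> L) \<and> r = (\<Oplus>\<gamma>\<in>\<Gamma> \<alpha>. c \<gamma> \<otimes> X.mon \<gamma>)"
    using \<Gamma>0 by blast+
  define ordr' where "ordr' = (\<lambda>\<alpha> \<beta>. prec (wt \<alpha>) (wt \<beta>) \<or> wt \<alpha> = wt \<beta> \<and> lex_le \<alpha> \<beta>)"
  have adm': "admissible_order s ordr'"
    unfolding ordr'_def by (rule admissible_order_pullback) (auto simp: wt_vadd)
  have below: "ordr' \<gamma> \<epsilon> \<and> \<gamma> \<noteq> \<epsilon>" if "\<gamma> \<in> \<Gamma> (wt \<epsilon>)" for \<gamma> \<epsilon>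
    using \<Gamma>[OF wt_Nvec[of \<epsilon>]] that unfolding ordr'_def prec_def by auto
  have wt2: "wt (vadd (unitvec i) (unitvec j)) = vadd (\<delta> i) (\<delta> j)" if "1 \<le> i" "i < j" "j \<le> s" for i j
    using that by (simp add: wt_vadd wt_unitvec)
  have LR: "c \<in> L \<Longrightarrow> c \<in> carrier R" for c using F_carr[OF vzero_in_Nvec] .
  have rel2: "\<exists>c. (\<forall>\<alpha>. c \<alpha> \<in> L) \<and> x j \<otimes> x i = (q j i \<otimes> x i \<otimes> x j) \<oplus>
      (\<Oplus>\<alpha>\<in>\<Gamma> (vadd (\<delta> i) (\<delta> j)). c \<alpha> \<otimes> X.mon \<alpha>)" if ij: "1 \<le> i" "i < j" "j \<le> s" for i j
  proof -
    have i: "i \<in> {1..s}" and j: "j \<in> {1..s}" using ij by auto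
    note d = \<delta>_Nvec[OF i] \<delta>_Nvec[OF j] and xF = x_F[OF i] x_F[OF j] and qL = q[OF ij]
    obtain \<sigma> where \<sigma>: "ore_step G (ore_stage G ?A y (j - 1)) (y j) \<sigma> (ore_stage G ?A y j)"
      "\<sigma> (y i) = cl vzero (q j i) \<otimes>\<^bsub>G\<^esub> y i" using ore[OF j] ij by auto
    have "y i \<in> ore_stage G ?A y (j - 1)"
      using Y.ore_stage_facts(3)[OF LG_subring, of "j - 1" i] ij by simp
    then have "y j \<otimes>\<^bsub>G\<^esub> y i = cl vzero (q j i) \<otimes>\<^bsub>G\<^esub> y i \<otimes>\<^bsub>G\<^esub> y j"
      using \<sigma> unfolding ore_step_def by metis
    moreover have "y j \<otimes>\<^bsub>G\<^esub> y i = cl (vadd (\<delta> i) (\<delta> j)) (x j \<otimes> x i)"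
      using cl_mult[OF d(2,1) xF(2,1)] y_cl[OF i] y_cl[OF j] by (simp add: vadd_comm)
    moreover have qx: "q j i \<otimes> x i \<in> F (\<delta> i)" using F_mult[OF vzero_in_Nvec d(1) qL xF(1)] by simp
    have "cl vzero (q j i) \<otimes>\<^bsub>G\<^esub> y i \<otimes>\<^bsub>G\<^esub> y j = cl (vadd (\<delta> i) (\<delta> j)) (q j i \<otimes> x i \<otimes> x j)"
      using cl_mult[OF vzero_in_Nvec d(1) qL xF(1)] cl_mult[OF d qx xF(2)] y_cl[OF i] y_cl[OF j] by simp
    ultimately have "cl (vadd (\<delta> i) (\<delta> j)) (x j \<otimes> x i) = cl (vadd (\<delta> i) (\<delta> j)) (q j i \<otimes> x i \<otimes> x j)" by simp
    moreover have "x j \<otimes> x i \<in> F (vadd (\<delta> i) (\<delta> j))" using F_mult[OF d(2,1) xF(2,1)] by (simp add: vadd_comm)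
    moreover have "q j i \<otimes> x i \<otimes> x j \<in> F (vadd (\<delta> i) (\<delta> j))" using F_mult[OF d qx xF(2)] .
    ultimately have "x j \<otimes> x i \<ominus> q j i \<otimes> x i \<otimes> x j \<in> Fp (vadd (\<delta> i) (\<delta> j))"
      using cl_eq_iff[OF vadd_in_Nvec[OF d]] by blast
    then obtain c where c: "\<forall>\<gamma>. c \<gamma> \<in> L"
      "x j \<otimes> x i \<ominus> q j i \<otimes> x i \<otimes> x j = (\<Oplus>\<gamma>\<in>\<Gamma> (vadd (\<delta> i) (\<delta> j)). c \<gamma> \<otimes> X.mon \<gamma>)"
      using \<Gamma>c[OF vadd_in_Nvec[OF d]] by blast
    have "x j \<otimes> x i = (q j i \<otimes> x i \<otimes> x j) \<oplus> (x j \<otimes> x i \<ominus> q j i \<otimes> x i \<otimes> x j)"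
      using x_carr[OF i] x_carr[OF j] LR[OF qL] by (simp add: add_minus_cancel)
    then show ?thesis using c by auto
  qed
  have rel1: "\<exists>a'\<in>L. \<exists>c. (\<forall>\<alpha>. c \<alpha> \<in> L) \<and> x k \<otimes> a = (a' \<otimes> x k) \<oplus>
      (\<Oplus>\<alpha>\<in>\<Gamma> (\<delta> k). c \<alpha> \<otimes> X.mon \<alpha>)" if a: "a \<in> L" and k: "k \<in> {1..s}" for a k
  proof -
    note d = \<delta>_Nvec[OF k] and xF = x_F[OF k]
    have "\<exists>a'\<in>L. x k \<otimes> a \<ominus> a' \<otimes> x k \<in> Fp (\<delta> k)"
    \<comment> \<open>In the zero ring a variable may have degree 0, but there
      \<open>a' = \<zero>\<close> works.\<close>
    proof (cases "\<one> = \<zero>")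
      case True
      then have triv: "z = \<zero>" if "z \<in> carrier R" for z using that by (metis l_null l_one)
      have "x k \<otimes> a \<ominus> \<zero> \<otimes> x k = \<zero>" by (rule triv) (use x_carr[OF k] LR[OF a] in simp)
      then show ?thesis using F_zero[OF vzero_in_Nvec] by (metis Fp_iff)
    next
      case False
      then have \<delta>nz: "\<And>i. i \<in> {1..s} \<Longrightarrow> \<delta> i \<noteq> vzero" using degree_nonzero[OF indR] by blast
      obtain \<sigma> where \<sigma>: "ore_step G (ore_stage G ?A y (k - 1)) (y k) \<sigma> (ore_stage G ?A y k)"
        using ore[OF k] by blast
      have k1: "k - 1 \<le> s" using k by auto
      have "cl vzero a \<in> ore_stage G ?A y (k - 1)"
        using Y.ore_stage_facts(2)[OF LG_subring k1] a by blast
      then have eq: "y k \<otimes>\<^bsub>G\<^esub> cl vzero a = \<sigma> (cl vzero a) \<otimes>\<^bsub>G\<^esub> y k"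
        and mem: "\<sigma> (cl vzero a) \<in> ore_stage G ?A y (k - 1)"
        using \<sigma> unfolding ore_step_def ring_hom_def by auto
      \<comment> \<open>The value of \<sigma> lies in the previous stage, not visibly in the copy of
        \<Lambda>, so it is expanded in the earlier monomials.\<close>
      have "\<sigma> (cl vzero a) \<in> lspan G ?A (Nvec (k - 1)) Y.mon" using mem basis[OF k1] by blast
      then obtain J c where J: "finite J" "J \<subseteq> Nvec (k - 1)" "c \<in> J \<rightarrow> L"
        "\<sigma> (cl vzero a) = (\<Oplus>\<^bsub>G\<^esub>i\<in>J. cl (wt i) (c i \<otimes> X.mon i))" by (rule lspan_G_E)
      have cF: "c i \<otimes> X.mon i \<in> F (wt i)" if "i \<in> J" for i using smult_mon_F J(3) that by auto
      have "\<sigma> (cl vzero a) \<otimes>\<^bsub>G\<^esub> y k = (\<Oplus>\<^bsub>G\<^esub>i\<in>J. cl (wt i) (c i \<otimes> X.mon i) \<otimes>\<^bsub>G\<^esub> y k)"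
        unfolding J(4) by (rule pr.S.finsum_ldistr[OF J(1) Y.x_closed[OF k]]) (use cl_closed cF in auto)
      also have "\<dots> = (\<Oplus>\<^bsub>G\<^esub>i\<in>J. cl (vadd (wt i) (\<delta> k)) (c i \<otimes> X.mon i \<otimes> x k))"
        by (rule pr.S.finsum_cong'[OF refl])
          (use cF d xF y_cl[OF k] cl_mult[OF wt_Nvec d cF xF] in \<open>auto intro!: cl_closed F_mult\<close>)
      also have "\<sigma> (cl vzero a) \<otimes>\<^bsub>G\<^esub> y k = cl (\<delta> k) (x k \<otimes> a)"
        unfolding eq[symmetric] using cl_mult[OF d vzero_in_Nvec xF a] y_cl[OF k] by simp
      finally have cleq: "cl (\<delta> k) (x k \<otimes> a) = (\<Oplus>\<^bsub>G\<^esub>i\<in>J. cl (vadd (wt i) (\<delta> k)) (c i \<otimes> X.mon i \<otimes> x k))" .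
      have xaF: "x k \<otimes> a \<in> F (\<delta> k)" using F_mult[OF d vzero_in_Nvec xF a] by simp
      \<comment> \<open>The left side is homogeneous of degree \<delta>(k), so only monomials whose
        product with \<open>x k\<close> has this degree matter, that is, those of degree 0.\<close>
      have low: "x k \<otimes> a \<ominus> (\<Oplus>i\<in>{i\<in>J. vadd (wt i) (\<delta> k) = \<delta> k}. c i \<otimes> X.mon i \<otimes> x k) \<in> Fp (\<delta> k)"
        by (rule cl_eq_finsum[OF J(1) _ _ d xaF cleq]) (use cF d xF in \<open>auto intro!: F_mult\<close>)
      have "vadd (wt i) (\<delta> k) = \<delta> k \<longleftrightarrow> i = vzero" if "i \<in> J" for i
      proof -
        have "vadd (wt i) (\<delta> k) = \<delta> k \<longleftrightarrow> wt i = vzero"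
          using vadd_right_cancel[of "wt i" "\<delta> k" vzero] by simp
        moreover have "i \<in> Nvec s" using that J(2) Nvec_mono[OF k1] by blast
        ultimately show ?thesis using wt_zero_imp[OF \<delta>nz] by auto
      qed
      then have set: "{i\<in>J. vadd (wt i) (\<delta> k) = \<delta> k} = (if vzero \<in> J then {vzero} else {})" by auto
      \<comment> \<open>The required scalar is the constant coefficient of the expansion, or 0 if
        the constant monomial does not occur in it.\<close>
      have "\<exists>a'\<in>L. (\<Oplus>i\<in>{i\<in>J. vadd (wt i) (\<delta> k) = \<delta> k}. c i \<otimes> X.mon i \<otimes> x k) = a' \<otimes> x k"
      proof (cases "vzero \<in> J")
        case True
        then have "c vzero \<in> L" using J(3) by blast
        then show ?thesis unfolding set using True x_carr[OF k] LR by (intro bexI[of _ "c vzero"]) simp_all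
      next
        case False
        then show ?thesis unfolding set using x_carr[OF k] F_zero[OF vzero_in_Nvec]
          by (intro bexI[of _ \<zero>]) simp_all
      qed
      then show ?thesis using low by metis
    qed
    then obtain a' where a': "a' \<in> L" "x k \<otimes> a \<ominus> a' \<otimes> x k \<in> Fp (\<delta> k)" by blast
    then obtain c where c: "\<forall>\<gamma>. c \<gamma> \<in> L" "x k \<otimes> a \<ominus> a' \<otimes> x k = (\<Oplus>\<gamma>\<in>\<Gamma> (\<delta> k). c \<gamma> \<otimes> X.mon \<gamma>)"
      using \<Gamma>c[OF d] by blast
    have "x k \<otimes> a = (a' \<otimes> x k) \<oplus> (x k \<otimes> a \<ominus> a' \<otimes> x k)"
      using x_carr[OF k] LR[OF a] LR[OF a'(1)] by (simp add: add_minus_cancel)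
    then show ?thesis using a' c by auto
  qed
  show ?thesis
  proof (intro exI pbw_relations.intro)
    show "\<forall>k\<in>{1..s}. x k \<in> carrier R" using x_carr by blast
    show "admissible_order s ordr'" by (rule adm')
    show "\<forall>i j. 1 \<le> i \<and> i < j \<and> j \<le> s \<longrightarrow>
           finite (\<Gamma> (vadd (\<delta> i) (\<delta> j))) \<and> \<Gamma> (vadd (\<delta> i) (\<delta> j)) \<subseteq> Nvec s \<and>
           (\<forall>\<gamma>\<in>\<Gamma> (vadd (\<delta> i) (\<delta> j)). ordr' \<gamma> (vadd (unitvec i) (unitvec j)) \<and> \<gamma> \<noteq> vadd (unitvec i) (unitvec j))"
      using \<Gamma>[OF wt_Nvec] below wt2 by metis
    show "\<forall>k\<in>{1..s}. finite (\<Gamma> (\<delta> k)) \<and> \<Gamma> (\<delta> k) \<subseteq> Nvec s \<and>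
           (\<forall>\<gamma>\<in>\<Gamma> (\<delta> k). ordr' \<gamma> (unitvec k) \<and> \<gamma> \<noteq> unitvec k)"
      using \<Gamma>[OF wt_Nvec] below wt_unitvec by metis
    show "left_basis R L (Nvec s) X.mon (carrier R)"
      using XL.left_basis_iff[OF zero_closed] spanR indR by blast
    show "\<forall>i j. 1 \<le> i \<and> i < j \<and> j \<le> s \<longrightarrow> (\<exists>c. (\<forall>\<alpha>. c \<alpha> \<in> L) \<and>
              x j \<otimes> x i = (q j i \<otimes> x i \<otimes> x j) \<oplus> (\<Oplus>\<alpha>\<in>\<Gamma> (vadd (\<delta> i) (\<delta> j)). c \<alpha> \<otimes> X.mon \<alpha>))"
      using rel2 by blast
    show "\<forall>a\<in>L. \<forall>k\<in>{1..s}. \<exists>a'\<in>L. \<exists>c. (\<forall>\<alpha>. c \<alpha> \<in> L) \<and>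
              x k \<otimes> a = (a' \<otimes> x k) \<oplus> (\<Oplus>\<alpha>\<in>\<Gamma> (\<delta> k). c \<alpha> \<otimes> X.mon \<alpha>)"
      using rel1 by blast
  qed
qed

end

section \<open>Skew-commuting variables\<close>

text \<open>The relations of (iii) without remainders. The associated graded ring of the weight
  filtration will be an instance.\<close>

locale skew_monomials = monomials R x s
  for R (structure) and x s +
  fixes A :: "'a set" and Q :: "nat \<Rightarrow> nat \<Rightarrow> 'a"
  assumes A: "subring A R"
    and base: "k \<in> {1..s} \<Longrightarrow> a \<in> A \<Longrightarrow> \<exists>a'\<in>A. x k \<otimes> a = a' \<otimes> x k"
    and rel: "1 \<le> i \<Longrightarrow> i < j \<Longrightarrow> j \<le> s \<Longrightarrow> Q j i \<in> A \<and> x j \<otimes> x i = Q j i \<otimes> x i \<otimes> x j"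
begin

text \<open>\<open>x k\<close> moves to the right past each smaller variable. A swap contributes the
  scalar \<open>Q k i\<close>, and the scalar from the inductive step is carried back across
  \<open>x i\<close> by \<open>base\<close>; so just one scalar accumulates in front.\<close>

lemma skew_shift:
  assumes k: "k \<in> {1..s}" and "\<beta> \<in> Nvec s"
  shows "\<exists>c\<in>A. x k \<otimes> mon \<beta> = c \<otimes> mon (vadd (unitvec k) \<beta>)"
  using assms(2)
proof (induction rule: Nvec_induct)
  case vzero
  show ?case using mon_unitvec[OF k] x_closed[OF k] subringE(3)[OF A] by (intro bexI[of _ \<one>]) simp_all
next
  case (unitvec i \<beta>)
  note xc = x_closed[OF k] x_closed[OF unitvec(1)]
  have AR: "a \<in> A \<Longrightarrow> a \<in> carrier R" for a using subringE(1)[OF A] by blast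
  show ?case
  proof (cases "k \<le> i")
    case True
    then have "x k \<otimes> mon (vadd (unitvec i) \<beta>) = mon (vadd (unitvec k) (vadd (unitvec i) \<beta>))"
      using unitvec(3) by (intro mon_Cons[OF k]) (auto simp: vadd_def unitvec_def)
    then show ?thesis using subringE(3)[OF A] by (intro bexI[of _ \<one>]) simp_all
  next
    case False
    obtain c where c: "c \<in> A" "x k \<otimes> mon \<beta> = c \<otimes> mon (vadd (unitvec k) \<beta>)" using unitvec(4) by blast
    obtain c' where c': "c' \<in> A" "x i \<otimes> c = c' \<otimes> x i" using base[OF unitvec(1) c(1)] by blast
    have q: "Q k i \<in> A" "x k \<otimes> x i = Q k i \<otimes> x i \<otimes> x k" using rel[of i k] False unitvec(1) k by auto
    have xi: "x i \<otimes> mon \<beta>' = mon (vadd (unitvec i) \<beta>')" if "\<And>j. j < i \<Longrightarrow> \<beta>' j = 0" for \<beta>'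
      by (rule mon_Cons[OF unitvec(1)]) (use that in auto)
    have "x k \<otimes> mon (vadd (unitvec i) \<beta>) = x k \<otimes> x i \<otimes> mon \<beta>"
      using xi[OF unitvec(3)] xc by (simp add: m_assoc)
    also have "\<dots> = Q k i \<otimes> (x i \<otimes> (x k \<otimes> mon \<beta>))"
      unfolding q(2) using xc AR[OF q(1)] by (simp add: m_assoc)
    also have "\<dots> = Q k i \<otimes> (x i \<otimes> c \<otimes> mon (vadd (unitvec k) \<beta>))"
      unfolding c(2) using xc AR[OF c(1)] by (simp add: m_assoc)
    also have "\<dots> = Q k i \<otimes> c' \<otimes> (x i \<otimes> mon (vadd (unitvec k) \<beta>))"
      unfolding c'(2) using xc AR[OF c'(1)] AR[OF q(1)] by (simp add: m_assoc)
    also have "x i \<otimes> mon (vadd (unitvec k) \<beta>) = mon (vadd (unitvec i) (vadd (unitvec k) \<beta>))"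
      by (rule xi) (use unitvec(3) False in \<open>auto simp: vadd_def unitvec_def\<close>)
    also have "vadd (unitvec i) (vadd (unitvec k) \<beta>) = vadd (unitvec k) (vadd (unitvec i) \<beta>)"
      by (auto simp: vadd_def)
    finally show ?thesis using subringE(6)[OF A q(1) c'(1)] by blast
  qed
qed

text \<open>\<open>B\<close> is the ring of all elements whose left multiplication maps the span
  into itself. It contains \<open>A\<close> and, by \<open>skew_shift\<close>, the variables, hence
  all monomials and the span; so the span is closed under products.\<close>

lemma lspan_subring:
  assumes j: "j \<le> s"
  shows "subring (lspan R A (Nvec j) mon) R"
proof -
  interpret V: left_family R A "Nvec j" mon using mon_family[OF A] .
  let ?V = "lspan R A (Nvec j) mon"
  define B where "B = {b \<in> carrier R. \<forall>v\<in>?V. b \<otimes> v \<in> ?V}"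
  note add = V.lspan_additive
  have B: "subring B R"
  proof (rule subringI)
    show "\<ominus> h \<in> B" if "h \<in> B" for h
      using that additive_subgroup_uminus[OF ring_axioms add] V.lspan_carr by (auto simp: B_def l_minus)
    show "h \<oplus> h' \<in> B" if "h \<in> B" "h' \<in> B" for h h'
      using that additive_subgroup.a_closed[OF add] V.lspan_carr by (auto simp: B_def l_distr)
    show "h \<otimes> h' \<in> B" if "h \<in> B" "h' \<in> B" for h h'
      using that V.lspan_carr by (auto simp: B_def m_assoc)
    show "\<one> \<in> B" using V.lspan_carr by (auto simp: B_def)
  qed (auto simp: B_def)
  have AB: "A \<subseteq> B" using V.lspan_smult V.A_carr by (auto simp: B_def)
  have xB: "x k \<in> B" if k: "k \<in> {1..j}" for k
  proof -
    have ks: "k \<in> {1..s}" using k j by auto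
    note xk = x_closed[OF ks]
    have sg: "additive_subgroup {v \<in> carrier R. x k \<otimes> v \<in> ?V} R"
      by (rule additive_subgroupI)
        (use xk additive_subgroup.zero_closed[OF add] additive_subgroup.a_closed[OF add]
          additive_subgroup_uminus[OF ring_axioms add] in \<open>auto simp: r_distr r_minus\<close>)
    have "?V \<subseteq> {v \<in> carrier R. x k \<otimes> v \<in> ?V}"
    proof (rule V.lspan_minimal[OF sg])
      fix \<alpha> a assume \<alpha>: "\<alpha> \<in> Nvec j" and a: "a \<in> A"
      obtain a' where a': "a' \<in> A" "x k \<otimes> a = a' \<otimes> x k" using base[OF ks a] by blast
      have "\<alpha> \<in> Nvec s" using \<alpha> Nvec_mono[OF j] by blast
      then obtain c where c: "c \<in> A" "x k \<otimes> mon \<alpha> = c \<otimes> mon (vadd (unitvec k) \<alpha>)"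
        using skew_shift[OF ks] by blast
      have "x k \<otimes> (a \<otimes> mon \<alpha>) = x k \<otimes> a \<otimes> mon \<alpha>" using xk V.A_carr[OF a] by (simp add: m_assoc)
      also have "\<dots> = a' \<otimes> (x k \<otimes> mon \<alpha>)" unfolding a'(2) using xk V.A_carr[OF a'(1)] by (simp add: m_assoc)
      also have "\<dots> = a' \<otimes> (c \<otimes> mon (vadd (unitvec k) \<alpha>))" unfolding c(2) ..
      also have "\<dots> \<in> ?V"
        using a' c \<alpha> k by (intro V.lspan_smult V.lspan_base_smult) auto
      finally show "a \<otimes> mon \<alpha> \<in> {v \<in> carrier R. x k \<otimes> v \<in> ?V}"
        using V.A_carr[OF a] by simp
    qed
    then show ?thesis using xk unfolding B_def by blast
  qed
  have "?V \<subseteq> B"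
  proof (rule V.lspan_minimal)
    show "additive_subgroup B R" using B subring.axioms(1) additive_subgroup.intro by blast
    show "a \<otimes> mon \<alpha> \<in> B" if "\<alpha> \<in> Nvec j" "a \<in> A" for \<alpha> a
      using mon_in_subring[OF B j xB that(1)] subringE(6)[OF B] AB that by blast
  qed
  then have mult: "u \<otimes> v \<in> ?V" if "u \<in> ?V" "v \<in> ?V" for u v using that unfolding B_def by blast
  show ?thesis
  proof (rule subringI)
    show "?V \<subseteq> carrier R" using V.lspan_carr by blast
    show "\<one> \<in> ?V" using V.lspan_base[of vzero] by simp
  qed (use mult additive_subgroup.a_closed[OF add] additive_subgroup_uminus[OF ring_axioms add] in auto)
qed

lemma ore_stage_eq_lspan:
  assumes j: "j \<le> s"
  shows "ore_stage R A x j = lspan R A (Nvec j) mon"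
proof
  interpret V: left_family R A "Nvec j" mon using mon_family[OF A] .
  note st = ore_stage_facts[OF A j]
  show "lspan R A (Nvec j) mon \<subseteq> ore_stage R A x j"
  proof (rule V.lspan_minimal)
    show "additive_subgroup (ore_stage R A x j) R"
      using st(1) subring.axioms(1) additive_subgroup.intro by blast
    show "a \<otimes> mon \<alpha> \<in> ore_stage R A x j" if "\<alpha> \<in> Nvec j" "a \<in> A" for \<alpha> a
      using mon_in_subring[OF st(1) j st(3) that(1)] subringE(6)[OF st(1)] st(2) that by blast
  qed
  show "ore_stage R A x j \<subseteq> lspan R A (Nvec j) mon"
    unfolding ore_stage_def
  proof (rule generate_ring_min_subring1[OF _ lspan_subring[OF j]])
    show "A \<union> x ` {1..j} \<subseteq> carrier R" using V.A_carr x_closed j by auto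
    have "a \<in> lspan R A (Nvec j) mon" if "a \<in> A" for a
      using V.lspan_base_smult[of vzero a] that V.A_carr by simp
    moreover have "x i \<in> lspan R A (Nvec j) mon" if "i \<in> {1..j}" for i
      using V.lspan_base[of "unitvec i"] mon_unitvec[of i] that j by simp
    ultimately show "A \<union> x ` {1..j} \<subseteq> lspan R A (Nvec j) mon" by blast
  qed
qed

text \<open>The endomorphism \<sigma> is forced by its equation. Existence of b with x_j a = b x_j
  is checked on monomials; uniqueness holds because the powers of x_j are independent over the
  previous stage, and it makes \<sigma> a ring homomorphism.\<close>

lemma monomial_basis_iterated_ore:
  assumes ind: "lindep R A (Nvec s) mon"
    and j: "j \<in> {1..s}"
  shows "\<exists>\<sigma>. ore_step R (ore_stage R A x (j - 1)) (x j) \<sigma> (ore_stage R A x j) \<and>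
    (\<forall>i\<in>{1..<j}. \<sigma> (x i) = Q j i \<otimes> x i)"
proof -
  have j1: "j - 1 \<le> s" and js: "j \<le> s" using j by auto
  define V where "V = lspan R A (Nvec (j - 1)) mon"
  have V: "ore_stage R A x (j - 1) = V" unfolding V_def by (rule ore_stage_eq_lspan[OF j1])
  have V': "ore_stage R A x j = lspan R A (Nvec j) mon" by (rule ore_stage_eq_lspan[OF js])
  note st = ore_stage_facts[OF A j1, unfolded V] and st' = ore_stage_facts[OF A js]
  note VE = subringE[OF st(1)]
  have xj: "x j \<in> carrier R" using x_closed[OF j] .
  interpret fam: left_family R A "Nvec (j - 1)" mon using mon_family[OF A] .
  interpret tower R A V "Nvec (j - 1)" "UNIV :: nat set" mon "\<lambda>k. x j [^] k"
  proof (intro tower.intro tower_axioms.intro ring_axioms A st(1,2))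
    show "mon \<in> Nvec (j - 1) \<rightarrow> V" using mon_in_subring[OF st(1) j1 st(3)] by blast
    show "(\<lambda>k. x j [^] k) \<in> (UNIV :: nat set) \<rightarrow> carrier R" using xj by auto
    show "V \<subseteq> lspan R A (Nvec (j - 1)) mon" unfolding V_def by blast
  qed
  \<comment> \<open>Independence over \<open>A\<close> of all monomials in \<open>j\<close>
    variables descends to independence of the powers of \<open>x j\<close> over the ring generated
    by the others.\<close>
  have indj: "lindep R V (UNIV :: nat set) (\<lambda>k. x j [^] k)"
    using lindep_down mon_split(2)[OF A j] lindep_mono[OF ind Nvec_mono[OF js]] by blast
  have spanj: "ore_stage R A x j = lspan R V (UNIV :: nat set) (\<lambda>k. x j [^] k)"
    unfolding V' mon_split(1)[OF A j] lspan_eq ..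
  have uniq: "a = b" if ab: "a \<in> V" "b \<in> V" "a \<otimes> x j = b \<otimes> x j" for a b
  proof -
    have "(\<Oplus>k\<in>{1::nat}. a \<otimes> x j [^] k) = (\<Oplus>k\<in>{1::nat}. b \<otimes> x j [^] k)"
      using ab xj carr(1) by simp
    then show ?thesis
      using dB.lindep_unique[OF indj, of "{1}" "\<lambda>_. a" "\<lambda>_. b" 1] ab by simp
  qed
  have ex: "\<exists>b\<in>V. x j \<otimes> a = b \<otimes> x j" if "a \<in> V" for a
  proof -
    have sg: "additive_subgroup {a \<in> carrier R. \<exists>b\<in>V. x j \<otimes> a = b \<otimes> x j} R"
    proof (rule additive_subgroupI)
      show "\<zero> \<in> {a \<in> carrier R. \<exists>b\<in>V. x j \<otimes> a = b \<otimes> x j}"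
        using xj VE(2) by (auto intro!: bexI[of _ \<zero>])
    next
      fix a b assume "a \<in> {a \<in> carrier R. \<exists>b\<in>V. x j \<otimes> a = b \<otimes> x j}" "b \<in> {a \<in> carrier R. \<exists>b\<in>V. x j \<otimes> a = b \<otimes> x j}"
      then obtain a' b' where "a \<in> carrier R" "b \<in> carrier R" "a' \<in> V" "b' \<in> V"
        "x j \<otimes> a = a' \<otimes> x j" "x j \<otimes> b = b' \<otimes> x j" by blast
      then show "a \<oplus> b \<in> {a \<in> carrier R. \<exists>b\<in>V. x j \<otimes> a = b \<otimes> x j}"
        using xj carr(1) VE(7) by (auto simp: r_distr l_distr intro!: bexI[of _ "a' \<oplus> b'"])
    next
      fix a assume "a \<in> {a \<in> carrier R. \<exists>b\<in>V. x j \<otimes> a = b \<otimes> x j}"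
      then obtain a' where "a \<in> carrier R" "a' \<in> V" "x j \<otimes> a = a' \<otimes> x j" by blast
      then show "\<ominus> a \<in> {a \<in> carrier R. \<exists>b\<in>V. x j \<otimes> a = b \<otimes> x j}"
        using xj carr(1) VE(5) by (auto simp: r_minus l_minus intro!: bexI[of _ "\<ominus> a'"])
    qed auto
    have "lspan R A (Nvec (j - 1)) mon \<subseteq> {a \<in> carrier R. \<exists>b\<in>V. x j \<otimes> a = b \<otimes> x j}"
    proof (rule fam.lspan_minimal[OF sg])
      fix \<alpha> a assume \<alpha>: "\<alpha> \<in> Nvec (j - 1)" and a: "a \<in> A"
      obtain a' where a': "a' \<in> A" "x j \<otimes> a = a' \<otimes> x j" using base[OF j a] by blast
      have "\<alpha> \<in> Nvec s" using \<alpha> Nvec_mono[OF j1] by blast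
      then obtain c where c: "c \<in> A" "x j \<otimes> mon \<alpha> = c \<otimes> mon (vadd (unitvec j) \<alpha>)"
        using skew_shift[OF j] by blast
      \<comment> \<open>\<open>x j\<close> does not occur in the monomial, so shifting it in means
        appending it on the right as a single factor.\<close>
      have "\<alpha> j = 0" using \<alpha> j by (auto simp: Nvec_iff)
      then have "vadd (unitvec j) \<alpha> = \<alpha>(j := 1)" by (auto simp: vadd_def unitvec_def)
      then have m: "mon (vadd (unitvec j) \<alpha>) = mon \<alpha> \<otimes> x j" using mon_snoc[OF j \<alpha>, of 1] xj by simp
      note cc = fam.A_carr[OF a] fam.A_carr[OF a'(1)] fam.A_carr[OF c(1)] xj
      have "x j \<otimes> (a \<otimes> mon \<alpha>) = x j \<otimes> a \<otimes> mon \<alpha>" using cc by (simp add: m_assoc)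
      also have "\<dots> = a' \<otimes> (x j \<otimes> mon \<alpha>)" unfolding a'(2) using cc by (simp add: m_assoc)
      also have "\<dots> = a' \<otimes> (c \<otimes> mon \<alpha>) \<otimes> x j" unfolding c(2) m using cc by (simp add: m_assoc)
      finally have "x j \<otimes> (a \<otimes> mon \<alpha>) = a' \<otimes> (c \<otimes> mon \<alpha>) \<otimes> x j" .
      moreover have "a' \<otimes> (c \<otimes> mon \<alpha>) \<in> V"
        unfolding V_def using a' c \<alpha> by (intro fam.lspan_smult fam.lspan_base_smult)
      ultimately show "a \<otimes> mon \<alpha> \<in> {a \<in> carrier R. \<exists>b\<in>V. x j \<otimes> a = b \<otimes> x j}" using cc by auto
    qed
    then show ?thesis using that unfolding V_def by blast
  qed
  then obtain \<sigma> where \<sigma>: "\<And>a. a \<in> V \<Longrightarrow> \<sigma> a \<in> V \<and> x j \<otimes> a = \<sigma> a \<otimes> x j" by metis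
  have \<sigma>_eq: "\<sigma> a = b" if "a \<in> V" "b \<in> V" "x j \<otimes> a = b \<otimes> x j" for a b
    using uniq[of "\<sigma> a" b] \<sigma>[OF that(1)] that by simp
  have hom: "\<sigma> \<in> ring_hom (R\<lparr>carrier := V\<rparr>) (R\<lparr>carrier := V\<rparr>)"
  proof (rule ring_hom_memI)
    fix a b assume ab: "a \<in> carrier (R\<lparr>carrier := V\<rparr>)" "b \<in> carrier (R\<lparr>carrier := V\<rparr>)"
    then have abV: "a \<in> V" "b \<in> V" by simp_all
    note cc = carr(1)[OF abV(1)] carr(1)[OF abV(2)] carr(1)[OF \<sigma>[OF abV(1), THEN conjunct1]]
      carr(1)[OF \<sigma>[OF abV(2), THEN conjunct1]] xj
    note s1 = \<sigma>[OF abV(1)] and s2 = \<sigma>[OF abV(2)]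
    have "x j \<otimes> (a \<otimes> b) = x j \<otimes> a \<otimes> b" using cc by (simp add: m_assoc)
    also have "\<dots> = \<sigma> a \<otimes> (x j \<otimes> b)" using s1 cc by (simp add: m_assoc)
    also have "\<dots> = \<sigma> a \<otimes> \<sigma> b \<otimes> x j" using s2 cc by (simp add: m_assoc)
    finally show "\<sigma> (a \<otimes>\<^bsub>R\<lparr>carrier := V\<rparr>\<^esub> b) = \<sigma> a \<otimes>\<^bsub>R\<lparr>carrier := V\<rparr>\<^esub> \<sigma> b"
      using \<sigma>_eq[of "a \<otimes> b" "\<sigma> a \<otimes> \<sigma> b"] VE(6) abV s1 s2 by simp
    have "x j \<otimes> (a \<oplus> b) = (\<sigma> a \<oplus> \<sigma> b) \<otimes> x j" using s1 s2 cc by (simp add: r_distr l_distr)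
    then show "\<sigma> (a \<oplus>\<^bsub>R\<lparr>carrier := V\<rparr>\<^esub> b) = \<sigma> a \<oplus>\<^bsub>R\<lparr>carrier := V\<rparr>\<^esub> \<sigma> b"
      using \<sigma>_eq[of "a \<oplus> b" "\<sigma> a \<oplus> \<sigma> b"] VE(7) abV s1 s2 by simp
  qed (use \<sigma> \<sigma>_eq[of \<one> \<one>] VE(3) xj in auto)
  have "V \<subseteq> ore_stage R A x j"
    unfolding V_def V' by (rule lspan_mono[OF Nvec_mono]) simp
  moreover have "left_basis R V (UNIV :: nat set) (\<lambda>k. x j [^] k) (ore_stage R A x j)"
    using dB.left_basis_iff[OF subringE(2)[OF st'(1)]] spanj indj by blast
  ultimately have "ore_step R V (x j) \<sigma> (ore_stage R A x j)"
    unfolding ore_step_def using xj st'(3)[of j] j hom \<sigma> by auto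
  moreover have "\<sigma> (x i) = Q j i \<otimes> x i" if i: "i \<in> {1..<j}" for i
  proof (rule \<sigma>_eq)
    show xi: "x i \<in> V" using st(3)[of i] i by auto
    have q: "Q j i \<in> A" "x j \<otimes> x i = Q j i \<otimes> x i \<otimes> x j" using rel[of i j] i j by auto
    show "Q j i \<otimes> x i \<in> V" using VE(6) xi q(1) st(2) by blast
    show "x j \<otimes> x i = Q j i \<otimes> x i \<otimes> x j" by (rule q(2))
  qed
  ultimately show ?thesis unfolding V by blast
qed

end

section \<open>The weight filtration\<close>

text \<open>Condition (iii) after the order has been traded for weights: a remainder is any
  combination of monomials of strictly smaller weight.\<close>

locale weighted_presentation = monomials R x s
  for R (structure) and x s +
  fixes L :: "'a set" and q :: "nat \<Rightarrow> nat \<Rightarrow> 'a" and w :: "nat \<Rightarrow> nat"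
  assumes L_sub: "subring L R"
    and w_pos: "k \<in> {1..s} \<Longrightarrow> 0 < w k"
    and span: "carrier R \<subseteq> lspan R L (Nvec s) mon"
    and indep: "lindep R L (Nvec s) mon"
    and rel2: "\<lbrakk>1 \<le> i; i < j; j \<le> s\<rbrakk> \<Longrightarrow> q j i \<in> L \<and>
      (\<exists>r\<in>lspan R L {\<gamma>\<in>Nvec s. vweight s w \<gamma> < w i + w j} mon. x j \<otimes> x i = q j i \<otimes> x i \<otimes> x j \<oplus> r)"
    and rel1: "\<lbrakk>k \<in> {1..s}; a \<in> L\<rbrakk> \<Longrightarrow>
      \<exists>a'\<in>L. \<exists>r\<in>lspan R L {\<gamma>\<in>Nvec s. vweight s w \<gamma> < w k} mon. x k \<otimes> a = a' \<otimes> x k \<oplus> r"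
begin

abbreviation "vw \<equiv> vweight s w"

definition Rn :: "nat \<Rightarrow> 'a set" where
  "Rn m = lspan R L {\<gamma>\<in>Nvec s. vw \<gamma> \<le> m} mon"

lemma fam: "left_family R L I mon"
  using mon_family[OF L_sub] .

lemma L_carr: "a \<in> L \<Longrightarrow> a \<in> carrier R"
  using subringE(1)[OF L_sub] by blast

lemma Rn_add: "additive_subgroup (Rn m) R"
  unfolding Rn_def by (rule left_family.lspan_additive[OF fam])

lemma Rn_carr: "r \<in> Rn m \<Longrightarrow> r \<in> carrier R"
  using additive_subgroup.a_Hcarr[OF Rn_add] .

lemma Rn_mono: "m \<le> m' \<Longrightarrow> Rn m \<subseteq> Rn m'"
  unfolding Rn_def by (rule lspan_mono) auto

lemma Rn_smult: "a \<in> L \<Longrightarrow> r \<in> Rn m \<Longrightarrow> a \<otimes> r \<in> Rn m"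
  unfolding Rn_def by (rule left_family.lspan_smult[OF fam])

lemma Rn_base: "\<gamma> \<in> Nvec s \<Longrightarrow> vw \<gamma> \<le> m \<Longrightarrow> mon \<gamma> \<in> Rn m"
  unfolding Rn_def by (rule left_family.lspan_base[OF fam]) simp

lemma Rn_minimal:
  assumes "additive_subgroup H R" "\<And>\<gamma> a. \<gamma> \<in> Nvec s \<Longrightarrow> vw \<gamma> \<le> m \<Longrightarrow> a \<in> L \<Longrightarrow> a \<otimes> mon \<gamma> \<in> H"
  shows "Rn m \<subseteq> H"
  unfolding Rn_def by (rule left_family.lspan_minimal[OF fam assms(1)]) (use assms(2) in auto)

text \<open>The assumption on \<open>M\<close> matters, as \<open>M - 1\<close> is truncated: for
  \<open>M = 0\<close> the left side is the zero span but \<open>Rn 0\<close> is \<Lambda>.\<close>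

lemma lower_Rn: "0 < M \<Longrightarrow> lspan R L {\<gamma>\<in>Nvec s. vw \<gamma> < M} mon = Rn (M - 1)"
proof -
  assume "0 < M"
  then have "{\<gamma>\<in>Nvec s. vw \<gamma> < M} = {\<gamma>\<in>Nvec s. vw \<gamma> \<le> M - 1}" by auto
  then show ?thesis unfolding Rn_def by simp
qed

lemma subgroup_left: "u \<in> carrier R \<Longrightarrow> additive_subgroup {v \<in> carrier R. u \<otimes> v \<in> Rn m} R"
  by (rule additive_subgroupI)
    (use additive_subgroup.zero_closed[OF Rn_add] additive_subgroup.a_closed[OF Rn_add]
      additive_subgroup_uminus[OF ring_axioms Rn_add] in \<open>auto simp: r_distr r_minus\<close>)

lemma subgroup_right: "v \<in> carrier R \<Longrightarrow> additive_subgroup {u \<in> carrier R. u \<otimes> v \<in> Rn m} R"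
  by (rule additive_subgroupI)
    (use additive_subgroup.zero_closed[OF Rn_add] additive_subgroup.a_closed[OF Rn_add]
      additive_subgroup_uminus[OF ring_axioms Rn_add] in \<open>auto simp: l_distr l_minus\<close>)

text \<open>The inductive statement of the rewriting argument, for one variable times a scalar times
  a monomial. Quantifying over all \<open>t\<close> up to the bound gives the sharp target
  \<open>Rn t\<close> and not merely \<open>Rn T\<close>.\<close>

definition multiplicative_upto :: "nat \<Rightarrow> bool" where
  "multiplicative_upto T \<longleftrightarrow> (\<forall>t\<le>T. \<forall>k\<in>{1..s}. \<forall>a\<in>L. \<forall>\<beta>\<in>Nvec s. w k + vw \<beta> \<le> t \<longrightarrow> x k \<otimes> (a \<otimes> mon \<beta>) \<in> Rn t)"

text \<open>From one variable to arbitrary left factors: extend additively in the right factor, then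
  build the left monomial by prepending variables, then extend additively in the left factor. In all
  these products the weight stays at most \<open>T\<close>.\<close>

lemma Rn_mult_upto:
  assumes T: "multiplicative_upto T" and "u \<in> Rn m" "v \<in> Rn m'" "m + m' \<le> T"
  shows "u \<otimes> v \<in> Rn (m + m')"
proof -
  have gen: "x k \<otimes> v \<in> Rn (w k + m)" if k: "k \<in> {1..s}" and v: "v \<in> Rn m" and m: "w k + m \<le> T" for k v m
  proof -
    have "Rn m \<subseteq> {v \<in> carrier R. x k \<otimes> v \<in> Rn (w k + m)}"
      by (rule Rn_minimal[OF subgroup_left[OF x_closed[OF k]]])
        (use T k m L_carr in \<open>auto simp: multiplicative_upto_def\<close>)
    then show ?thesis using v by blast
  qed
  have mon: "mon \<gamma> \<otimes> v \<in> Rn (vw \<gamma> + m')" if "\<gamma> \<in> Nvec s" "v \<in> Rn m'" "vw \<gamma> + m' \<le> T" for \<gamma> v m'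
    using that
  proof (induction rule: Nvec_induct)
    case vzero
    then show ?case using Rn_carr by simp
  next
    case (unitvec i \<beta>)
    have vw: "vw (vadd (unitvec i) \<beta>) = w i + vw \<beta>" using unitvec(1) by (simp add: vweight_vadd vweight_unitvec)
    have "mon (vadd (unitvec i) \<beta>) = x i \<otimes> mon \<beta>" using mon_Cons[OF unitvec(1)] unitvec(3) by simp
    then have "mon (vadd (unitvec i) \<beta>) \<otimes> v = x i \<otimes> (mon \<beta> \<otimes> v)"
      using x_closed[OF unitvec(1)] Rn_carr[OF unitvec(5)] by (simp add: m_assoc)
    moreover have "mon \<beta> \<otimes> v \<in> Rn (vw \<beta> + m')" using unitvec vw by simp
    ultimately show ?case
      using gen[OF unitvec(1), of "mon \<beta> \<otimes> v" "vw \<beta> + m'"] unitvec(6) vw by (simp add: add.assoc)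
  qed
  have "Rn m \<subseteq> {u \<in> carrier R. u \<otimes> v \<in> Rn (m + m')}"
  proof (rule Rn_minimal[OF subgroup_right[OF Rn_carr[OF assms(3)]]])
    fix \<gamma> a assume \<gamma>: "\<gamma> \<in> Nvec s" "vw \<gamma> \<le> m" and a: "a \<in> L"
    have "mon \<gamma> \<otimes> v \<in> Rn (m + m')"
      using mon[OF \<gamma>(1) assms(3)] \<gamma>(2) assms(4) Rn_mono[of "vw \<gamma> + m'" "m + m'"] by auto
    then show "a \<otimes> mon \<gamma> \<in> {u \<in> carrier R. u \<otimes> v \<in> Rn (m + m')}"
      using Rn_smult[OF a, of "mon \<gamma> \<otimes> v"] L_carr[OF a] Rn_carr[OF assms(3)] by (simp add: m_assoc)
  qed
  then show ?thesis using assms(2) by blast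
qed

text \<open>Moving \<open>x k\<close> past a scalar leaves r of weight below \<open>w k\<close>, so
  r times the monomial is covered by the bound \<open>T\<close>. If the monomial starts with a
  variable of index at least \<open>k\<close>, prepending is free. Otherwise it starts with some
  \<open>x i\<close> with i < k, and swapping leaves another remainder covered by \<open>T\<close>
  and the term with \<open>x i\<close> in front, which is handled by induction on the index.\<close>

lemma multiplicative_all: "multiplicative_upto T"
proof (induction T)
  \<comment> \<open>Vacuous, because every variable has positive weight.\<close>
  case 0
  then show ?case using w_pos unfolding multiplicative_upto_def by fastforce
next
  case (Suc T)
  have low: "u \<otimes> v \<in> Rn (Suc T)" if "u \<in> Rn m" "v \<in> Rn m'" "m + m' \<le> T" for u v m m'
    using Rn_mult_upto[OF Suc that] Rn_mono[of "m + m'" "Suc T"] that(3) by auto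
  have step: "x k \<otimes> (a \<otimes> mon \<beta>) \<in> Rn (Suc T)"
    if "k \<in> {1..s}" "a \<in> L" "\<beta> \<in> Nvec s" "w k + vw \<beta> \<le> Suc T" for k a \<beta>
    using that
  proof (induction k arbitrary: a \<beta> rule: less_induct)
    case (less k)
    note k = less.prems(1) and xk = x_closed[OF less.prems(1)] and wk = w_pos[OF less.prems(1)]
    obtain a' r where a': "a' \<in> L" "r \<in> Rn (w k - 1)" "x k \<otimes> a = a' \<otimes> x k \<oplus> r"
      using rel1[OF k less.prems(2)] lower_Rn[OF wk] by auto
    have rc: "r \<in> carrier R" using Rn_carr[OF a'(2)] .
    have "x k \<otimes> mon \<beta> \<in> Rn (Suc T)"
    proof (cases "\<beta> = vzero")
      case True
      then have "x k \<otimes> mon \<beta> = mon (unitvec k)" using xk mon_unitvec[OF k] by simp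
      then show ?thesis using Rn_base[of "unitvec k" "Suc T"] k less.prems(4) by (simp add: vweight_unitvec)
    next
      case False
      then obtain i \<beta>' where i: "i \<in> {1..s}" "\<beta>' \<in> Nvec s" "\<beta> = vadd (unitvec i) \<beta>'" "\<And>j. j < i \<Longrightarrow> \<beta> j = 0"
        using Nvec_least_index[OF less.prems(3)] by blast
      have \<beta>'0: "\<beta>' j = 0" if "j < i" for j using i(3,4) that by (auto simp: vadd_def unitvec_def)
      have vw\<beta>: "vw \<beta> = w i + vw \<beta>'" unfolding i(3) using i(1) by (simp add: vweight_vadd vweight_unitvec)
      have xi: "x i \<in> carrier R" using x_closed[OF i(1)] .
      show ?thesis
      proof (cases "k \<le> i")
        case True
        then have "x k \<otimes> mon \<beta> = mon (vadd (unitvec k) \<beta>)" using i(4) by (intro mon_Cons[OF k]) auto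
        then show ?thesis
          using Rn_base[of "vadd (unitvec k) \<beta>" "Suc T"] k less.prems(3,4) by (simp add: vweight_vadd vweight_unitvec)
      next
        case False
        then have ik: "1 \<le> i" "i < k" "k \<le> s" using i(1) k by auto
        obtain r' where r': "q k i \<in> L" "r' \<in> Rn (w i + w k - 1)" "x k \<otimes> x i = q k i \<otimes> x i \<otimes> x k \<oplus> r'"
          using rel2[OF ik] lower_Rn[of "w i + w k"] wk by auto
        have r'c: "r' \<in> carrier R" using Rn_carr[OF r'(2)] .
        have "mon \<beta> = x i \<otimes> mon \<beta>'" unfolding i(3) using mon_Cons[OF i(1)] \<beta>'0 by simp
        then have "x k \<otimes> mon \<beta> = x k \<otimes> x i \<otimes> mon \<beta>'" using xk xi by (simp add: m_assoc)
        also have "\<dots> = q k i \<otimes> (x i \<otimes> (x k \<otimes> mon \<beta>')) \<oplus> r' \<otimes> mon \<beta>'"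
          unfolding r'(3) using xk xi L_carr[OF r'(1)] r'c by (simp add: l_distr m_assoc)
        finally have eq: "x k \<otimes> mon \<beta> = q k i \<otimes> (x i \<otimes> (x k \<otimes> mon \<beta>')) \<oplus> r' \<otimes> mon \<beta>'" .
        have "r' \<otimes> mon \<beta>' \<in> Rn (Suc T)"
          by (rule low[OF r'(2) Rn_base[OF i(2) order_refl]]) (use less.prems(4) vw\<beta> wk in simp)
        moreover have "x i \<otimes> (x k \<otimes> mon \<beta>') \<in> Rn (Suc T)"
        proof -
          \<comment> \<open>Removing \<open>x i\<close> lowers the weight strictly, so sorting
            \<open>x k\<close> into the rest is covered by the outer induction.\<close>
          have "w k + vw \<beta>' \<le> T" using less.prems(4) vw\<beta> w_pos[OF i(1)] by simp
          then have "x k \<otimes> (\<one> \<otimes> mon \<beta>') \<in> Rn (w k + vw \<beta>')"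
            using Suc k i(2) subringE(3)[OF L_sub] unfolding multiplicative_upto_def by blast
          then have "x k \<otimes> mon \<beta>' \<in> Rn (w k + vw \<beta>')" by simp
          moreover have "Rn (w k + vw \<beta>') \<subseteq> {v \<in> carrier R. x i \<otimes> v \<in> Rn (Suc T)}"
          proof (rule Rn_minimal[OF subgroup_left[OF xi]])
            fix \<gamma> c assume "\<gamma> \<in> Nvec s" "vw \<gamma> \<le> w k + vw \<beta>'" "c \<in> L"
            \<comment> \<open>The sorted terms may have the same total weight as before, but the
              variable in front now has the smaller index \<open>i\<close>.\<close>
            then show "c \<otimes> mon \<gamma> \<in> {v \<in> carrier R. x i \<otimes> v \<in> Rn (Suc T)}"
              using less.IH[OF ik(2) i(1), of c \<gamma>] less.prems(4) vw\<beta> L_carr by simp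
          qed
          ultimately show ?thesis by blast
        qed
        ultimately show ?thesis
          unfolding eq using Rn_smult[OF r'(1)] additive_subgroup.a_closed[OF Rn_add] by blast
      qed
    qed
    moreover have "r \<otimes> mon \<beta> \<in> Rn (Suc T)"
      by (rule low[OF a'(2) Rn_base[OF less.prems(3) order_refl]]) (use less.prems(4) wk in simp)
    moreover have "x k \<otimes> (a \<otimes> mon \<beta>) = a' \<otimes> (x k \<otimes> mon \<beta>) \<oplus> r \<otimes> mon \<beta>"
    proof -
      have "x k \<otimes> (a \<otimes> mon \<beta>) = x k \<otimes> a \<otimes> mon \<beta>"
        using xk L_carr[OF less.prems(2)] by (simp add: m_assoc)
      then show ?thesis unfolding a'(3) using xk L_carr[OF a'(1)] rc by (simp add: l_distr m_assoc)
    qed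
    ultimately show ?case
      using Rn_smult[OF a'(1)] additive_subgroup.a_closed[OF Rn_add] by simp
  qed
  show ?case
    unfolding multiplicative_upto_def
  proof (intro allI impI ballI)
    fix t k a \<beta> assume t: "t \<le> Suc T" and h: "k \<in> {1..s}" "a \<in> L" "\<beta> \<in> Nvec s" "w k + vw \<beta> \<le> t"
    show "x k \<otimes> (a \<otimes> mon \<beta>) \<in> Rn t"
    proof (cases "t = Suc T")
      case True
      then show ?thesis using step h by simp
    next
      case False
      then show ?thesis using Suc t h unfolding multiplicative_upto_def by simp
    qed
  qed
qed

lemma Rn_mult: "u \<in> Rn m \<Longrightarrow> v \<in> Rn m' \<Longrightarrow> u \<otimes> v \<in> Rn (m + m')"
  using Rn_mult_upto[OF multiplicative_all] by blast

text \<open>Positive integer weights are at least 1. Hence only finitely many monomials have bounded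
  weight, and only the constant one has weight 0.\<close>

lemma coord_le_vw: "\<gamma> \<in> Nvec s \<Longrightarrow> \<gamma> i \<le> vw \<gamma>"
proof (cases "i \<in> {1..s}")
  case True
  then have "\<gamma> i \<le> w i * \<gamma> i" using w_pos[OF True] by simp
  also have "\<dots> \<le> vw \<gamma>" unfolding vweight_def using True by (intro member_le_sum) auto
  finally show ?thesis .
next
  case False
  assume "\<gamma> \<in> Nvec s"
  then show ?thesis using False by (auto simp: Nvec_iff)
qed

lemma Rn_0: "Rn 0 = L"
proof -
  have "{\<gamma>\<in>Nvec s. vw \<gamma> \<le> 0} = Nvec 0"
  proof
    show "{\<gamma>\<in>Nvec s. vw \<gamma> \<le> 0} \<subseteq> Nvec 0"
      using coord_le_vw unfolding Nvec_0 vzero_def by fastforce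
  qed (auto simp: Nvec_0)
  then show ?thesis unfolding Rn_def using lspan_Nvec_0[OF L_sub] by simp
qed

lemma Rn_fin_gen: "fin_gen_left R L (Rn m)"
proof -
  have "{\<gamma>\<in>Nvec s. vw \<gamma> \<le> m} \<subseteq> {\<gamma>\<in>Nvec s. \<forall>i. \<gamma> i \<le> m}" using coord_le_vw order_trans by blast
  then have "finite {\<gamma>\<in>Nvec s. vw \<gamma> \<le> m}" using finite_Nvec_bounded by (rule finite_subset)
  then show ?thesis unfolding Rn_def by (rule fin_gen_left_lspan[OF L_sub]) auto
qed

lemma Rn_exhaust: "r \<in> carrier R \<Longrightarrow> \<exists>m. r \<in> Rn m"
proof -
  assume "r \<in> carrier R"
  then have "r \<in> lspan R L (Nvec s) mon" using span by blast
  then obtain J c where J: "finite J" "J \<subseteq> Nvec s" "c \<in> J \<rightarrow> L" "r = (\<Oplus>i\<in>J. c i \<otimes> mon i)" by (rule lspanE)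
  have "vw i \<le> (\<Sum>i\<in>J. vw i)" if "i \<in> J" for i using that J(1) by (intro member_le_sum) auto
  then have "r \<in> Rn (\<Sum>i\<in>J. vw i)"
    unfolding Rn_def J(4) using J by (intro lspanI) auto
  then show ?thesis by blast
qed

end

section \<open>The weight filtration as a filtration by \<open>\<nat>\<close>\<close>

declare One_nat_def [simp del]

lemma admissible_order_nat: "admissible_order 1 (\<lambda>\<alpha> \<beta>. \<alpha> 1 \<le> \<beta> 1)"
  unfolding admissible_order_def
proof (intro conjI ballI impI, goal_cases)
  case (2 \<alpha> \<beta>)
  show ?case
  proof
    fix i
    show "\<alpha> i = \<beta> i" using 2 by (cases "i = 1") (auto simp: Nvec_iff)
  qed
qed (auto simp: vadd_def vzero_def)

definition nvec1 :: "nat \<Rightarrow> nat \<Rightarrow> nat" where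
  "nvec1 m = (\<lambda>j. if j = 1 then m else 0)"

lemma nvec1_in [simp]: "nvec1 m \<in> Nvec 1" and nvec1_1 [simp]: "nvec1 m 1 = m"
  by (auto simp: nvec1_def Nvec_iff)

lemma Nvec1_eq: "\<alpha> \<in> Nvec 1 \<Longrightarrow> \<alpha> = nvec1 (\<alpha> 1)"
proof
  fix i assume "\<alpha> \<in> Nvec 1"
  then show "\<alpha> i = nvec1 (\<alpha> 1) i" by (cases "i = 1") (auto simp: nvec1_def Nvec_iff)
qed

context weighted_presentation
begin

sublocale FR: filtered_ring R 1 "\<lambda>\<alpha> \<beta>. \<alpha> 1 \<le> \<beta> 1" "\<lambda>\<alpha>. Rn (\<alpha> 1)"
proof (intro filtered_ring.intro filtered_ring_axioms.intro ring_axioms adm_order.intro admissible_order_nat)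
  show "\<one> \<in> Rn (vzero 1)" using Rn_0 subringE(3)[OF L_sub] by (simp add: vzero_def)
  show "a \<otimes> b \<in> Rn (vadd \<alpha> \<beta> 1)" if "a \<in> Rn (\<alpha> 1)" "b \<in> Rn (\<beta> 1)" for \<alpha> \<beta> a b
    using Rn_mult[OF that] by (simp add: vadd_def)
qed (use Rn_add Rn_mono in auto)

definition y :: "nat \<Rightarrow> ((nat \<Rightarrow> nat) \<Rightarrow> 'a) set" where
  "y i = FR.cl (nvec1 (w i)) (x i)"

lemma x_Rn: "i \<in> {1..s} \<Longrightarrow> x i \<in> Rn (w i)"
  using Rn_base[of "unitvec i" "w i"] by (simp add: mon_unitvec vweight_unitvec)

sublocale FE: filtered_elements R 1 "\<lambda>\<alpha> \<beta>. \<alpha> 1 \<le> \<beta> 1" "\<lambda>\<alpha>. Rn (\<alpha> 1)" s x "\<lambda>i. nvec1 (w i)" y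
  by (intro filtered_elements.intro filtered_elements_axioms.intro FR.filtered_ring_axioms)
    (auto simp: y_def x_Rn)

lemma wt_eq: "FE.wt \<alpha> = nvec1 (vw \<alpha>)"
  unfolding FE.wt_def by (auto simp: nvec1_def vweight_def mult.commute)

lemma Rn_vzero: "Rn (vzero 1) = L"
  using Rn_0 by (simp add: vzero_def)

text \<open>For natural numbers, strictly below m means at most m - 1. The case m = 0 is separate:
  truncated subtraction would give \<open>Rn 0\<close> in place of the zero group.\<close>

lemma Fp_nvec1: "FR.Fp (nvec1 m) = (if m = 0 then {\<zero>} else Rn (m - 1))"
proof (cases "m = 0")
  case True
  have "nvec1 0 = vzero" by (auto simp: nvec1_def vzero_def)
  then show ?thesis using FR.Fp_vzero True by simp
next
  case False
  have "a \<in> Rn (m - 1)" if "\<beta> \<in> Nvec 1" "FR.prec \<beta> (nvec1 m)" "a \<in> Rn (\<beta> 1)" for a \<beta>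
  proof -
    have "\<beta> 1 \<le> m" "\<beta> \<noteq> nvec1 m" using that(2) by (auto simp: FR.prec_def)
    then have "\<beta> 1 \<le> m - 1" using Nvec1_eq[OF that(1)] by (cases "\<beta> 1 = m") auto
    then show ?thesis using Rn_mono that(3) by blast
  qed
  then have "FR.Fp (nvec1 m) \<subseteq> Rn (m - 1)"
    using additive_subgroup.zero_closed[OF Rn_add[of "m - 1"]] by (auto simp: FR.Fp_iff)
  moreover have "nvec1 (m - 1) \<noteq> nvec1 m"
  proof
    assume "nvec1 (m - 1) = nvec1 m"
    then have "nvec1 (m - 1) 1 = nvec1 m 1" by (rule arg_cong)
    then show False using False by simp
  qed
  then have prec: "FR.prec (nvec1 (m - 1)) (nvec1 m)" by (simp add: FR.prec_def)
  have "a \<in> FR.Fp (nvec1 m)" if "a \<in> Rn (m - 1)" for a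
    unfolding FR.Fp_iff by (intro disjI2 bexI[of _ "nvec1 (m - 1)"] conjI prec) (simp_all add: that)
  then have "Rn (m - 1) \<subseteq> FR.Fp (nvec1 m)" ..
  ultimately show ?thesis using False by auto
qed

lemma y_carr: "i \<in> {1..s} \<Longrightarrow> y i \<in> carrier FR.G"
  by (rule FE.Y.x_closed)

text \<open>In degree m, the class of a monomial of weight m is the corresponding monomial in the
  \<open>y i\<close>, and the class of a monomial of smaller weight is 0.\<close>

lemma graded_span: "carrier FR.G \<subseteq> lspan FR.G (FR.cl vzero ` L) (Nvec s) FE.Y.mon"
proof
  fix g assume "g \<in> carrier FR.G"
  then obtain S r where S: "finite S" "S \<subseteq> Nvec 1" "\<forall>\<alpha>\<in>S. r \<alpha> \<in> Rn (\<alpha> 1)"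
    "g = (\<Oplus>\<^bsub>FR.G\<^esub>\<alpha>\<in>S. FR.cl \<alpha> (r \<alpha>))" using FR.cl_span by blast
  note YLs = FE.YL.lspan_finsum[unfolded Rn_vzero] FE.YL.lspan_base_smult[unfolded Rn_vzero]
    FE.YL.lspan_additive[unfolded Rn_vzero]
  have "FR.cl \<alpha> (r \<alpha>) \<in> lspan FR.G (FR.cl vzero ` L) (Nvec s) FE.Y.mon" if \<alpha>: "\<alpha> \<in> S" for \<alpha>
  proof -
    have \<alpha>1: "\<alpha> \<in> Nvec 1" "\<alpha> = nvec1 (\<alpha> 1)" using \<alpha> S(2) Nvec1_eq by blast+
    have "r \<alpha> \<in> lspan R L {\<gamma>\<in>Nvec s. vw \<gamma> \<le> \<alpha> 1} mon" using S(3) \<alpha> unfolding Rn_def by blast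
    then obtain J c where J: "finite J" "J \<subseteq> {\<gamma>\<in>Nvec s. vw \<gamma> \<le> \<alpha> 1}" "c \<in> J \<rightarrow> L" "r \<alpha> = (\<Oplus>i\<in>J. c i \<otimes> mon i)"
      by (rule lspanE)
    have cR: "c i \<otimes> mon i \<in> Rn (vw i)" if "i \<in> J" for i
      using that J Rn_smult[OF _ Rn_base[of i "vw i"]] by blast
    have "FR.cl \<alpha> (r \<alpha>) = (\<Oplus>\<^bsub>FR.G\<^esub>i\<in>J. FR.cl \<alpha> (c i \<otimes> mon i))"
      unfolding J(4) by (rule FR.cl_finsum[OF J(1) \<alpha>1(1)]) (use J(2) cR Rn_mono in blast)
    also have "\<dots> \<in> lspan FR.G (FR.cl vzero ` L) (Nvec s) FE.Y.mon"
    proof (rule YLs(1)[OF J(1)])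
      fix i assume i: "i \<in> J"
      then have iN: "i \<in> Nvec s" "vw i \<le> \<alpha> 1" and ci: "c i \<in> L" using J by auto
      show "FR.cl \<alpha> (c i \<otimes> mon i) \<in> lspan FR.G (FR.cl vzero ` L) (Nvec s) FE.Y.mon"
      proof (cases "vw i = \<alpha> 1")
        case True
        then have "FR.cl \<alpha> (c i \<otimes> mon i) = FR.cl vzero (c i) \<otimes>\<^bsub>FR.G\<^esub> FE.Y.mon i"
          using FE.smult_mon_cl[of "c i" i] ci wt_eq[of i] \<alpha>1(2) Rn_vzero by simp
        then show ?thesis using YLs(2)[of i "FR.cl vzero (c i)"] ci iN by simp
      next
        case False
        then have "vw i \<le> \<alpha> 1 - 1" "\<alpha> 1 \<noteq> 0" using iN by auto
        then have "c i \<otimes> mon i \<in> FR.Fp \<alpha>"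
          using cR[OF i] Rn_mono[of "vw i" "\<alpha> 1 - 1"] Fp_nvec1[of "\<alpha> 1"] \<alpha>1(2) by auto
        moreover have "c i \<otimes> mon i \<in> Rn (\<alpha> 1)" using cR[OF i] Rn_mono[OF iN(2)] by blast
        ultimately have "FR.cl \<alpha> (c i \<otimes> mon i) = \<zero>\<^bsub>FR.G\<^esub>" using FR.cl_zero_iff[OF \<alpha>1(1)] by blast
        then show ?thesis using additive_subgroup.zero_closed[OF YLs(3)] by simp
      qed
    qed
    finally show ?thesis .
  qed
  then show "g \<in> lspan FR.G (FR.cl vzero ` L) (Nvec s) FE.Y.mon"
    unfolding S(4) by (rule YLs(1)[OF S(1)])
qed

text \<open>A relation says that the terms of one weight add up to a combination of monomials of
  strictly smaller weight. Since the monomials are independent in \<open>R\<close>,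
  \<open>lindep_support\<close> would make the weight of a term with nonzero coefficient smaller
  than itself.\<close>

lemma graded_lindep: "lindep FR.G (FR.cl vzero ` L) (Nvec s) FE.Y.mon"
  unfolding lindep_def
proof (intro allI impI ballI)
  fix J c' i
  assume J: "finite J" "J \<subseteq> Nvec s" "c' \<in> J \<rightarrow> FR.cl vzero ` L"
    "(\<Oplus>\<^bsub>FR.G\<^esub>i\<in>J. c' i \<otimes>\<^bsub>FR.G\<^esub> FE.Y.mon i) = \<zero>\<^bsub>FR.G\<^esub>" "i \<in> J"
  have "\<forall>i\<in>J. \<exists>a\<in>L. c' i = FR.cl vzero a" using J(3) by blast
  then obtain c where c: "\<And>i. i \<in> J \<Longrightarrow> c i \<in> L \<and> c' i = FR.cl vzero (c i)" by metis
  have cF: "c i \<otimes> mon i \<in> Rn (FE.wt i 1)" if "i \<in> J" for i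
    using FE.smult_mon_F[of "c i" i] c[OF that] Rn_vzero by simp
  have "(\<Oplus>\<^bsub>FR.G\<^esub>i\<in>J. FR.cl (FE.wt i) (c i \<otimes> mon i)) = (\<Oplus>\<^bsub>FR.G\<^esub>i\<in>J. FR.cl vzero (c i) \<otimes>\<^bsub>FR.G\<^esub> FE.Y.mon i)"
    by (rule FE.comb_cl[symmetric]) (use c Rn_vzero in auto)
  also have "\<dots> = (\<Oplus>\<^bsub>FR.G\<^esub>i\<in>J. c' i \<otimes>\<^bsub>FR.G\<^esub> FE.Y.mon i)"
    by (rule FR.pr.S.finsum_cong'[OF refl])
      (use c J(2) FE.YL.smult_closed[unfolded Rn_vzero] in auto)
  finally have "(\<Oplus>\<^bsub>FR.G\<^esub>i\<in>J. FR.cl (FE.wt i) (c i \<otimes> mon i)) = \<zero>\<^bsub>FR.G\<^esub>" using J(4) by simp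
  then have low: "(\<Oplus>k\<in>{k\<in>J. FE.wt k = \<alpha>}. c k \<otimes> mon k) \<in> FR.Fp \<alpha>" if "\<alpha> \<in> Nvec 1" for \<alpha>
    using FR.finsum_cl_zero_iff[OF J(1), of FE.wt "\<lambda>i. c i \<otimes> mon i"] cF that by simp
  let ?T = "{k\<in>J. FE.wt k = FE.wt i}"
  have "FR.Fp (nvec1 (vw i)) \<subseteq> lspan R L {\<gamma>\<in>Nvec s. vw \<gamma> < vw i} mon"
    using Fp_nvec1[of "vw i"] lower_Rn[of "vw i"] additive_subgroup.zero_closed[OF left_family.lspan_additive[OF fam]]
    by auto
  then have mem: "(\<Oplus>k\<in>?T. c k \<otimes> mon k) \<in> lspan R L {\<gamma>\<in>Nvec s. vw \<gamma> < vw i} mon"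
    using low[of "FE.wt i"] unfolding wt_eq by auto
  have "c i = \<zero>"
  proof (rule ccontr)
    assume "c i \<noteq> \<zero>"
    then have "i \<in> {\<gamma>\<in>Nvec s. vw \<gamma> < vw i}"
      using left_family.lindep_support[OF fam indep _ _ _ _ mem, of i] J c by auto
    then show False by simp
  qed
  then show "c' i = \<zero>\<^bsub>FR.G\<^esub>" using c[OF J(5)] FE.cl_L_zero_iff[of \<zero>] Rn_vzero subringE(2)[OF L_sub] by simp
qed

text \<open>The remainder lies in \<open>Rn (w k - 1)\<close>, hence is 0 in the graded ring in
  degree \<open>w k\<close>. The swap relations lose their remainders in the same way.\<close>

lemma graded_base:
  assumes k: "k \<in> {1..s}" and a: "a \<in> FR.cl vzero ` L"
  shows "\<exists>a'\<in>FR.cl vzero ` L. y k \<otimes>\<^bsub>FR.G\<^esub> a = a' \<otimes>\<^bsub>FR.G\<^esub> y k"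
proof -
  obtain b where b: "b \<in> L" "a = FR.cl vzero b" using a by blast
  obtain b' r where b': "b' \<in> L" "r \<in> Rn (w k - 1)" "x k \<otimes> b = b' \<otimes> x k \<oplus> r"
    using rel1[OF k b(1)] lower_Rn[OF w_pos[OF k]] by auto
  have rc: "r \<in> carrier R" using Rn_carr[OF b'(2)] .
  have xk: "x k \<in> carrier R" using x_closed[OF k] .
  have m1: "x k \<otimes> b \<in> Rn (w k)" using Rn_mult[OF x_Rn[OF k], of b 0] b Rn_0 by simp
  have m2: "b' \<otimes> x k \<in> Rn (w k)" using Rn_smult[OF b'(1) x_Rn[OF k]] .
  have "x k \<otimes> b \<ominus> b' \<otimes> x k = r"
    unfolding b'(3) using xk rc L_carr[OF b'(1)] by (simp add: a_minus_def a_ac r_neg)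
  then have "x k \<otimes> b \<ominus> b' \<otimes> x k \<in> FR.Fp (nvec1 (w k))"
    using b'(2) w_pos[OF k] by (simp add: Fp_nvec1)
  then have "FR.cl (nvec1 (w k)) (x k \<otimes> b) = FR.cl (nvec1 (w k)) (b' \<otimes> x k)"
    using FR.cl_eq_iff[of "nvec1 (w k)" "x k \<otimes> b" "b' \<otimes> x k"] m1 m2 by simp
  moreover have "y k \<otimes>\<^bsub>FR.G\<^esub> a = FR.cl (nvec1 (w k)) (x k \<otimes> b)"
    unfolding y_def b(2) using FR.cl_mult[of "nvec1 (w k)" vzero "x k" b] x_Rn[OF k] b(1) Rn_vzero by simp
  moreover have "FR.cl vzero b' \<otimes>\<^bsub>FR.G\<^esub> y k = FR.cl (nvec1 (w k)) (b' \<otimes> x k)"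
    unfolding y_def using FR.cl_mult[of vzero "nvec1 (w k)" b' "x k"] x_Rn[OF k] b'(1) Rn_vzero by simp
  ultimately show ?thesis using b'(1) by (intro bexI[of _ "FR.cl vzero b'"]) auto
qed

lemma graded_rel:
  assumes ij: "1 \<le> i" "i < j" "j \<le> s"
  shows "FR.cl vzero (q j i) \<in> FR.cl vzero ` L \<and>
    y j \<otimes>\<^bsub>FR.G\<^esub> y i = FR.cl vzero (q j i) \<otimes>\<^bsub>FR.G\<^esub> y i \<otimes>\<^bsub>FR.G\<^esub> y j"
proof -
  have i: "i \<in> {1..s}" and j: "j \<in> {1..s}" using ij by auto
  let ?d = "nvec1 (w i + w j)"
  have d: "vadd (nvec1 (w i)) (nvec1 (w j)) = ?d" "vadd (nvec1 (w j)) (nvec1 (w i)) = ?d"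
    by (auto simp: vadd_def nvec1_def)
  obtain r where r: "q j i \<in> L" "r \<in> Rn (w i + w j - 1)" "x j \<otimes> x i = q j i \<otimes> x i \<otimes> x j \<oplus> r"
    using rel2[OF ij] lower_Rn[of "w i + w j"] w_pos[OF i] by auto
  have rc: "r \<in> carrier R" using Rn_carr[OF r(2)] .
  note xc = x_closed[OF i] x_closed[OF j] and xR = x_Rn[OF i] x_Rn[OF j]
  have qx: "q j i \<otimes> x i \<in> Rn (w i)" using Rn_smult[OF r(1) xR(1)] .
  have m1: "x j \<otimes> x i \<in> Rn (w i + w j)" using Rn_mult[OF xR(2,1)] by (simp add: add.commute)
  have m2: "q j i \<otimes> x i \<otimes> x j \<in> Rn (w i + w j)" using Rn_mult[OF qx xR(2)] .
  have "x j \<otimes> x i \<ominus> q j i \<otimes> x i \<otimes> x j = r"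
    unfolding r(3) using xc rc L_carr[OF r(1)] by (simp add: a_minus_def a_ac r_neg)
  then have "x j \<otimes> x i \<ominus> q j i \<otimes> x i \<otimes> x j \<in> FR.Fp ?d"
    using r(2) w_pos[OF i] by (simp add: Fp_nvec1)
  then have "FR.cl ?d (x j \<otimes> x i) = FR.cl ?d (q j i \<otimes> x i \<otimes> x j)"
    using FR.cl_eq_iff[of ?d "x j \<otimes> x i" "q j i \<otimes> x i \<otimes> x j"] m1 m2 by simp
  moreover have "y j \<otimes>\<^bsub>FR.G\<^esub> y i = FR.cl ?d (x j \<otimes> x i)"
    unfolding y_def using FR.cl_mult[of "nvec1 (w j)" "nvec1 (w i)" "x j" "x i"] xR d by simp
  moreover have "FR.cl vzero (q j i) \<otimes>\<^bsub>FR.G\<^esub> y i \<otimes>\<^bsub>FR.G\<^esub> y j = FR.cl ?d (q j i \<otimes> x i \<otimes> x j)"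
    unfolding y_def using FR.cl_mult[of vzero "nvec1 (w i)" "q j i" "x i"] r(1) Rn_vzero xR
      FR.cl_mult[of "nvec1 (w i)" "nvec1 (w j)" "q j i \<otimes> x i" "x j"] qx d by simp
  ultimately show ?thesis using r(1) by simp
qed

lemma graded_iter_ore_Rn: "graded_iter_ore R L 1 (\<lambda>\<alpha> \<beta>. \<alpha> 1 \<le> \<beta> 1) (\<lambda>\<alpha>. Rn (\<alpha> 1)) s q"
proof -
  let ?A = "FR.cl vzero ` L"
  have io: "gembed R 1 (\<lambda>\<alpha> \<beta>. \<alpha> 1 \<le> \<beta> 1) (\<lambda>\<alpha>. Rn (\<alpha> 1)) = FR.cl vzero" by (auto simp: gembed_def)
  have A: "subring ?A FR.G" using FE.LG_subring Rn_vzero by simp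
  interpret SK: skew_monomials FR.G y s ?A "\<lambda>j i. FR.cl vzero (q j i)"
    by (intro skew_monomials.intro skew_monomials_axioms.intro FE.Y.monomials_axioms A graded_base graded_rel)
  have stage: "ore_stage FR.G ?A y s = lspan FR.G ?A (Nvec s) FE.Y.mon"
    by (rule SK.ore_stage_eq_lspan) simp
  have "lspan FR.G ?A (Nvec s) FE.Y.mon \<subseteq> carrier FR.G"
    using FE.YL.lspan_carr Rn_vzero by auto
  then have 1: "carrier FR.G = ore_stage FR.G ?A y s" using stage graded_span by auto
  have 2: "\<exists>\<sigma>. ore_step FR.G (ore_stage FR.G ?A y (j - 1)) (y j) \<sigma> (ore_stage FR.G ?A y j) \<and>
      (\<forall>i\<in>{1..<j}. \<sigma> (y i) = FR.cl vzero (q j i) \<otimes>\<^bsub>FR.G\<^esub> y i)" if "j \<in> {1..s}" for j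
    by (rule SK.monomial_basis_iterated_ore[OF graded_lindep that])
  have 3: "homogeneous R 1 (\<lambda>\<alpha> \<beta>. \<alpha> 1 \<le> \<beta> 1) (\<lambda>\<alpha>. Rn (\<alpha> 1)) (y i)" if "i \<in> {1..s}" for i
    unfolding homogeneous_def y_def using x_Rn[OF that] nvec1_in[of "w i"] by (intro bexI[of _ "nvec1 (w i)"] bexI[of _ "x i"]) auto
  show ?thesis
    unfolding graded_iter_ore_def Let_def io
    by (intro exI[of _ y] conjI ballI 1 2 3 y_carr)
qed

end

section \<open>The equivalence\<close>

lemma presentation_of_filtration:
  fixes R :: "('r,'b) ring_scheme"
  assumes alg: "K_algebra K \<phi> R"
    and q: "\<And>i j. 1 \<le> i \<Longrightarrow> i < j \<Longrightarrow> j \<le> s \<Longrightarrow> q j i \<in> \<Lambda>"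
    and adm: "admissible_order n ordr" and filt: "is_filtration K \<phi> R n ordr F" and F0: "F vzero = \<Lambda>"
    and fg: "\<forall>\<alpha>\<in>Nvec n. fin_gen_left R \<Lambda> (F \<alpha>)" and gr: "graded_iter_ore R \<Lambda> n ordr F s q"
  shows "\<exists>x ordr' \<Gamma>2 \<Gamma>1. pbw_relations R \<Lambda> s q x ordr' \<Gamma>2 \<Gamma>1"
proof -
  interpret filtered_ring R n ordr F
    using alg filt adm unfolding K_algebra_def is_filtration_def K_submodule_def
    by (intro filtered_ring.intro filtered_ring_axioms.intro adm_order.intro) blast+
  have io: "gembed R n ordr F = cl vzero" by (auto simp: gembed_def)
  obtain y where hom: "\<forall>i\<in>{1..s}. y i \<in> carrier G \<and> homogeneous R n ordr F (y i)"
    and stage: "carrier G = ore_stage G (cl vzero ` \<Lambda>) y s"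
    and ore: "\<forall>j\<in>{1..s}. \<exists>\<sigma>. ore_step G (ore_stage G (cl vzero ` \<Lambda>) y (j - 1)) (y j) \<sigma> (ore_stage G (cl vzero ` \<Lambda>) y j) \<and>
          (\<forall>i\<in>{1..<j}. \<sigma> (y i) = cl vzero (q j i) \<otimes>\<^bsub>G\<^esub> y i)"
    using gr unfolding graded_iter_ore_def Let_def io by (elim exE conjE) rule
  \<comment> \<open>Degree and representative are chosen together, because the class 0 does not
    determine its degree.\<close>
  have "\<forall>i\<in>{1..s}. \<exists>p. fst p \<in> Nvec n \<and> snd p \<in> F (fst p) \<and> y i = cl (fst p) (snd p)"
    using hom unfolding homogeneous_def by (metis fst_conv snd_conv)
  from bchoice[OF this] obtain p where
    p: "\<forall>i\<in>{1..s}. fst (p i) \<in> Nvec n \<and> snd (p i) \<in> F (fst (p i)) \<and> y i = cl (fst (p i)) (snd (p i))" ..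
  interpret filtered_elements R n ordr F s "\<lambda>i. snd (p i)" "\<lambda>i. fst (p i)" y
    using p by (intro filtered_elements.intro filtered_elements_axioms.intro filtered_ring_axioms) auto
  have "(\<Union>\<alpha>\<in>Nvec n. F \<alpha>) = carrier R" using filt unfolding is_filtration_def by blast
  then show ?thesis
    unfolding F0[symmetric] by (intro presentation) (use fg q stage ore F0 in auto)
qed

lemma (in pbw_relations) filtration_of_presentation:
  assumes alg: "K_algebra K \<phi> R" and sub: "K_subalgebra K \<phi> R \<Lambda>"
    and q: "\<And>i j. 1 \<le> i \<Longrightarrow> i < j \<Longrightarrow> j \<le> s \<Longrightarrow> q j i \<in> \<Lambda>"
  shows "\<exists>Rn :: nat \<Rightarrow> 'r set.
        is_filtration K \<phi> R 1 (\<lambda>\<alpha> \<beta>. \<alpha> 1 \<le> \<beta> 1) (\<lambda>\<alpha>. Rn (\<alpha> 1)) \<and> Rn 0 = \<Lambda> \<and>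
        (\<forall>m. fin_gen_left R \<Lambda> (Rn m)) \<and>
        graded_iter_ore R \<Lambda> 1 (\<lambda>\<alpha> \<beta>. \<alpha> 1 \<le> \<beta> 1) (\<lambda>\<alpha>. Rn (\<alpha> 1)) s q"
proof -
  interpret ring R using alg unfolding K_algebra_def by blast
  have L: "subring \<Lambda> R" and \<phi>: "\<phi> ` carrier K \<subseteq> \<Lambda>" using sub unfolding K_subalgebra_def by auto
  interpret adm_order s ordr' by (rule adm_order.intro[OF adm])
  interpret X: monomials R x s using x by unfold_locales auto
  interpret XL: left_family R \<Lambda> "Nvec s" X.mon using X.mon_family[OF L] .
  define P where "P = {(i, j). 1 \<le> i \<and> i < j \<and> j \<le> s}"
  \<comment> \<open>The finitely many comparisons occurring in the relations; the weights are
    required to respect just these.\<close>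
  define D where "D = (\<Union>(i, j)\<in>P. (\<lambda>\<gamma>. (\<gamma>, vadd (unitvec i) (unitvec j))) ` \<Gamma>2 j i)
      \<union> (\<Union>k\<in>{1..s}. (\<lambda>\<gamma>. (\<gamma>, unitvec k)) ` \<Gamma>1 k)"
  have "P \<subseteq> {1..s} \<times> {1..s}" unfolding P_def by auto
  then have "finite P" by (rule finite_subset) simp
  then have "finite D" unfolding D_def using \<Gamma>2 \<Gamma>1 unfolding P_def by auto
  moreover have "u \<in> Nvec s \<and> v \<in> Nvec s \<and> prec u v" if "(u, v) \<in> D" for u v
    using that \<Gamma>2 \<Gamma>1 unfolding D_def P_def prec_def by auto
  ultimately obtain w where w: "\<forall>i\<in>{1..s}. 0 < w i" "\<forall>(u, v)\<in>D. vweight s w u < vweight s w v"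
    using exists_weight[of D] by blast
  have w2: "vweight s w \<gamma> < w i + w j" if "1 \<le> i" "i < j" "j \<le> s" "\<gamma> \<in> \<Gamma>2 j i" for i j \<gamma>
  proof -
    have "(\<gamma>, vadd (unitvec i) (unitvec j)) \<in> D" using that unfolding D_def P_def by blast
    then show ?thesis using w(2) that by (auto simp: vweight_vadd vweight_unitvec)
  qed
  have w1: "vweight s w \<gamma> < w k" if "k \<in> {1..s}" "\<gamma> \<in> \<Gamma>1 k" for k \<gamma>
  proof -
    have "(\<gamma>, unitvec k) \<in> D" using that unfolding D_def by blast
    then show ?thesis using w(2) that by (auto simp: vweight_unitvec)
  qed
  interpret W: weighted_presentation R x s \<Lambda> q w
  proof (intro weighted_presentation.intro weighted_presentation_axioms.intro X.monomials_axioms L)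
    show "carrier R \<subseteq> lspan R \<Lambda> (Nvec s) X.mon" "lindep R \<Lambda> (Nvec s) X.mon"
      using basis XL.left_basis_iff[OF zero_closed] by auto
    show "0 < w k" if "k \<in> {1..s}" for k using w(1) that by blast
  next
    fix i j assume ij: "1 \<le> i" "i < j" "j \<le> s"
    then obtain c where c: "\<forall>\<alpha>. c \<alpha> \<in> \<Lambda>" "x j \<otimes> x i = (q j i \<otimes> x i \<otimes> x j) \<oplus>
                finsum R (\<lambda>\<alpha>. c \<alpha> \<otimes> X.mon \<alpha>) (\<Gamma>2 j i)" using rel2 by blast
    have "finite (\<Gamma>2 j i)" "\<Gamma>2 j i \<subseteq> Nvec s" using \<Gamma>2 ij by blast+
    then have "finsum R (\<lambda>\<alpha>. c \<alpha> \<otimes> X.mon \<alpha>) (\<Gamma>2 j i) \<in> lspan R \<Lambda> {\<gamma>\<in>Nvec s. vweight s w \<gamma> < w i + w j} X.mon"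
      by (intro lspanI) (use c(1) w2[OF ij] in auto)
    then show "q j i \<in> \<Lambda> \<and> (\<exists>r\<in>lspan R \<Lambda> {\<gamma>\<in>Nvec s. vweight s w \<gamma> < w i + w j} X.mon.
        x j \<otimes> x i = q j i \<otimes> x i \<otimes> x j \<oplus> r)" using c(2) q[OF ij] by blast
  next
    fix k a assume k: "k \<in> {1..s}" and a: "a \<in> \<Lambda>"
    obtain a' c where c: "a' \<in> \<Lambda>" "\<forall>\<alpha>. c \<alpha> \<in> \<Lambda>" "x k \<otimes> a = (a' \<otimes> x k) \<oplus>
                finsum R (\<lambda>\<alpha>. c \<alpha> \<otimes> X.mon \<alpha>) (\<Gamma>1 k)" using rel1 a k by blast
    have "finsum R (\<lambda>\<alpha>. c \<alpha> \<otimes> X.mon \<alpha>) (\<Gamma>1 k) \<in> lspan R \<Lambda> {\<gamma>\<in>Nvec s. vweight s w \<gamma> < w k} X.mon"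
      by (rule lspanI) (use c(2) w1[OF k] \<Gamma>1 k in auto)
    then show "\<exists>a'\<in>\<Lambda>. \<exists>r\<in>lspan R \<Lambda> {\<gamma>\<in>Nvec s. vweight s w \<gamma> < w k} X.mon. x k \<otimes> a = a' \<otimes> x k \<oplus> r"
      using c(1,3) by blast
  qed
  have "is_filtration K \<phi> R 1 (\<lambda>\<alpha> \<beta>. \<alpha> 1 \<le> \<beta> 1) (\<lambda>\<alpha>. W.Rn (\<alpha> 1))"
    unfolding is_filtration_def K_submodule_def
  proof (intro conjI ballI impI)
    show "(\<Union>\<alpha>\<in>Nvec 1. W.Rn (\<alpha> 1)) = carrier R"
    proof
      show "carrier R \<subseteq> (\<Union>\<alpha>\<in>Nvec 1. W.Rn (\<alpha> 1))"
      proof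
        fix r assume "r \<in> carrier R"
        then obtain m where "r \<in> W.Rn m" using W.Rn_exhaust by blast
        then show "r \<in> (\<Union>\<alpha>\<in>Nvec 1. W.Rn (\<alpha> 1))" by (intro UN_I[of "nvec1 m"]) auto
      qed
    qed (use W.Rn_carr in auto)
  next
    fix \<alpha> k m assume "k \<in> carrier K" "m \<in> W.Rn (\<alpha> 1)"
    then show "\<phi> k \<otimes> m \<in> W.Rn (\<alpha> 1)" using W.Rn_smult \<phi> by blast
  next
    show "\<one> \<in> W.Rn (vzero 1)" by (rule W.FR.F_one)
  qed (use W.Rn_add W.Rn_mono W.FR.F_mult in auto)
  then show ?thesis
    using W.Rn_0 W.Rn_fin_gen W.graded_iter_ore_Rn by blast
qed

theorem theorem1:
  fixes K :: "('k,'c) ring_scheme" and \<phi> :: "'k \<Rightarrow> 'r" and R :: "('r,'b) ring_scheme"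
    and \<Lambda> :: "'r set" and s :: nat and q :: "nat \<Rightarrow> nat \<Rightarrow> 'r"
  assumes alg: "K_algebra K \<phi> R"
    and sub: "K_subalgebra K \<phi> R \<Lambda>"
    and noeth: "left_noetherian R \<Lambda>"
    and spos: "0 < s"
    and qin: "\<And>i j. 1 \<le> i \<Longrightarrow> i < j \<Longrightarrow> j \<le> s \<Longrightarrow> q j i \<in> \<Lambda>"
  shows
   "((\<exists>n ordr F. admissible_order n ordr \<and> is_filtration K \<phi> R n ordr F \<and> F vzero = \<Lambda> \<and>
        (\<forall>\<alpha>\<in>Nvec n. fin_gen_left R \<Lambda> (F \<alpha>)) \<and> graded_iter_ore R \<Lambda> n ordr F s q)
     \<longleftrightarrow>
     (\<exists>Rn :: nat \<Rightarrow> 'r set.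
        is_filtration K \<phi> R 1 (\<lambda>\<alpha> \<beta>. \<alpha> 1 \<le> \<beta> 1) (\<lambda>\<alpha>. Rn (\<alpha> 1)) \<and> Rn 0 = \<Lambda> \<and>
        (\<forall>m. fin_gen_left R \<Lambda> (Rn m)) \<and>
        graded_iter_ore R \<Lambda> 1 (\<lambda>\<alpha> \<beta>. \<alpha> 1 \<le> \<beta> 1) (\<lambda>\<alpha>. Rn (\<alpha> 1)) s q))
   \<and>
   ((\<exists>Rn :: nat \<Rightarrow> 'r set.
        is_filtration K \<phi> R 1 (\<lambda>\<alpha> \<beta>. \<alpha> 1 \<le> \<beta> 1) (\<lambda>\<alpha>. Rn (\<alpha> 1)) \<and> Rn 0 = \<Lambda> \<and>
        (\<forall>m. fin_gen_left R \<Lambda> (Rn m)) \<and>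
        graded_iter_ore R \<Lambda> 1 (\<lambda>\<alpha> \<beta>. \<alpha> 1 \<le> \<beta> 1) (\<lambda>\<alpha>. Rn (\<alpha> 1)) s q)
     \<longleftrightarrow>
     (\<exists>(x :: nat \<Rightarrow> 'r) ordr' (\<Gamma>2 :: nat \<Rightarrow> nat \<Rightarrow> (nat \<Rightarrow> nat) set) (\<Gamma>1 :: nat \<Rightarrow> (nat \<Rightarrow> nat) set).
        (\<forall>k\<in>{1..s}. x k \<in> carrier R) \<and>
        admissible_order s ordr' \<and>
        (\<forall>i j. 1 \<le> i \<and> i < j \<and> j \<le> s \<longrightarrow>
           finite (\<Gamma>2 j i) \<and> \<Gamma>2 j i \<subseteq> Nvec s \<and>
           (\<forall>\<gamma>\<in>\<Gamma>2 j i. ordr' \<gamma> (vadd (unitvec i) (unitvec j)) \<and> \<gamma> \<noteq> vadd (unitvec i) (unitvec j))) \<and>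
        (\<forall>k\<in>{1..s}. finite (\<Gamma>1 k) \<and> \<Gamma>1 k \<subseteq> Nvec s \<and>
           (\<forall>\<gamma>\<in>\<Gamma>1 k. ordr' \<gamma> (unitvec k) \<and> \<gamma> \<noteq> unitvec k)) \<and>
        left_basis R \<Lambda> (Nvec s) (std_monom R x s) (carrier R) \<and>
        (\<forall>i j. 1 \<le> i \<and> i < j \<and> j \<le> s \<longrightarrow>
           (\<exists>c. (\<forall>\<alpha>. c \<alpha> \<in> \<Lambda>) \<and>
              x j \<otimes>\<^bsub>R\<^esub> x i = (q j i \<otimes>\<^bsub>R\<^esub> x i \<otimes>\<^bsub>R\<^esub> x j) \<oplus>\<^bsub>R\<^esub>
                finsum R (\<lambda>\<alpha>. c \<alpha> \<otimes>\<^bsub>R\<^esub> std_monom R x s \<alpha>) (\<Gamma>2 j i))) \<and>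
        (\<forall>a\<in>\<Lambda>. \<forall>k\<in>{1..s}. \<exists>a'\<in>\<Lambda>. \<exists>c. (\<forall>\<alpha>. c \<alpha> \<in> \<Lambda>) \<and>
              x k \<otimes>\<^bsub>R\<^esub> a = (a' \<otimes>\<^bsub>R\<^esub> x k) \<oplus>\<^bsub>R\<^esub>
                finsum R (\<lambda>\<alpha>. c \<alpha> \<otimes>\<^bsub>R\<^esub> std_monom R x s \<alpha>) (\<Gamma>1 k))))"
proof -
  let ?i = "\<exists>n ordr F. admissible_order n ordr \<and> is_filtration K \<phi> R n ordr F \<and> F vzero = \<Lambda> \<and>
        (\<forall>\<alpha>\<in>Nvec n. fin_gen_left R \<Lambda> (F \<alpha>)) \<and> graded_iter_ore R \<Lambda> n ordr F s q"
  let ?ii = "\<exists>Rn :: nat \<Rightarrow> 'r set.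
        is_filtration K \<phi> R 1 (\<lambda>\<alpha> \<beta>. \<alpha> 1 \<le> \<beta> 1) (\<lambda>\<alpha>. Rn (\<alpha> 1)) \<and> Rn 0 = \<Lambda> \<and>
        (\<forall>m. fin_gen_left R \<Lambda> (Rn m)) \<and>
        graded_iter_ore R \<Lambda> 1 (\<lambda>\<alpha> \<beta>. \<alpha> 1 \<le> \<beta> 1) (\<lambda>\<alpha>. Rn (\<alpha> 1)) s q"
  let ?iii = "\<exists>x ordr' \<Gamma>2 \<Gamma>1. pbw_relations R \<Lambda> s q x ordr' \<Gamma>2 \<Gamma>1"
  \<comment> \<open>The implications form the cycle (i), (iii), (ii), (i); both equivalences are
    read off from it.\<close>
  have 1: "?i \<Longrightarrow> ?iii"
    using presentation_of_filtration[where q = q and \<Lambda> = \<Lambda>, OF alg qin] by (elim exE conjE)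
  have 2: "?iii \<Longrightarrow> ?ii"
    by (elim exE) (rule pbw_relations.filtration_of_presentation[OF _ alg sub qin])
  have 3: "?ii \<Longrightarrow> ?i"
  proof -
    assume ?ii
    then obtain Rn :: "nat \<Rightarrow> 'r set" where Rn:
      "is_filtration K \<phi> R 1 (\<lambda>\<alpha> \<beta>. \<alpha> 1 \<le> \<beta> 1) (\<lambda>\<alpha>. Rn (\<alpha> 1))" "Rn 0 = \<Lambda>"
      "\<forall>m. fin_gen_left R \<Lambda> (Rn m)" "graded_iter_ore R \<Lambda> 1 (\<lambda>\<alpha> \<beta>. \<alpha> 1 \<le> \<beta> 1) (\<lambda>\<alpha>. Rn (\<alpha> 1)) s q"
      by (elim exE conjE)
    then show ?i
      by (intro exI[of _ 1] exI[of _ "\<lambda>\<alpha> \<beta>. \<alpha> 1 \<le> \<beta> 1"] exI[of _ "\<lambda>\<alpha>. Rn (\<alpha> 1)"] conjI admissible_order_nat)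
        (simp_all add: vzero_def)
  qed
  have "?i \<longleftrightarrow> ?ii"
  proof
    assume ?i
    then show ?ii by (rule 2[OF 1])
  qed (rule 3)
  moreover have "?ii \<longleftrightarrow> ?iii"
  proof
    assume ?ii
    then show ?iii by (rule 1[OF 3])
  qed (rule 2)
  ultimately show ?thesis unfolding pbw_relations_def conj_assoc by (rule conjI)
qed

end
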